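(* There is an absolute constant $C>0$ such that the following holds. Suppose $P$ is weakly communicating, let $s_0\in\mathcal S$ be arbitrary, $\eta=1/n$ and $\xi=\frac{1}{2n^2}$, and let $\widehat\pi$ be a Blackwell-optimal policy of $(\underline{\widehat P},\widetilde r)$. Then for every $\delta\in(0,1)$, with probability at least $1-\delta$, $$\rho^\star-\rho^{\widehat\pi}\le\sqrt{\frac{C\log^3\!\big(\frac{SAn}{\delta}\big)}{n}\Big(\|h^\star\|_{\mathrm{sp}}+\min\{\|\underline{\widehat h}^{\widehat\pi}\|_{\mathrm{sp}},\|\underline h^{\widehat\pi}\|_{\mathrm{sp}}\}+1\Big)}\;\mathbf 1 .$$
   Context: $\mathcal S$ finite with $S$ states, $\mathcal A$ finite with $A$ actions; transition kernel $P$; known reward $r:\mathcal S\times\mathcal A\to[0,1]$. Empirical kernel $\widehat P$: $n$ i.i.d. samples from each $P(\cdot|s,a)$, independent across pairs, $\widehat P(s'|s,a)$ = fraction equal to $s'$. Anchored kernels $\underline{\widehat P}(s'|s,a)=(1-\eta)\widehat P(s'|s,a)+\eta\mathbb 1\{s'=s_0\}$, $\underline P(s'|s,a)=(1-\eta)P(s'|s,a)+\eta\mathbb 1\{s'=s_0\}$. Perturbed reward $\widetilde r=r+\Delta$, $\Delta(s,a)$ i.i.d. Uniform$[0,\xi]$ independent of the samples. Gain $\rho^\pi=P^\infty_\pi r_\pi$, bias $h^\pi=\mathrm{C\text{-}lim}_T\sum_{t<T}(P_\pi^tr_\pi-\rho^\pi)$. Blackwell-optimal for $(Q,\tilde r)$: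 deterministic policy maximizing $(I-\gamma Q_\pi)^{-1}\tilde r_\pi$ for all $\gamma$ in some $[\bar\gamma,1)$. $\rho^\star,h^\star$: gain and bias of a Blackwell-optimal policy of $(P,r)$. $\underline{\widehat h}^{\pi}$ and $\underline h^\pi$: biases of $\pi$ in $(\underline{\widehat P},r)$ and $(\underline P,r)$ respectively (unperturbed reward). $\|x\|_{\mathrm{sp}}=\max x-\min x$. Weakly communicating: states split into states transient under every stationary policy and a set where every state is reachable from every other. *)

theory Defs
  imports "HOL-Probability.Probability"
begin

text \<open>Finite MDPs with state set {..<S} and action set {..<A} (natural-number carriers,
so that the constant C can be quantified uniformly over all S, A).
A kernel K s a s' is the probability of moving to s' from s under action a.
Deterministic stationary policies are maps p with p s < A for s < S.\<close>

definition is_policy :: "nat \<Rightarrow> nat \<Rightarrow> (nat \<Rightarrow> nat) \<Rightarrow> bool" where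
  "is_policy S A p \<longleftrightarrow> (\<forall>s<S. p s < A)"

definition Ppol :: "nat \<Rightarrow> (nat \<Rightarrow> nat \<Rightarrow> nat \<Rightarrow> real) \<Rightarrow> (nat \<Rightarrow> nat) \<Rightarrow> (nat \<Rightarrow> real) \<Rightarrow> nat \<Rightarrow> real" where
  "Ppol S K p v = (\<lambda>s. \<Sum>s'<S. K s (p s) s' * v s')"

definition rpol :: "(nat \<Rightarrow> nat \<Rightarrow> real) \<Rightarrow> (nat \<Rightarrow> nat) \<Rightarrow> nat \<Rightarrow> real" where
  "rpol r p = (\<lambda>s. r s (p s))"

definition Ppow_r :: "nat \<Rightarrow> (nat \<Rightarrow> nat \<Rightarrow> nat \<Rightarrow> real) \<Rightarrow> (nat \<Rightarrow> nat \<Rightarrow> real) \<Rightarrow> (nat \<Rightarrow> nat) \<Rightarrow> nat \<Rightarrow> nat \<Rightarrow> real" where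
  "Ppow_r S K r p t = (Ppol S K p ^^ t) (rpol r p)"

definition gain :: "nat \<Rightarrow> (nat \<Rightarrow> nat \<Rightarrow> nat \<Rightarrow> real) \<Rightarrow> (nat \<Rightarrow> nat \<Rightarrow> real) \<Rightarrow> (nat \<Rightarrow> nat) \<Rightarrow> nat \<Rightarrow> real" where
  "gain S K r p s = lim (\<lambda>T. (\<Sum>t<T. Ppow_r S K r p t s) / real T)"

definition bias :: "nat \<Rightarrow> (nat \<Rightarrow> nat \<Rightarrow> nat \<Rightarrow> real) \<Rightarrow> (nat \<Rightarrow> nat \<Rightarrow> real) \<Rightarrow> (nat \<Rightarrow> nat) \<Rightarrow> nat \<Rightarrow> real" where
  "bias S K r p s = lim (\<lambda>N. (\<Sum>T\<in>{1..N}. \<Sum>t<T. (Ppow_r S K r p t s - gain S K r p s)) / real N)"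

text \<open>Discounted value (I - gamma Q_pi)^{-1} r_pi, written as its Neumann series.\<close>
definition disc_value :: "nat \<Rightarrow> (nat \<Rightarrow> nat \<Rightarrow> nat \<Rightarrow> real) \<Rightarrow> (nat \<Rightarrow> nat \<Rightarrow> real) \<Rightarrow> (nat \<Rightarrow> nat) \<Rightarrow> real \<Rightarrow> nat \<Rightarrow> real" where
  "disc_value S K r p \<gamma> s = (\<Sum>t. \<gamma> ^ t * Ppow_r S K r p t s)"

definition blackwell_optimal :: "nat \<Rightarrow> nat \<Rightarrow> (nat \<Rightarrow> nat \<Rightarrow> nat \<Rightarrow> real) \<Rightarrow> (nat \<Rightarrow> nat \<Rightarrow> real) \<Rightarrow> (nat \<Rightarrow> nat) \<Rightarrow> bool" where
  "blackwell_optimal S A K r p \<longleftrightarrow> is_policy S A p \<and>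
     (\<exists>\<gamma>0<1. \<forall>\<gamma>. \<gamma>0 \<le> \<gamma> \<and> \<gamma> < 1 \<longrightarrow>
        (\<forall>q. is_policy S A q \<longrightarrow> (\<forall>s<S. disc_value S K r q \<gamma> s \<le> disc_value S K r p \<gamma> s)))"

definition opt_gain :: "nat \<Rightarrow> nat \<Rightarrow> (nat \<Rightarrow> nat \<Rightarrow> nat \<Rightarrow> real) \<Rightarrow> (nat \<Rightarrow> nat \<Rightarrow> real) \<Rightarrow> nat \<Rightarrow> real" where
  "opt_gain S A K r = gain S K r (SOME p. blackwell_optimal S A K r p)"

definition opt_bias :: "nat \<Rightarrow> nat \<Rightarrow> (nat \<Rightarrow> nat \<Rightarrow> nat \<Rightarrow> real) \<Rightarrow> (nat \<Rightarrow> nat \<Rightarrow> real) \<Rightarrow> nat \<Rightarrow> real" where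
  "opt_bias S A K r = bias S K r (SOME p. blackwell_optimal S A K r p)"

definition span :: "nat \<Rightarrow> (nat \<Rightarrow> real) \<Rightarrow> real" where
  "span S v = Max (v ` {..<S}) - Min (v ` {..<S})"

definition stationary_policy :: "nat \<Rightarrow> nat \<Rightarrow> (nat \<Rightarrow> nat \<Rightarrow> real) \<Rightarrow> bool" where
  "stationary_policy S A mu \<longleftrightarrow> (\<forall>s<S. (\<forall>a<A. 0 \<le> mu s a) \<and> (\<Sum>a<A. mu s a) = 1)"

definition chain_edge :: "nat \<Rightarrow> nat \<Rightarrow> (nat \<Rightarrow> nat \<Rightarrow> nat \<Rightarrow> real) \<Rightarrow> (nat \<Rightarrow> nat \<Rightarrow> real) \<Rightarrow> nat \<Rightarrow> nat \<Rightarrow> bool" where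
  "chain_edge S A K mu s s' \<longleftrightarrow> s < S \<and> s' < S \<and> (\<exists>a<A. mu s a > 0 \<and> K s a s' > 0)"

text \<open>A state of a finite Markov chain is transient iff it can reach a state from which it is
not reachable.\<close>
definition transient_under :: "nat \<Rightarrow> nat \<Rightarrow> (nat \<Rightarrow> nat \<Rightarrow> nat \<Rightarrow> real) \<Rightarrow> (nat \<Rightarrow> nat \<Rightarrow> real) \<Rightarrow> nat \<Rightarrow> bool" where
  "transient_under S A K mu s \<longleftrightarrow>
     (\<exists>s'. (chain_edge S A K mu)\<^sup>*\<^sup>* s s' \<and> \<not> (chain_edge S A K mu)\<^sup>*\<^sup>* s' s)"

definition mdp_edge :: "nat \<Rightarrow> nat \<Rightarrow> (nat \<Rightarrow> nat \<Rightarrow> nat \<Rightarrow> real) \<Rightarrow> nat \<Rightarrow> nat \<Rightarrow> bool" where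
  "mdp_edge S A K s s' \<longleftrightarrow> s < S \<and> s' < S \<and> (\<exists>a<A. K s a s' > 0)"

definition weakly_communicating :: "nat \<Rightarrow> nat \<Rightarrow> (nat \<Rightarrow> nat \<Rightarrow> nat \<Rightarrow> real) \<Rightarrow> bool" where
  "weakly_communicating S A K \<longleftrightarrow>
     (\<exists>Tr Cl. Tr \<inter> Cl = {} \<and> Tr \<union> Cl = {..<S} \<and>
        (\<forall>s\<in>Tr. \<forall>mu. stationary_policy S A mu \<longrightarrow> transient_under S A K mu s) \<and>
        (\<forall>s\<in>Cl. \<forall>s'\<in>Cl. (mdp_edge S A K)\<^sup>*\<^sup>* s s'))"

definition pmf_kernel :: "(nat \<Rightarrow> nat \<Rightarrow> nat pmf) \<Rightarrow> nat \<Rightarrow> nat \<Rightarrow> nat \<Rightarrow> real" where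
  "pmf_kernel P s a s' = pmf (P s a) s'"

definition emp_kernel :: "nat \<Rightarrow> (nat \<times> nat \<times> nat \<Rightarrow> nat) \<Rightarrow> nat \<Rightarrow> nat \<Rightarrow> nat \<Rightarrow> real" where
  "emp_kernel n X s a s' = real (card {i. i < n \<and> X (s, a, i) = s'}) / real n"

definition anchor :: "nat \<Rightarrow> real \<Rightarrow> (nat \<Rightarrow> nat \<Rightarrow> nat \<Rightarrow> real) \<Rightarrow> nat \<Rightarrow> nat \<Rightarrow> nat \<Rightarrow> real" where
  "anchor s0 \<eta> K s a s' = (1 - \<eta>) * K s a s' + \<eta> * (if s' = s0 then 1 else 0)"

definition perturb :: "(nat \<Rightarrow> nat \<Rightarrow> real) \<Rightarrow> (nat \<times> nat \<Rightarrow> real) \<Rightarrow> nat \<Rightarrow> nat \<Rightarrow> real" where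
  "perturb r D s a = r s a + D (s, a)"

definition sample_space :: "nat \<Rightarrow> nat \<Rightarrow> nat \<Rightarrow> (nat \<Rightarrow> nat \<Rightarrow> nat pmf) \<Rightarrow> real
     \<Rightarrow> ((nat \<times> nat \<times> nat \<Rightarrow> nat) \<times> (nat \<times> nat \<Rightarrow> real)) measure" where
  "sample_space S A n P \<xi> =
     (PiM ({..<S} \<times> {..<A} \<times> {..<n}) (\<lambda>(s, a, i). measure_pmf (P s a)))
     \<Otimes>\<^sub>M (PiM ({..<S} \<times> {..<A}) (\<lambda>_. uniform_measure lborel {0..\<xi>}))"

end

theory Submission
  imports Defs
begin

text \<open>Anchoring with weight \<open>1/n\<close> turns the average-reward problem into a discounted one with factor
  \<open>\<gamma> = 1 - 1/n\<close>: a Blackwell-optimal policy of the anchored empirical model is \<open>\<gamma>\<close>-optimal for the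
  empirical kernel, and the span of its anchored bias is the span of its \<open>\<gamma>\<close>-discounted value. For the
  Blackwell-optimal policy of the true model the discounted value is within \<open>\<parallel>h\<parallel>\<close> of \<open>n \<rho>\<close>, and the gain of
  any policy dominates \<open>(1 - \<gamma>)\<close> times its minimal discounted value, so it suffices to compare discounted
  values at horizon \<open>n\<close> up to an error of order \<open>sqrt (n * span)\<close>.

  If \<open>V\<close> is the value of a policy under one kernel and the other kernel satisfies a Bernstein bound at \<open>V\<close>,
  a quadratic Lyapunov function in \<open>V\<close> shows that the two values differ by \<open>O(L sqrt (n (span V + 1)))\<close>.
  The Bernstein bound at the data-dependent values is obtained by leave-one-out: at a state-action pair the
  transition row is removed and replaced by a terminal reward \<open>u\<close> from a finite net. The empirical optimal
  value is 1-Lipschitz in \<open>u\<close>, and the reward perturbation creates an action gap that makes the empirical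
  optimal policy itself equal to the optimal policy for a net point.\<close>

subsection \<open>Discounted policy evaluation\<close>

text \<open>The output policy is correlated with the samples, and nothing bounds its bias span in
  advance, so its evaluation has to be controlled by a span that it generates itself. The comparison
  of two evaluations can start from either model: from the true values, with variances under the
  empirical rows, or from the empirical values, with variances under the true rows. This is where
  the minimum of two spans comes from. The two runs need different forms of leave-one-out. For the
  empirical values it is enough to be close to a net point, because a small change of the vector is
  harmless. The true values of the output policy depend on the samples through the policy alone, a
  discrete object for which closeness is of no help; the policy must be recovered exactly, which is
  why ties have to be excluded. Mesh and tie width may be polynomially small, since the number of
  net points enters only through the logarithm L. The argument yields L^2 under the root; one more
  logarithm absorbs constants, as \<open>ln x\<close> is at least 1/2 whenever there are two
  actions.\<close>

definition expct :: "nat \<Rightarrow> (nat \<Rightarrow> real) \<Rightarrow> (nat \<Rightarrow> real) \<Rightarrow> real" where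
  "expct S k v = (\<Sum>s<S. k s * v s)"

definition substoch :: "nat \<Rightarrow> (nat \<Rightarrow> real) \<Rightarrow> bool" where
  "substoch S k \<longleftrightarrow> (\<forall>s<S. 0 \<le> k s) \<and> sum k {..<S} \<le> 1"

definition stoch :: "nat \<Rightarrow> (nat \<Rightarrow> real) \<Rightarrow> bool" where
  "stoch S k \<longleftrightarrow> (\<forall>s<S. 0 \<le> k s) \<and> sum k {..<S} = 1"

definition subchain :: "nat \<Rightarrow> (nat \<Rightarrow> nat \<Rightarrow> nat \<Rightarrow> real) \<Rightarrow> (nat \<Rightarrow> nat) \<Rightarrow> bool" where
  "subchain S K q \<longleftrightarrow> (\<forall>s<S. substoch S (K s (q s)))"

lemma subchainD: "subchain S K q \<Longrightarrow> s < S \<Longrightarrow> substoch S (K s (q s))"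
  by (simp add: subchain_def)

lemma stoch_imp_substoch: "stoch S k \<Longrightarrow> substoch S k"
  by (simp add: stoch_def substoch_def)

lemma Ppol_expct: "Ppol S K q v s = expct S (K s (q s)) v"
  by (simp add: Ppol_def expct_def)

lemma expct_mono: "substoch S k \<Longrightarrow> (\<And>s. s < S \<Longrightarrow> v s \<le> w s) \<Longrightarrow> expct S k v \<le> expct S k w"
  unfolding expct_def substoch_def by (intro sum_mono mult_left_mono) auto

lemma expct_add: "expct S k (\<lambda>s. v s + w s) = expct S k v + expct S k w"
  by (simp add: expct_def distrib_left sum.distrib)

lemma expct_diff: "expct S k (\<lambda>s. v s - w s) = expct S k v - expct S k w"
  by (simp add: expct_def right_diff_distrib sum_subtractf)

lemma expct_cmult: "expct S k (\<lambda>s. c * v s) = c * expct S k v"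
  by (simp add: expct_def sum_distrib_left mult_ac)

lemma expct_sum: "expct S k (\<lambda>s. \<Sum>i\<in>I. f i s) = (\<Sum>i\<in>I. expct S k (f i))"
  unfolding expct_def by (subst sum.swap) (simp add: sum_distrib_left)

lemma expct_const: "stoch S k \<Longrightarrow> expct S k (\<lambda>s. c) = c"
  by (simp add: expct_def stoch_def flip: sum_distrib_right)

lemma expct_cong: "(\<And>s. s < S \<Longrightarrow> v s = w s) \<Longrightarrow> expct S k v = expct S k w"
  by (simp add: expct_def)

lemma expct_le_const:
  assumes "substoch S k" "\<And>s. s < S \<Longrightarrow> v s \<le> c" "0 \<le> c"
  shows "expct S k v \<le> c"
proof -
  have "expct S k v \<le> (\<Sum>s<S. k s * c)"
    unfolding expct_def using assms by (intro sum_mono mult_left_mono) (auto simp: substoch_def)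
  also have "\<dots> = sum k {..<S} * c" by (simp add: sum_distrib_right)
  also have "\<dots> \<le> 1 * c" using assms by (intro mult_right_mono) (auto simp: substoch_def)
  finally show ?thesis by simp
qed

lemma expct_abs_le:
  assumes "substoch S k" "\<And>s. s < S \<Longrightarrow> \<bar>v s\<bar> \<le> w s"
  shows "\<bar>expct S k v\<bar> \<le> expct S k w"
proof -
  have "expct S k v \<le> expct S k w" using assms by (intro expct_mono) (auto simp: abs_le_iff)
  moreover have "- expct S k v = expct S k (\<lambda>s. - 1 * v s)" unfolding expct_cmult by simp
  moreover have "expct S k (\<lambda>s. - 1 * v s) \<le> expct S k w"
    using assms by (intro expct_mono) (auto simp: abs_le_iff)
  ultimately show ?thesis by linarith
qed

lemma expct_nonneg: "substoch S k \<Longrightarrow> (\<And>s. s < S \<Longrightarrow> 0 \<le> v s) \<Longrightarrow> 0 \<le> expct S k v"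
  unfolding expct_def substoch_def by (intro sum_nonneg mult_nonneg_nonneg) auto

lemma expct_ge_const:
  assumes "stoch S k" "\<And>s. s < S \<Longrightarrow> c \<le> v s"
  shows "c \<le> expct S k v"
  using expct_mono[OF stoch_imp_substoch[OF assms(1)], of "\<lambda>_. c" v] assms expct_const[of S k c] by simp

lemma expct_le_const':
  assumes "stoch S k" "\<And>s. s < S \<Longrightarrow> v s \<le> c"
  shows "expct S k v \<le> c"
  using expct_mono[OF stoch_imp_substoch[OF assms(1)], of v "\<lambda>_. c"] assms expct_const[of S k c] by simp

text \<open>Read the inequality at a maximizer of \<open>w\<close>: an average cannot exceed the
  maximum m, so (1 - \<gamma>) m \<le> \<kappa>. Comparison, uniqueness and perturbation of values
  all reduce to this.\<close>

lemma discounted_max_principle: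
  assumes sub: "\<And>s. s < S \<Longrightarrow> substoch S (M s)" and g: "0 \<le> \<gamma>" "\<gamma> < 1" and k: "0 \<le> \<kappa>"
    and le: "\<And>s. s < S \<Longrightarrow> w s \<le> \<gamma> * expct S (M s) w + \<kappa>" and s: "s < S"
  shows "w s \<le> \<kappa> / (1 - \<gamma>)"
proof -
  define m where "m = Max (w ` {..<S})"
  have ub: "w i \<le> m" if "i < S" for i unfolding m_def using that by (intro Max_ge) auto
  have "m \<in> w ` {..<S}" unfolding m_def using s by (intro Max_in) auto
  then obtain i where i: "i < S" "w i = m" by auto
  show ?thesis
  \<comment> \<open>For a row of mass below one the average is bounded by the maximum only if the
    maximum is nonnegative; a negative maximum satisfies the bound trivially.\<close>
  proof (cases "m \<ge> 0")
    case True
    have "m \<le> \<gamma> * expct S (M i) w + \<kappa>" using le[OF i(1)] i by simp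
    also have "\<dots> \<le> \<gamma> * m + \<kappa>"
      using expct_le_const[OF sub[OF i(1)] ub True] g by (intro add_right_mono mult_left_mono) auto
    finally have "m * (1 - \<gamma>) \<le> \<kappa>" by (simp add: algebra_simps)
    then have "m \<le> \<kappa> / (1 - \<gamma>)" using g by (simp add: field_simps)
    then show ?thesis using ub[OF s] by linarith
  next
    case False
    then show ?thesis using ub[OF s] g k by (smt (verit) divide_nonneg_pos)
  qed
qed

lemma Ppow_r_0: "Ppow_r S K r q 0 = rpol r q"
  by (simp add: Ppow_r_def)

lemma Ppow_r_Suc: "Ppow_r S K r q (Suc t) = Ppol S K q (Ppow_r S K r q t)"
  by (simp add: Ppow_r_def)

lemma Ppow_r_bound:
  assumes sub: "subchain S K q" and R: "\<And>s. s < S \<Longrightarrow> \<bar>r s (q s)\<bar> \<le> R"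
    and s: "s < S"
  shows "\<bar>Ppow_r S K r q t s\<bar> \<le> R"
  using s
proof (induction t arbitrary: s)
  case 0
  then show ?case using R by (simp add: Ppow_r_0 rpol_def)
next
  case (Suc t)
  have "0 \<le> R" using R[OF Suc.prems] by linarith
  have "\<bar>expct S (K s (q s)) (Ppow_r S K r q t)\<bar> \<le> expct S (K s (q s)) (\<lambda>_. R)"
    using Suc by (intro expct_abs_le subchainD[OF sub]) auto
  also have "\<dots> \<le> R" using \<open>0 \<le> R\<close> by (intro expct_le_const subchainD[OF sub] Suc) auto
  finally show ?case by (simp add: Ppow_r_Suc Ppol_expct)
qed

lemma exists_reward_bound: "\<exists>R\<ge>0. \<forall>s<S::nat. \<bar>r s (q s :: nat)\<bar> \<le> (R :: real)"
proof (intro exI[of _ "\<Sum>s<S. \<bar>r s (q s)\<bar>"] conjI allI impI sum_nonneg)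
  fix s assume "s < S"
  then show "\<bar>r s (q s)\<bar> \<le> (\<Sum>s<S. \<bar>r s (q s)\<bar>)"
    by (intro member_le_sum) auto
qed auto

lemma disc_summable:
  assumes sub: "subchain S K q" and g: "0 \<le> \<gamma>" "\<gamma> < 1" and s: "s < S"
  shows "summable (\<lambda>t. \<gamma> ^ t * Ppow_r S K r q t s)"
proof -
  obtain R where R: "\<forall>s<S. \<bar>r s (q s)\<bar> \<le> R" using exists_reward_bound[of S r q] by blast
  show ?thesis
  proof (rule summable_comparison_test')
    show "summable (\<lambda>t. R * \<gamma> ^ t)" using g by (intro summable_mult summable_geometric) auto
    fix t :: nat assume "t \<ge> 0"
    show "norm (\<gamma> ^ t * Ppow_r S K r q t s) \<le> R * \<gamma> ^ t"
      using mult_left_mono[OF Ppow_r_bound[where S = S and K = K and q = q and r = r and R = R and s = s and t = t, OF sub], of "\<gamma>^t"] g R s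
      by (simp add: abs_mult mult.commute)
  qed
qed

lemma disc_value_fixed_point:
  assumes sub: "subchain S K q" and g: "0 \<le> \<gamma>" "\<gamma> < 1" and s: "s < S"
  shows "disc_value S K r q \<gamma> s = r s (q s) + \<gamma> * expct S (K s (q s)) (disc_value S K r q \<gamma>)"
proof -
  note sm = disc_summable[where S = S and K = K and q = q and r = r, OF sub g]
  have "disc_value S K r q \<gamma> s = (\<Sum>t. \<gamma> ^ Suc t * Ppow_r S K r q (Suc t) s) + Ppow_r S K r q 0 s"
    unfolding disc_value_def using suminf_split_head[OF sm[OF s]] by simp
  also have "(\<Sum>t. \<gamma> ^ Suc t * Ppow_r S K r q (Suc t) s)
      = (\<Sum>t. \<Sum>s'<S. \<gamma> * K s (q s) s' * (\<gamma> ^ t * Ppow_r S K r q t s'))"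
    by (intro suminf_cong) (simp add: Ppow_r_Suc Ppol_def sum_distrib_left mult_ac)
  also have "\<dots> = (\<Sum>s'<S. (\<Sum>t. \<gamma> * K s (q s) s' * (\<gamma> ^ t * Ppow_r S K r q t s')))"
    by (intro suminf_sum summable_mult sm) auto
  also have "\<dots> = \<gamma> * expct S (K s (q s)) (disc_value S K r q \<gamma>)"
    unfolding expct_def disc_value_def sum_distrib_left
    by (intro sum.cong refl, subst suminf_mult) (auto intro: sm simp: mult_ac)
  finally show ?thesis by (simp add: Ppow_r_0 rpol_def)
qed

text \<open>A subsolution minus the value satisfies \<open>discounted_max_principle\<close> with
  zero error. Together with its mirror image \<open>disc_value_le\<close>, this reduces later value
  estimates to guessing a function and checking one Bellman step.\<close>

lemma disc_value_ge:
  assumes sub: "subchain S K q" and g: "0 \<le> \<gamma>" "\<gamma> < 1"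
    and w: "\<And>s. s < S \<Longrightarrow> w s \<le> r s (q s) + \<gamma> * expct S (K s (q s)) w" and s: "s < S"
  shows "w s \<le> disc_value S K r q \<gamma> s"
proof -
  have "w s - disc_value S K r q \<gamma> s \<le> 0 / (1 - \<gamma>)"
  proof (rule discounted_max_principle[where M = "\<lambda>s. K s (q s)" and S = S])
    fix i assume i: "i < S"
    show "w i - disc_value S K r q \<gamma> i
        \<le> \<gamma> * expct S (K i (q i)) (\<lambda>j. w j - disc_value S K r q \<gamma> j) + 0"
      using w[OF i] disc_value_fixed_point[where S = S and K = K and q = q and r = r, OF sub g i]
      by (simp add: expct_diff right_diff_distrib)
  qed (use subchainD[OF sub] g s in auto)
  then show ?thesis by simp
qed

lemma disc_value_le:
  assumes sub: "subchain S K q" and g: "0 \<le> \<gamma>" "\<gamma> < 1"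
    and w: "\<And>s. s < S \<Longrightarrow> r s (q s) + \<gamma> * expct S (K s (q s)) w \<le> w s" and s: "s < S"
  shows "disc_value S K r q \<gamma> s \<le> w s"
proof -
  have "disc_value S K r q \<gamma> s - w s \<le> 0 / (1 - \<gamma>)"
  proof (rule discounted_max_principle[where M = "\<lambda>s. K s (q s)" and S = S])
    fix i assume i: "i < S"
    show "disc_value S K r q \<gamma> i - w i
        \<le> \<gamma> * expct S (K i (q i)) (\<lambda>j. disc_value S K r q \<gamma> j - w j) + 0"
      using w[OF i] disc_value_fixed_point[where S = S and K = K and q = q and r = r, OF sub g i]
      by (simp add: expct_diff right_diff_distrib)
  qed (use subchainD[OF sub] g s in auto)
  then show ?thesis by simp
qed

lemma disc_value_unique:
  assumes sub: "subchain S K q" and g: "0 \<le> \<gamma>" "\<gamma> < 1"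
    and w: "\<And>s. s < S \<Longrightarrow> w s = r s (q s) + \<gamma> * expct S (K s (q s)) w" and s: "s < S"
  shows "disc_value S K r q \<gamma> s = w s"
proof (rule antisym)
  show "disc_value S K r q \<gamma> s \<le> w s"
    by (rule disc_value_le[OF sub g _ s]) (metis w order_refl)
  show "w s \<le> disc_value S K r q \<gamma> s"
    by (rule disc_value_ge[OF sub g _ s]) (metis w order_refl)
qed

lemma disc_value_bounds:
  assumes sub: "subchain S K q" and g: "0 \<le> \<gamma>" "\<gamma> < 1"
    and r: "\<And>s. s < S \<Longrightarrow> 0 \<le> r s (q s) \<and> r s (q s) \<le> R" and s: "s < S"
  shows "0 \<le> disc_value S K r q \<gamma> s" "disc_value S K r q \<gamma> s \<le> R / (1 - \<gamma>)"
proof -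
  have R: "0 \<le> R" using r[OF s] by linarith
  show "0 \<le> disc_value S K r q \<gamma> s"
    by (rule disc_value_ge[where w = "\<lambda>_. 0" and S = S]) (use assms in \<open>auto simp: expct_def\<close>)
  show "disc_value S K r q \<gamma> s \<le> R / (1 - \<gamma>)"
  proof (rule disc_value_le[where S = S])
    fix i assume i: "i < S"
    have "expct S (K i (q i)) (\<lambda>s. R / (1 - \<gamma>)) \<le> R / (1 - \<gamma>)"
      using R g by (intro expct_le_const subchainD[OF sub] i) auto
    then have "\<gamma> * expct S (K i (q i)) (\<lambda>s. R / (1 - \<gamma>)) \<le> \<gamma> * (R / (1 - \<gamma>))"
      using g by (intro mult_left_mono)
    moreover have "R + \<gamma> * (R / (1 - \<gamma>)) = R / (1 - \<gamma>)" using g by (simp add: field_simps)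
    ultimately show "r i (q i) + \<gamma> * expct S (K i (q i)) (\<lambda>s. R / (1 - \<gamma>)) \<le> R / (1 - \<gamma>)"
      using r[OF i] by linarith
  qed (use assms in auto)
qed

lemma disc_value_reward_shift:
  assumes sub: "subchain S K q" and g: "0 \<le> \<gamma>" "\<gamma> < 1"
    and r: "\<And>s. s < S \<Longrightarrow> \<bar>r s (q s) - r' s (q s)\<bar> \<le> x" and s: "s < S"
  shows "\<bar>disc_value S K r q \<gamma> s - disc_value S K r' q \<gamma> s\<bar> \<le> x / (1 - \<gamma>)"
proof -
  have *: "disc_value S K u q \<gamma> s - disc_value S K u' q \<gamma> s \<le> x / (1 - \<gamma>)"
    if u: "\<And>s. s < S \<Longrightarrow> u s (q s) - u' s (q s) \<le> x" for u u'
  proof (rule discounted_max_principle[where M = "\<lambda>s. K s (q s)" and S = S])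
    show "0 \<le> x" using r[OF s] by linarith
    fix i assume i: "i < S"
    show "disc_value S K u q \<gamma> i - disc_value S K u' q \<gamma> i
        \<le> \<gamma> * expct S (K i (q i)) (\<lambda>j. disc_value S K u q \<gamma> j - disc_value S K u' q \<gamma> j) + x"
      using u[OF i] disc_value_fixed_point[where S = S and K = K and q = q and r = u, OF sub g i]
        disc_value_fixed_point[where S = S and K = K and q = q and r = u', OF sub g i]
      by (simp add: expct_diff right_diff_distrib)
  qed (use subchainD[OF sub] g s in auto)
  have "\<And>s. s < S \<Longrightarrow> r s (q s) - r' s (q s) \<le> x" "\<And>s. s < S \<Longrightarrow> r' s (q s) - r s (q s) \<le> x"
    using r by (fastforce simp: abs_le_iff)+
  then have "disc_value S K r q \<gamma> s - disc_value S K r' q \<gamma> s \<le> x / (1 - \<gamma>)"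
    "disc_value S K r' q \<gamma> s - disc_value S K r q \<gamma> s \<le> x / (1 - \<gamma>)"
    by (auto intro: *)
  then show ?thesis by linarith
qed

lemma disc_value_cong:
  assumes "\<And>s s'. s < S \<Longrightarrow> s' < S \<Longrightarrow> K s (q s) s' = K' s (q' s) s'"
    and "\<And>s. s < S \<Longrightarrow> r s (q s) = r' s (q' s)" and "s < S"
  shows "disc_value S K r q \<gamma> s = disc_value S K' r' q' \<gamma> s"
proof -
  have "\<forall>s<S. Ppow_r S K r q t s = Ppow_r S K' r' q' t s" for t
    by (induction t) (auto simp: Ppow_r_0 rpol_def Ppow_r_Suc Ppol_def assms)
  then show ?thesis using assms(3) by (simp add: disc_value_def)
qed

lemma gain_cong_policy:
  assumes "\<And>s. s < S \<Longrightarrow> q s = q' s" and "s < S"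
  shows "gain S K r q s = gain S K r q' s"
proof -
  have "\<forall>s<S. Ppow_r S K r q t s = Ppow_r S K r q' t s" for t
    by (induction t) (auto simp: Ppow_r_0 rpol_def Ppow_r_Suc Ppol_def assms)
  then show ?thesis using assms(2) by (simp add: gain_def)
qed

subsection \<open>Discounted optimality\<close>

definition subkernel :: "nat \<Rightarrow> nat \<Rightarrow> (nat \<Rightarrow> nat \<Rightarrow> nat \<Rightarrow> real) \<Rightarrow> bool" where
  "subkernel S A K \<longleftrightarrow> (\<forall>s<S. \<forall>a<A. substoch S (K s a))"

text \<open>Extensional representatives make the set of policies finite, so that maxima over it
  exist and uniqueness of an optimal policy is an equation between functions;
  \<open>disc_value_restrict\<close> moves any policy into the set.\<close>

definition pols :: "nat \<Rightarrow> nat \<Rightarrow> (nat \<Rightarrow> nat) set" where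
  "pols S A = PiE {..<S} (\<lambda>_. {..<A})"

definition disc_optimal :: "nat \<Rightarrow> nat \<Rightarrow> (nat \<Rightarrow> nat \<Rightarrow> nat \<Rightarrow> real) \<Rightarrow> (nat \<Rightarrow> nat \<Rightarrow> real) \<Rightarrow> real
    \<Rightarrow> (nat \<Rightarrow> nat) \<Rightarrow> bool" where
  "disc_optimal S A K r \<gamma> p \<longleftrightarrow> is_policy S A p \<and>
     (\<forall>q\<in>pols S A. \<forall>s<S. disc_value S K r q \<gamma> s \<le> disc_value S K r p \<gamma> s)"

definition optv :: "nat \<Rightarrow> nat \<Rightarrow> (nat \<Rightarrow> nat \<Rightarrow> nat \<Rightarrow> real) \<Rightarrow> (nat \<Rightarrow> nat \<Rightarrow> real) \<Rightarrow> real
    \<Rightarrow> nat \<Rightarrow> real" where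
  "optv S A K r \<gamma> s = Max ((\<lambda>q. disc_value S K r q \<gamma> s) ` pols S A)"

lemma finite_pols [simp]: "finite (pols S A)"
  by (auto simp: pols_def intro!: finite_PiE)

lemma pols_nonempty: "0 < A \<Longrightarrow> pols S A \<noteq> {}"
  by (auto simp: pols_def PiE_eq_empty_iff)

lemma pols_is_policy: "q \<in> pols S A \<Longrightarrow> is_policy S A q"
  by (auto simp: pols_def is_policy_def)

lemma restrict_pols: "is_policy S A q \<Longrightarrow> restrict q {..<S} \<in> pols S A"
  by (auto simp: pols_def is_policy_def)

lemma disc_value_restrict: "s < S \<Longrightarrow> disc_value S K r (restrict q {..<S}) \<gamma> s = disc_value S K r q \<gamma> s"
  by (rule disc_value_cong) auto

lemma disc_optimal_ge:
  assumes "disc_optimal S A K r \<gamma> p" "is_policy S A q" "s < S"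
  shows "disc_value S K r q \<gamma> s \<le> disc_value S K r p \<gamma> s"
  using assms restrict_pols[OF assms(2)] disc_value_restrict[OF assms(3), of K r q \<gamma>]
  unfolding disc_optimal_def by metis

lemma subkernelD: "subkernel S A K \<Longrightarrow> is_policy S A q \<Longrightarrow> subchain S K q"
  by (auto simp: subkernel_def is_policy_def subchain_def)

lemma is_policy_upd: "is_policy S A q \<Longrightarrow> a < A \<Longrightarrow> is_policy S A (q(s := a))"
  by (auto simp: is_policy_def)

text \<open>The old value is a subsolution for the modified policy, which gives the first claim. The
  second inserts the first into the fixed point equation of the modified policy at
  \<open>s\<close>.\<close>

lemma improvement_le:
  assumes K: "subkernel S A K" and g: "0 \<le> \<gamma>" "\<gamma> < 1" and q: "is_policy S A q" and a: "a < A"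
    and s: "s < S"
    and imp: "disc_value S K r q \<gamma> s \<le> r s a + \<gamma> * expct S (K s a) (disc_value S K r q \<gamma>)"
  shows "\<And>i. i < S \<Longrightarrow> disc_value S K r q \<gamma> i \<le> disc_value S K r (q(s := a)) \<gamma> i"
    and "r s a + \<gamma> * expct S (K s a) (disc_value S K r q \<gamma>) \<le> disc_value S K r (q(s := a)) \<gamma> s"
proof -
  let ?V = "disc_value S K r q \<gamma>" and ?W = "disc_value S K r (q(s := a)) \<gamma>"
  note q' = is_policy_upd[OF q a, of s]
  show ge: "?V i \<le> ?W i" if "i < S" for i
  proof (rule disc_value_ge[where S = S])
    fix j assume j: "j < S"
    show "?V j \<le> r j ((q(s := a)) j) + \<gamma> * expct S (K j ((q(s := a)) j)) ?V"
      using imp disc_value_fixed_point[where S = S and K = K and q = q and r = r, OF subkernelD[OF K q] g j]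
      by (cases "j = s") auto
  qed (use g that subkernelD[OF K q'] in \<open>auto simp del: fun_upd_apply\<close>)
  have "expct S (K s a) ?V \<le> expct S (K s a) ?W"
    using K a s ge by (intro expct_mono) (auto simp: subkernel_def)
  then have "r s a + \<gamma> * expct S (K s a) ?V \<le> r s a + \<gamma> * expct S (K s a) ?W"
    using g by (intro add_left_mono mult_left_mono) auto
  also have "\<dots> = ?W s"
    using disc_value_fixed_point[where S = S and K = K and q = "q(s := a)" and r = r, OF subkernelD[OF K q'] g s] by simp
  finally show "r s a + \<gamma> * expct S (K s a) ?V \<le> ?W s" .
qed

lemma disc_optimal_bellman:
  assumes K: "subkernel S A K" and g: "0 \<le> \<gamma>" "\<gamma> < 1" and opt: "disc_optimal S A K r \<gamma> p"
    and s: "s < S" and a: "a < A"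
  shows "r s a + \<gamma> * expct S (K s a) (disc_value S K r p \<gamma>) \<le> disc_value S K r p \<gamma> s"
proof (rule ccontr)
  assume n: "\<not> ?thesis"
  have p: "is_policy S A p" using opt by (simp add: disc_optimal_def)
  have "r s a + \<gamma> * expct S (K s a) (disc_value S K r p \<gamma>) \<le> disc_value S K r (p(s := a)) \<gamma> s"
    using n by (intro improvement_le(2)[OF K g p a s]) auto
  also have "\<dots> \<le> disc_value S K r p \<gamma> s"
    by (rule disc_optimal_ge[OF opt is_policy_upd[OF p a] s])
  finally show False using n by simp
qed

lemma disc_optimalI:
  assumes K: "subkernel S A K" and g: "0 \<le> \<gamma>" "\<gamma> < 1" and p: "is_policy S A p"
    and bell: "\<And>s a. s < S \<Longrightarrow> a < A \<Longrightarrow>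
       r s a + \<gamma> * expct S (K s a) (disc_value S K r p \<gamma>) \<le> disc_value S K r p \<gamma> s"
  shows "disc_optimal S A K r \<gamma> p"
  unfolding disc_optimal_def
proof (intro conjI p ballI allI impI)
  fix q s assume q: "q \<in> pols S A" and s: "s < S"
  show "disc_value S K r q \<gamma> s \<le> disc_value S K r p \<gamma> s"
    using pols_is_policy[OF q]
    by (intro disc_value_le[where S = S] subkernelD[OF K] g s bell) (auto simp: is_policy_def)
qed

text \<open>A policy maximizing the sum of the values over all states admits no one-step improvement.\<close>

lemma disc_optimal_exists:
  assumes K: "subkernel S A K" and g: "0 \<le> \<gamma>" "\<gamma> < 1" and A: "0 < A"
  shows "\<exists>p\<in>pols S A. disc_optimal S A K r \<gamma> p"
proof -
  let ?f = "\<lambda>q. \<Sum>s<S. disc_value S K r q \<gamma> s"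
  obtain p where p: "p \<in> pols S A" and mx: "\<And>q. q \<in> pols S A \<Longrightarrow> ?f q \<le> ?f p"
    using obtains_MAX[OF finite_pols pols_nonempty[OF A, of S], of ?f]
    by (metis (no_types, lifting) Max_ge finite_imageI finite_pols image_eqI)
  have pp: "is_policy S A p" by (rule pols_is_policy[OF p])
  have "disc_optimal S A K r \<gamma> p"
  proof (rule disc_optimalI[OF K g pp])
    fix s a assume s: "s < S" and a: "a < A"
    show "r s a + \<gamma> * expct S (K s a) (disc_value S K r p \<gamma>) \<le> disc_value S K r p \<gamma> s"
    proof (rule ccontr)
      assume n: "\<not> ?thesis"
      let ?q = "p(s := a)"
      note imp = improvement_le[OF K g pp a s, of r]
      have lt: "disc_value S K r p \<gamma> s < disc_value S K r ?q \<gamma> s"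
        using imp(2) n by linarith
      have "?f p < ?f ?q"
        by (rule sum_strict_mono_ex1) (use imp(1) n s lt in auto)
      also have "?f ?q = ?f (restrict ?q {..<S})"
        by (intro sum.cong) (auto simp: disc_value_restrict)
      also have "\<dots> \<le> ?f p" by (intro mx restrict_pols is_policy_upd pp a)
      finally show False by simp
    qed
  qed
  then show ?thesis using p by blast
qed

lemma optv_eq:
  assumes "disc_optimal S A K r \<gamma> p" "s < S"
  shows "optv S A K r \<gamma> s = disc_value S K r p \<gamma> s"
  unfolding optv_def
proof (rule Max_eqI)
  show "disc_value S K r p \<gamma> s \<in> (\<lambda>q. disc_value S K r q \<gamma> s) ` pols S A"
    using assms restrict_pols[of S A p] disc_value_restrict[OF assms(2), of K r p \<gamma>]
    by (intro image_eqI[where x = "restrict p {..<S}"]) (auto simp: disc_optimal_def)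
qed (use assms in \<open>auto simp: disc_optimal_def\<close>)

subsection \<open>Anchoring as discounting\<close>

definition pstoch :: "nat \<Rightarrow> (nat \<Rightarrow> nat \<Rightarrow> nat \<Rightarrow> real) \<Rightarrow> (nat \<Rightarrow> nat) \<Rightarrow> bool" where
  "pstoch S K q \<longleftrightarrow> (\<forall>s<S. stoch S (K s (q s)))"

lemma pstochD: "pstoch S K q \<Longrightarrow> s < S \<Longrightarrow> stoch S (K s (q s))"
  by (simp add: pstoch_def)

lemma pstoch_subchain: "pstoch S K q \<Longrightarrow> subchain S K q"
  by (simp add: pstoch_def subchain_def stoch_imp_substoch)

lemma expct_anchor:
  assumes "s0 < S"
  shows "expct S (anchor s0 \<eta> K s a) v = (1 - \<eta>) * expct S (K s a) v + \<eta> * v s0"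
proof -
  have "expct S (anchor s0 \<eta> K s a) v
      = (\<Sum>s'<S. (1 - \<eta>) * (K s a s' * v s') + (if s' = s0 then \<eta> * v s' else 0))"
    unfolding expct_def anchor_def by (intro sum.cong) (auto simp: algebra_simps)
  also have "\<dots> = (1 - \<eta>) * expct S (K s a) v + \<eta> * v s0"
    using assms by (simp add: sum.distrib sum_distrib_left expct_def)
  finally show ?thesis .
qed

lemma stoch_anchor:
  assumes "s0 < S" "0 \<le> \<eta>" "\<eta> \<le> 1" "stoch S (K s a)"
  shows "stoch S (anchor s0 \<eta> K s a)"
proof -
  have "sum (anchor s0 \<eta> K s a) {..<S} = expct S (anchor s0 \<eta> K s a) (\<lambda>_. 1)"
    by (simp add: expct_def)
  also have "\<dots> = 1" unfolding expct_anchor[OF assms(1)] using assms(4) by (simp add: expct_const)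
  finally show ?thesis using assms by (auto simp: stoch_def anchor_def)
qed

lemma pstoch_anchor:
  assumes "s0 < S" "0 \<le> \<eta>" "\<eta> \<le> 1" "pstoch S K q"
  shows "pstoch S (anchor s0 \<eta> K) q"
  using assms stoch_anchor[of s0 S \<eta> K] by (simp add: pstoch_def)

text \<open>The jump to \<open>s0\<close> has the same probability everywhere, so its contribution
  is a constant. Without the jump a step survives with weight \<beta> (1 - \<eta>), and the constant
  is the solution of the scalar equation recorded as \<open>c\<close>.\<close>

lemma disc_value_anchor:
  assumes s0: "s0 < S" and e: "0 \<le> \<eta>" "\<eta> \<le> 1" and K: "pstoch S K q" and b: "0 \<le> \<beta>" "\<beta> < 1"
    and s: "s < S"
  shows "disc_value S (anchor s0 \<eta> K) r q \<beta> s = disc_value S K r q (\<beta> * (1 - \<eta>)) s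
     + \<beta> * \<eta> / (1 - \<beta>) * disc_value S K r q (\<beta> * (1 - \<eta>)) s0"
proof -
  let ?g = "\<beta> * (1 - \<eta>)"
  let ?V = "disc_value S K r q ?g"
  have g: "0 \<le> ?g" "?g < 1" using e b by (auto intro: mult_nonneg_nonneg, smt (verit) mult_left_le)
  show ?thesis
  proof (rule disc_value_unique[OF pstoch_subchain[OF pstoch_anchor[OF s0 e K]] b _ s])
    fix i assume i: "i < S"
    define c where "c = \<beta> * \<eta> / (1 - \<beta>) * ?V s0"
    have c: "c = \<beta> * c + \<beta> * \<eta> * ?V s0" using b by (simp add: c_def field_simps)
    have "r i (q i) + \<beta> * expct S (anchor s0 \<eta> K i (q i)) (\<lambda>s. ?V s + c)
        = r i (q i) + \<beta> * ((1 - \<eta>) * (expct S (K i (q i)) ?V + c) + \<eta> * (?V s0 + c))"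
      by (simp only: expct_anchor[OF s0] expct_add expct_const[OF pstochD[OF K i]]) (simp add: algebra_simps)
    also have "\<dots> = r i (q i) + ?g * expct S (K i (q i)) ?V + (\<beta> * c + \<beta> * \<eta> * ?V s0)"
      by (simp add: algebra_simps)
    also have "\<dots> = ?V i + c"
      using disc_value_fixed_point[OF pstoch_subchain[OF K] g i, of r] c by linarith
    finally show "?V i + \<beta> * \<eta> / (1 - \<beta>) * ?V s0 = r i (q i)
        + \<beta> * expct S (anchor s0 \<eta> K i (q i)) (\<lambda>s. ?V s + \<beta> * \<eta> / (1 - \<beta>) * ?V s0)"
      by (simp add: c_def)
  qed
qed

lemma disc_value_continuous:
  assumes K: "subchain S K q" and g: "0 \<le> \<gamma>" "\<gamma> < 1" and s: "s < S"
  shows "isCont (\<lambda>x. disc_value S K r q x s) \<gamma>"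
proof -
  let ?x = "(1 + \<gamma>) / 2"
  have "isCont (\<lambda>x. \<Sum>t. Ppow_r S K r q t s * x ^ t) \<gamma>"
  proof (rule isCont_powser)
    show "summable (\<lambda>t. Ppow_r S K r q t s * ?x ^ t)"
      using disc_summable[OF K _ _ s, of ?x r] g by (simp add: mult.commute)
    show "norm \<gamma> < norm ?x" using g by simp
  qed
  then show ?thesis by (simp add: disc_value_def mult.commute)
qed

definition stochkernel :: "nat \<Rightarrow> nat \<Rightarrow> (nat \<Rightarrow> nat \<Rightarrow> nat \<Rightarrow> real) \<Rightarrow> bool" where
  "stochkernel S A K \<longleftrightarrow> (\<forall>s<S. \<forall>a<A. stoch S (K s a))"

lemma stochkernel_subkernel: "stochkernel S A K \<Longrightarrow> subkernel S A K"
  by (simp add: stochkernel_def subkernel_def stoch_imp_substoch)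

lemma stochkernel_pstoch: "stochkernel S A K \<Longrightarrow> is_policy S A q \<Longrightarrow> pstoch S K q"
  by (simp add: stochkernel_def pstoch_def is_policy_def)

text \<open>By \<open>disc_value_anchor\<close>, anchored optimality at discount \<beta> concerns
  the \<beta> (1 - \<eta>)-discounted value plus a nonnegative multiple of its value at
  \<open>s0\<close>. This already forces optimality at discount \<beta> (1 - \<eta>); continuity
  then allows \<beta> to tend to 1.\<close>

lemma blackwell_anchor_disc_optimal:
  assumes s0: "s0 < S" and e: "0 < \<eta>" "\<eta> \<le> 1" and K: "stochkernel S A K" and A: "0 < A"
    and bw: "blackwell_optimal S A (anchor s0 \<eta> K) r p"
  shows "disc_optimal S A K r (1 - \<eta>) p"
proof -
  obtain b0 where b0: "b0 < 1" and opt: "\<And>b q s. b0 \<le> b \<Longrightarrow> b < 1 \<Longrightarrow> is_policy S A q \<Longrightarrow> s < S \<Longrightarrow>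
      disc_value S (anchor s0 \<eta> K) r q b s \<le> disc_value S (anchor s0 \<eta> K) r p b s"
    using bw by (auto simp: blackwell_optimal_def)
  have p: "is_policy S A p" using bw by (simp add: blackwell_optimal_def)
  define b1 where "b1 = max b0 0"
  have b1: "b1 < 1" "0 \<le> b1" "b0 \<le> b1" using b0 by (auto simp: b1_def)
  have near: "disc_value S K r q (b * (1 - \<eta>)) s \<le> disc_value S K r p (b * (1 - \<eta>)) s"
    if b: "b1 \<le> b" "b < 1" and q: "is_policy S A q" and s: "s < S" for b q s
  proof -
    let ?g = "b * (1 - \<eta>)"
    have bb: "0 \<le> b" using b b1 by linarith
    have g: "0 \<le> ?g" "?g < 1" using e bb b by (auto intro: mult_nonneg_nonneg, smt (verit) mult_left_le)
    \<comment> \<open>The rival is an optimal policy rather than \<open>q\<close> itself: its value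
      at \<open>s0\<close> is at least that of \<open>p\<close>, so the extra term cannot be the
      reason why \<open>p\<close> wins, and \<open>p\<close> must win at \<open>s\<close>.\<close>
    obtain q' where q': "q' \<in> pols S A" "disc_optimal S A K r ?g q'"
      using disc_optimal_exists[OF stochkernel_subkernel[OF K] g A] by blast
    have pq: "is_policy S A q'" by (rule pols_is_policy[OF q'(1)])
    define k where "k = b * \<eta> / (1 - b)"
    have k: "0 \<le> k" unfolding k_def using bb b e by simp
    have "disc_value S K r q' ?g s + k * disc_value S K r q' ?g s0
        \<le> disc_value S K r p ?g s + k * disc_value S K r p ?g s0"
      using opt[of b q' s] b b1 pq s e bb
        disc_value_anchor[OF s0 _ _ stochkernel_pstoch[OF K pq], of \<eta> b s r]
        disc_value_anchor[OF s0 _ _ stochkernel_pstoch[OF K p], of \<eta> b s r] by (simp add: k_def)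
    moreover have "k * disc_value S K r p ?g s0 \<le> k * disc_value S K r q' ?g s0"
      by (intro mult_left_mono k disc_optimal_ge[OF q'(2) p s0])
    moreover have "disc_value S K r q ?g s \<le> disc_value S K r q' ?g s"
      by (rule disc_optimal_ge[OF q'(2) q s])
    ultimately show ?thesis by linarith
  qed
  show ?thesis
    unfolding disc_optimal_def
  proof (intro conjI p ballI allI impI)
    fix q s assume "q \<in> pols S A" and s: "s < S"
    then have q: "is_policy S A q" by (simp add: pols_is_policy)
    have g: "0 \<le> 1 - \<eta>" "1 - \<eta> < 1" using e by auto
    have lim: "((\<lambda>b. disc_value S K r q (b * (1 - \<eta>)) s) \<longlongrightarrow> disc_value S K r q (1 - \<eta>) s) (at_left 1)"
      if q: "is_policy S A q" for q
    proof (rule isCont_tendsto_compose[OF disc_value_continuous[OF pstoch_subchain[OF stochkernel_pstoch[OF K q]] g s]])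
      have "((\<lambda>b. b * (1 - \<eta>)) \<longlongrightarrow> 1 * (1 - \<eta>)) (at_left 1)" by (intro tendsto_intros)
      then show "((\<lambda>b. b * (1 - \<eta>)) \<longlongrightarrow> 1 - \<eta>) (at_left 1)" by simp
    qed
    have ev: "\<forall>\<^sub>F b in at_left 1. disc_value S K r q (b * (1 - \<eta>)) s \<le> disc_value S K r p (b * (1 - \<eta>)) s"
      using eventually_at_left_real[OF b1(1)] by eventually_elim (use near q s in auto)
    show "disc_value S K r q (1 - \<eta>) s \<le> disc_value S K r p (1 - \<eta>) s"
      by (rule tendsto_le[OF _ lim[OF p] lim[OF q] ev]) simp
  qed
qed

subsection \<open>A leave-one-out modification\<close>

definition cutk :: "nat \<Rightarrow> nat \<Rightarrow> (nat \<Rightarrow> nat \<Rightarrow> nat \<Rightarrow> real) \<Rightarrow> nat \<Rightarrow> nat \<Rightarrow> nat \<Rightarrow> real" where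
  "cutk s a K = (\<lambda>s1 a1 s2. if s1 = s \<and> a1 = a then 0 else K s1 a1 s2)"

definition cutr :: "nat \<Rightarrow> nat \<Rightarrow> real \<Rightarrow> (nat \<Rightarrow> nat \<Rightarrow> real) \<Rightarrow> nat \<Rightarrow> nat \<Rightarrow> real" where
  "cutr s a u r = (\<lambda>s1 a1. if s1 = s \<and> a1 = a then u else r s1 a1)"

lemma subkernel_cut:
  assumes "subkernel S A K"
  shows "subkernel S A (cutk s a K)"
  unfolding subkernel_def
proof (intro allI impI)
  fix i b assume "i < S" "b < A"
  then have "substoch S (K i b)" using assms by (simp add: subkernel_def)
  then show "substoch S (cutk s a K i b)"
    by (cases "i = s \<and> b = a") (auto simp: cutk_def substoch_def)
qed

lemma expct_cut: "expct S (cutk s a K s1 a1) v = (if s1 = s \<and> a1 = a then 0 else expct S (K s1 a1) v)"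
  by (auto simp: cutk_def expct_def)

text \<open>The Lipschitz constant is 1 and not 1 / (1 - \<gamma>) because the process stops at the
  removed pair, so \<open>u\<close> is collected at most once. Formally, the value for
  \<open>u'\<close> raised by |u - u'| is a supersolution for \<open>u\<close>.\<close>

lemma cut_value_lipschitz:
  assumes K: "subkernel S A K" and g: "0 \<le> \<gamma>" "\<gamma> < 1" and q: "is_policy S A q" and i: "i < S"
  shows "disc_value S (cutk s a K) (cutr s a u r) q \<gamma> i
     \<le> disc_value S (cutk s a K) (cutr s a u' r) q \<gamma> i + \<bar>u - u'\<bar>"
proof (rule disc_value_le[OF subkernelD[OF subkernel_cut[OF K] q] g _ i])
  let ?W = "disc_value S (cutk s a K) (cutr s a u' r) q \<gamma>"
  fix j assume j: "j < S"
  show "cutr s a u r j (q j) + \<gamma> * expct S (cutk s a K j (q j)) (\<lambda>i. ?W i + \<bar>u - u'\<bar>) \<le> ?W j + \<bar>u - u'\<bar>"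
  proof (cases "j = s \<and> q j = a")
    case True
    then show ?thesis
      using disc_value_fixed_point[OF subkernelD[OF subkernel_cut[OF K] q] g j, of s a "cutr s a u' r"]
      by (auto simp: expct_cut cutr_def)
  next
    case False
    have "expct S (cutk s a K j (q j)) (\<lambda>i. \<bar>u - u'\<bar>) \<le> \<bar>u - u'\<bar>"
      using subchainD[OF subkernelD[OF subkernel_cut[OF K] q] j] by (intro expct_le_const) auto
    then have "\<gamma> * expct S (cutk s a K j (q j)) (\<lambda>i. \<bar>u - u'\<bar>) \<le> 1 * \<bar>u - u'\<bar>"
      using g by (intro order_trans[OF mult_left_mono mult_right_mono]) auto
    then show ?thesis
      using disc_value_fixed_point[OF subkernelD[OF subkernel_cut[OF K] q] g j, of s a "cutr s a u' r"] False
      by (auto simp: expct_add cutr_def distrib_left)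
  qed
qed

lemma cut_optv_lipschitz:
  assumes K: "subkernel S A K" and g: "0 \<le> \<gamma>" "\<gamma> < 1" and A: "0 < A" and i: "i < S"
  shows "\<bar>optv S A (cutk s a K) (cutr s a u r) \<gamma> i - optv S A (cutk s a K) (cutr s a u' r) \<gamma> i\<bar> \<le> \<bar>u - u'\<bar>"
proof -
  have *: "optv S A (cutk s a K) (cutr s a u r) \<gamma> i \<le> optv S A (cutk s a K) (cutr s a u' r) \<gamma> i + \<bar>u - u'\<bar>"
    for u u'
  proof -
    obtain p where p: "p \<in> pols S A" "disc_optimal S A (cutk s a K) (cutr s a u r) \<gamma> p"
      using disc_optimal_exists[OF subkernel_cut[OF K] g A] by blast
    have "disc_value S (cutk s a K) (cutr s a u' r) p \<gamma> i \<le> optv S A (cutk s a K) (cutr s a u' r) \<gamma> i"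
      unfolding optv_def using p by (intro Max_ge) auto
    then show ?thesis
      using cut_value_lipschitz[OF K g pols_is_policy[OF p(1)] i, of s a u r u'] optv_eq[OF p(2) i] by linarith
  qed
  show ?thesis using *[of u u'] *[of u' u] by (simp add: abs_le_iff abs_minus_commute)
qed

definition qval :: "nat \<Rightarrow> (nat \<Rightarrow> nat \<Rightarrow> nat \<Rightarrow> real) \<Rightarrow> (nat \<Rightarrow> nat \<Rightarrow> real) \<Rightarrow> real \<Rightarrow> (nat \<Rightarrow> real)
    \<Rightarrow> nat \<Rightarrow> nat \<Rightarrow> real" where
  "qval S K r \<gamma> v s a = r s a + \<gamma> * expct S (K s a) v"

text \<open>If the terminal reward equals what the removed row would have earned, the old value
  function still solves the Bellman optimality equation. Hence the sample-dependent value is a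
  member of the one-parameter family indexed by \<open>u\<close>.\<close>

lemma optv_cut_at_qval:
  assumes K: "subkernel S A K" and g: "0 \<le> \<gamma>" "\<gamma> < 1" and opt: "disc_optimal S A K r \<gamma> p"
    and i: "i < S" and u: "u = qval S K r \<gamma> (disc_value S K r p \<gamma>) s a"
  shows "optv S A (cutk s a K) (cutr s a u r) \<gamma> i = disc_value S K r p \<gamma> i"
proof -
  let ?V = "disc_value S K r p \<gamma>"
  have p: "is_policy S A p" using opt by (simp add: disc_optimal_def)
  have eq: "disc_value S (cutk s a K) (cutr s a u r) p \<gamma> i = ?V i" if "i < S" for i
    by (rule disc_value_unique[OF subkernelD[OF subkernel_cut[OF K] p] g _ that])
       (use disc_value_fixed_point[OF subkernelD[OF K p] g, of _ r] in \<open>auto simp: expct_cut cutr_def u qval_def\<close>)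
  have "disc_optimal S A (cutk s a K) (cutr s a u r) \<gamma> p"
  proof (rule disc_optimalI[OF subkernel_cut[OF K] g p])
    fix j b assume j: "j < S" and b: "b < A"
    have "expct S (cutk s a K j b) (disc_value S (cutk s a K) (cutr s a u r) p \<gamma>) = expct S (cutk s a K j b) ?V"
      by (intro expct_cong eq)
    then show "cutr s a u r j b + \<gamma> * expct S (cutk s a K j b) (disc_value S (cutk s a K) (cutr s a u r) p \<gamma>)
        \<le> disc_value S (cutk s a K) (cutr s a u r) p \<gamma> j"
      using eq[OF j] disc_optimal_bellman[OF K g opt j b] by (auto simp: expct_cut cutr_def u qval_def)
  qed
  then show ?thesis using optv_eq eq[OF i] i by metis
qed

text \<open>Giving the removed pair the worthless reward 0 amounts to forbidding it; if it was not used by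
  the optimal policy, the optimal value is unchanged.\<close>

lemma optv_cut_zero:
  assumes K: "subkernel S A K" and g: "0 \<le> \<gamma>" "\<gamma> < 1" and opt: "disc_optimal S A K r \<gamma> p"
    and r: "\<And>s a. s < S \<Longrightarrow> a < A \<Longrightarrow> 0 \<le> r s a" and na: "p s \<noteq> a" and i: "i < S"
  shows "optv S A (cutk s a K) (cutr s a 0 r) \<gamma> i = disc_value S K r p \<gamma> i"
proof -
  let ?V = "disc_value S K r p \<gamma>"
  have p: "is_policy S A p" using opt by (simp add: disc_optimal_def)
  have eq: "disc_value S (cutk s a K) (cutr s a 0 r) p \<gamma> i = ?V i" if "i < S" for i
    by (rule disc_value_unique[OF subkernelD[OF subkernel_cut[OF K] p] g _ that])
       (use na disc_value_fixed_point[OF subkernelD[OF K p] g, of _ r] in \<open>auto simp: expct_cut cutr_def\<close>)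
  have V0: "0 \<le> ?V j" if "j < S" for j
    by (rule disc_value_ge[OF subkernelD[OF K p] g _ that, of "\<lambda>_. 0"])
       (use r p in \<open>auto simp: expct_def is_policy_def\<close>)
  have "disc_optimal S A (cutk s a K) (cutr s a 0 r) \<gamma> p"
  proof (rule disc_optimalI[OF subkernel_cut[OF K] g p])
    fix j b assume j: "j < S" and b: "b < A"
    have "expct S (cutk s a K j b) (disc_value S (cutk s a K) (cutr s a 0 r) p \<gamma>) = expct S (cutk s a K j b) ?V"
      by (intro expct_cong eq)
    then show "cutr s a 0 r j b + \<gamma> * expct S (cutk s a K j b) (disc_value S (cutk s a K) (cutr s a 0 r) p \<gamma>)
        \<le> disc_value S (cutk s a K) (cutr s a 0 r) p \<gamma> j"
      using eq[OF j] disc_optimal_bellman[OF K g opt j b] V0[OF j] by (auto simp: expct_cut cutr_def)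
  qed
  then show ?thesis using optv_eq eq[OF i] i by metis
qed

text \<open>The value is taken in the model with the pair forbidden, so it does not depend on the
  reward at (s, a). The Q-value is then that reward plus a term free of it, and a near tie confines
  the reward to an interval of length \<open>w\<close>. This is what makes the event easy to
  estimate under independent noise.\<close>

definition near_tie :: "nat \<Rightarrow> nat \<Rightarrow> (nat \<Rightarrow> nat \<Rightarrow> nat \<Rightarrow> real) \<Rightarrow> (nat \<Rightarrow> nat \<Rightarrow> real) \<Rightarrow> real \<Rightarrow> real
    \<Rightarrow> nat \<Rightarrow> nat \<Rightarrow> bool" where
  "near_tie S A K r \<gamma> w s a \<longleftrightarrow> (let V = optv S A (cutk s a K) (cutr s a 0 r) \<gamma> in
     V s - w \<le> qval S K r \<gamma> V s a \<and> qval S K r \<gamma> V s a \<le> V s)"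

lemma action_gap:
  assumes K: "subkernel S A K" and g: "0 \<le> \<gamma>" "\<gamma> < 1" and opt: "disc_optimal S A K r \<gamma> p"
    and r: "\<And>s a. s < S \<Longrightarrow> a < A \<Longrightarrow> 0 \<le> r s a" and na: "p s \<noteq> a" and s: "s < S" and a: "a < A"
    and nt: "\<not> near_tie S A K r \<gamma> w s a"
  shows "qval S K r \<gamma> (disc_value S K r p \<gamma>) s a < disc_value S K r p \<gamma> s - w"
proof -
  let ?V0 = "optv S A (cutk s a K) (cutr s a 0 r) \<gamma>"
  have V0: "?V0 i = disc_value S K r p \<gamma> i" if "i < S" for i
    by (rule optv_cut_zero[where S = S and A = A, OF K g opt _ na that]) (use r in auto)
  have "expct S (K s a) ?V0 = expct S (K s a) (disc_value S K r p \<gamma>)"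
    by (intro expct_cong V0)
  then have "qval S K r \<gamma> ?V0 s a = qval S K r \<gamma> (disc_value S K r p \<gamma>) s a"
    by (simp add: qval_def)
  then show ?thesis
    using nt disc_optimal_bellman[OF K g opt s a] V0[OF s]
    unfolding near_tie_def Let_def by (simp only: qval_def[symmetric]) auto
qed

text \<open>Moving \<open>u\<close> by \<open>e\<close> moves the optimal value by at most
  \<open>e\<close>, and the Q-value of the action chosen by \<open>q\<close> likewise. That action
  is therefore within 2 e of optimal in the uncut model, which the gap \<open>w\<close> forbids for
  every action but that of \<open>p\<close>.\<close>

lemma cut_unique_optimal:
  assumes K: "subkernel S A K" and g: "0 \<le> \<gamma>" "\<gamma> < 1" and opt: "disc_optimal S A K r \<gamma> p"
    and gap: "\<And>s a. s < S \<Longrightarrow> a < A \<Longrightarrow> a \<noteq> p s \<Longrightarrow>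
      qval S K r \<gamma> (disc_value S K r p \<gamma>) s a < disc_value S K r p \<gamma> s - w"
    and u: "\<bar>u - qval S K r \<gamma> (disc_value S K r p \<gamma>) s a\<bar> \<le> e" and ew: "2 * e \<le> w"
    and q: "disc_optimal S A (cutk s a K) (cutr s a u r) \<gamma> q" and i: "i < S" and A: "0 < A"
  shows "q i = p i"
proof (rule ccontr)
  assume neq: "q i \<noteq> p i"
  let ?V = "disc_value S K r p \<gamma>" and ?W = "optv S A (cutk s a K) (cutr s a u r) \<gamma>"
  let ?us = "qval S K r \<gamma> ?V s a"
  have qp: "is_policy S A q" using q by (simp add: disc_optimal_def)
  then have qi: "q i < A" using i by (simp add: is_policy_def)
  have close: "\<bar>?W j - ?V j\<bar> \<le> e" if "j < S" for j
    using cut_optv_lipschitz[OF K g A that, of s a u r ?us] optv_cut_at_qval[OF K g opt that refl, of s a] u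
    by simp
  have "?W i = cutr s a u r i (q i) + \<gamma> * expct S (cutk s a K i (q i)) (disc_value S (cutk s a K) (cutr s a u r) q \<gamma>)"
    using disc_value_fixed_point[OF subkernelD[OF subkernel_cut[OF K] qp] g i] optv_eq[OF q i] by simp
  also have "expct S (cutk s a K i (q i)) (disc_value S (cutk s a K) (cutr s a u r) q \<gamma>)
      = expct S (cutk s a K i (q i)) ?W"
    using optv_eq[OF q] by (intro expct_cong) auto
  finally have W: "?W i = cutr s a u r i (q i) + \<gamma> * expct S (cutk s a K i (q i)) ?W" .
  have "?W i \<le> qval S K r \<gamma> ?V i (q i) + e"
  proof (cases "i = s \<and> q i = a")
    case True
    then show ?thesis using W u by (auto simp: cutr_def expct_cut)
  next
    case False
    have sub: "substoch S (K i (q i))" using K i qi by (simp add: subkernel_def)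
    have "expct S (K i (q i)) ?W - expct S (K i (q i)) ?V \<le> e"
      unfolding expct_diff[symmetric] using u close by (intro expct_le_const sub) (auto simp: abs_le_iff)
    then have "\<gamma> * (expct S (K i (q i)) ?W - expct S (K i (q i)) ?V) \<le> 1 * e"
      using g u by (intro order_trans[OF mult_left_mono mult_right_mono]) auto
    then show ?thesis using W False by (auto simp: cutr_def expct_cut qval_def right_diff_distrib)
  qed
  then show False using gap[OF i qi neq] close[OF i] ew by linarith
qed

subsection \<open>Gain and bias of a finite chain\<close>

text \<open>Gaussian elimination, one coordinate per induction step, for vectors given as functions
  of which only the first \<open>S\<close> coordinates count.\<close>

lemma linear_dependence:
  fixes f :: "nat \<Rightarrow> nat \<Rightarrow> real"
  assumes "finite I" "S < card I"
  shows "\<exists>c. (\<exists>i\<in>I. c i \<noteq> 0) \<and> (\<forall>s<S. (\<Sum>i\<in>I. c i * f i s) = 0)"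
  using assms
proof (induction S arbitrary: I f)
  case 0
  then obtain i where "i \<in> I" by fastforce
  then show ?case by (intro exI[of _ "\<lambda>_. 1"]) auto
next
  case (Suc S)
  show ?case
  proof (cases "\<forall>i\<in>I. f i S = 0")
    case True
    obtain c where "\<exists>i\<in>I. c i \<noteq> 0" "\<forall>s<S. (\<Sum>i\<in>I. c i * f i s) = 0"
      using Suc.IH[of I f] Suc.prems by auto
    then show ?thesis using True by (intro exI[of _ c]) (auto simp: less_Suc_eq)
  next
    case False
    then obtain j where j: "j \<in> I" "f j S \<noteq> 0" by blast
    \<comment> \<open>The pivot vector \<open>j\<close> clears the last coordinate of the others;
      its coefficient \<open>d\<close> is then chosen so that the combination vanishes there
      too.\<close>
    define f' where "f' i s = f i s - f i S / f j S * f j s" for i s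
    obtain c where c: "\<exists>i\<in>I - {j}. c i \<noteq> 0" "\<forall>s<S. (\<Sum>i\<in>I - {j}. c i * f' i s) = 0"
      using Suc.IH[of "I - {j}" f'] Suc.prems j by (auto simp: less_diff_conv)
    define d where "d = - (\<Sum>i\<in>I - {j}. c i * f i S) / f j S"
    define c' where "c' = c(j := d)"
    have split: "(\<Sum>i\<in>I. c' i * f i s) = d * f j s + (\<Sum>i\<in>I - {j}. c i * f i s)" for s
      using j Suc.prems by (subst sum.remove[of _ j]) (auto simp: c'_def intro!: sum.cong)
    have eq: "(\<Sum>i\<in>I - {j}. c i * f' i s) = d * f j s + (\<Sum>i\<in>I - {j}. c i * f i s)" for s
      using j by (simp add: f'_def d_def right_diff_distrib sum_subtractf sum_divide_distrib
          sum_distrib_left mult_ac)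
    have "(\<Sum>i\<in>I. c' i * f i s) = 0" if "s < Suc S" for s
    proof (cases "s = S")
      case True
      then show ?thesis using j by (simp add: split d_def)
    next
      case False
      then have "s < S" using that by simp
      then show ?thesis using c(2) split eq by simp
    qed
    moreover have "\<exists>i\<in>I. c' i \<noteq> 0" using c(1) by (auto simp: c'_def)
    ultimately show ?thesis by blast
  qed
qed

section \<open>Polynomials in the transition operator\<close>

definition poly_act :: "nat \<Rightarrow> (nat \<Rightarrow> nat \<Rightarrow> nat \<Rightarrow> real) \<Rightarrow> (nat \<Rightarrow> nat) \<Rightarrow> real poly
    \<Rightarrow> (nat \<Rightarrow> real) \<Rightarrow> nat \<Rightarrow> real" where
  "poly_act S K q p v s = (\<Sum>i\<le>degree p. coeff p i * (Ppol S K q ^^ i) v s)"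

lemma poly_act_eq: "degree p \<le> N \<Longrightarrow> poly_act S K q p v s = (\<Sum>i\<le>N. coeff p i * (Ppol S K q ^^ i) v s)"
  unfolding poly_act_def by (rule sum.mono_neutral_left) (auto simp: coeff_eq_0)

lemma poly_act_add: "poly_act S K q (p1 + p2) v s = poly_act S K q p1 v s + poly_act S K q p2 v s"
proof -
  define N where "N = max (degree p1) (degree p2)"
  have "degree (p1 + p2) \<le> N" "degree p1 \<le> N" "degree p2 \<le> N"
    unfolding N_def using degree_add_le_max[of p1 p2] by auto
  then show ?thesis by (simp add: poly_act_eq[of _ N] sum.distrib distrib_right)
qed

lemma poly_act_smult: "poly_act S K q (smult c p) v s = c * poly_act S K q p v s"
  by (simp add: poly_act_eq[of _ "degree p"] degree_smult_le sum_distrib_left mult_ac)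

lemma poly_act_0: "poly_act S K q 0 v s = 0"
  by (simp add: poly_act_def)

lemma poly_act_pCons: "poly_act S K q (pCons a p) v s = a * v s + Ppol S K q (poly_act S K q p v) s"
proof -
  have "poly_act S K q (pCons a p) v s = (\<Sum>i\<le>Suc (degree p). coeff (pCons a p) i * (Ppol S K q ^^ i) v s)"
    by (rule poly_act_eq) (simp add: degree_pCons_le)
  also have "\<dots> = a * v s + (\<Sum>i\<le>degree p. coeff p i * Ppol S K q ((Ppol S K q ^^ i) v) s)"
    by (subst sum.atMost_Suc_shift) simp
  also have "(\<Sum>i\<le>degree p. coeff p i * Ppol S K q ((Ppol S K q ^^ i) v) s)
      = Ppol S K q (poly_act S K q p v) s"
    unfolding Ppol_expct poly_act_def by (simp add: expct_sum expct_cmult)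
  finally show ?thesis .
qed

lemma Ppol_zero: "Ppol S K q (\<lambda>s. 0) s = 0"
  by (simp add: Ppol_def)

lemma poly_act_mult: "poly_act S K q (p1 * p2) v s = poly_act S K q p1 (poly_act S K q p2 v) s"
proof (induction p1 arbitrary: s)
  case 0
  then show ?case by (simp add: poly_act_0)
next
  case (pCons a p)
  have "poly_act S K q (pCons a p * p2) v s
      = a * poly_act S K q p2 v s + Ppol S K q (poly_act S K q (p * p2) v) s"
    by (simp add: poly_act_add poly_act_smult poly_act_pCons)
  also have "poly_act S K q (p * p2) v = poly_act S K q p (poly_act S K q p2 v)"
    using pCons by auto
  finally show ?case by (simp add: poly_act_pCons)
qed

lemma Ppol_cong: "(\<And>s. s < S \<Longrightarrow> v s = w s) \<Longrightarrow> Ppol S K q v = Ppol S K q w"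
  by (auto simp: Ppol_def)

lemma funpow_Ppol_bounded:
  assumes K: "pstoch S K q" and v: "\<And>s. s < S \<Longrightarrow> \<bar>v s\<bar> \<le> B" and s: "s < S"
  shows "\<bar>(Ppol S K q ^^ t) v s\<bar> \<le> B"
  using s
proof (induction t arbitrary: s)
  case (Suc t)
  have "\<bar>expct S (K s (q s)) ((Ppol S K q ^^ t) v)\<bar> \<le> expct S (K s (q s)) (\<lambda>_. B)"
    using Suc stoch_imp_substoch[OF pstochD[OF K Suc.prems]] by (intro expct_abs_le) auto
  then show ?case
    using expct_const[OF pstochD[OF K Suc.prems]] by (simp add: Ppol_expct[of S K q "(Ppol S K q ^^ t) v"])
qed (use v in auto)

lemma exists_bound: "\<exists>B\<ge>0. \<forall>s<S::nat. \<bar>v s\<bar> \<le> (B::real)"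
  using exists_reward_bound[of S "\<lambda>s _. v s" "\<lambda>_. 0"] by simp

lemma expct_add_cmult: "expct S k (\<lambda>s. x s + c * y s) = expct S k x + c * expct S k y"
  by (simp add: expct_add expct_cmult)

text \<open>Powers of a stochastic matrix are bounded, so the eigenvalue 1 has no nilpotent part.\<close>

lemma fixed_if_difference_fixed:
  assumes K: "pstoch S K q"
    and d: "\<And>s. s < S \<Longrightarrow> d s = Ppol S K q w s - w s" "\<And>s. s < S \<Longrightarrow> Ppol S K q d s = d s" and s: "s < S"
  shows "Ppol S K q w s = w s"
proof -
  \<comment> \<open>The iterates would grow linearly in \<open>t\<close> along \<open>d\<close>,
    against the uniform bound on powers.\<close>
  have pw: "\<forall>s<S. (Ppol S K q ^^ t) w s = w s + real t * d s" for t
  proof (induction t)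
    case (Suc t)
    show ?case
    proof (intro allI impI)
      fix s assume s: "s < S"
      have "(Ppol S K q ^^ Suc t) w s = Ppol S K q (\<lambda>s. w s + real t * d s) s"
        using Suc Ppol_cong[of S "(Ppol S K q ^^ t) w" "\<lambda>s. w s + real t * d s" K q] by simp
      also have "\<dots> = Ppol S K q w s + real t * Ppol S K q d s"
        unfolding Ppol_expct expct_add_cmult ..
      also have "\<dots> = (w s + d s) + real t * d s"
        using d(1)[OF s] d(2)[OF s] by simp
      finally show "(Ppol S K q ^^ Suc t) w s = w s + real (Suc t) * d s"
        by (simp add: algebra_simps)
    qed
  qed simp
  obtain B where B: "B \<ge> 0" "\<forall>s<S. \<bar>w s\<bar> \<le> B" using exists_bound by blast
  have "d s = 0"
  proof (rule ccontr)
    assume "d s \<noteq> 0"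
    then obtain t :: nat where t: "2 * B < real t * \<bar>d s\<bar>"
      by (meson reals_Archimedean3 zero_less_abs_iff)
    have "\<bar>w s + real t * d s\<bar> \<le> B"
      using funpow_Ppol_bounded[OF K _ s, of w B t] pw[of t] B s by auto
    moreover have "\<bar>w s\<bar> \<le> B" using B s by auto
    ultimately have "\<bar>real t * d s\<bar> \<le> 2 * B" by linarith
    then show False using t by (simp add: abs_mult)
  qed
  then show ?thesis using d(1)[OF s] by simp
qed

lemma poly_act_minus_one: "poly_act S K q [:-1, 1:] w s = Ppol S K q w s - w s"
proof -
  have "poly_act S K q [:1:] w = w"
    by (rule ext) (simp add: poly_act_def)
  then show ?thesis by (simp add: poly_act_pCons[of _ _ _ _ "[:1:]"])
qed

text \<open>One factor T - 1 is removed at a time: by induction (T - 1) w is fixed, and then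
  \<open>fixed_if_difference_fixed\<close> makes \<open>w\<close> fixed.\<close>

lemma fixed_if_power_kills:
  assumes K: "pstoch S K q" and "\<And>s. s < S \<Longrightarrow> poly_act S K q ([:-1, 1:] ^ k) w s = 0" and "s < S"
  shows "Ppol S K q w s = w s"
  using assms(2,3)
proof (induction k arbitrary: w s)
  case 0
  then have "\<And>s. s < S \<Longrightarrow> w s = 0" by (simp add: poly_act_def)
  then show ?case using 0 Ppol_cong[of S w "\<lambda>_. 0" K q] by (simp add: Ppol_zero)
next
  case (Suc k)
  let ?d = "poly_act S K q [:-1, 1:] w"
  have "Ppol S K q ?d s = ?d s" if "s < S" for s
  proof (rule Suc.IH[OF _ that])
    fix s assume "s < S"
    then show "poly_act S K q ([:-1, 1:] ^ k) ?d s = 0"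
      using Suc.prems(1) unfolding power_Suc2 poly_act_mult by simp
  qed
  then show ?case
    by (intro fixed_if_difference_fixed[OF K _ _ Suc.prems(2), of ?d]) (auto simp: poly_act_minus_one)
qed

text \<open>The S + 1 iterates of \<open>v\<close> live in dimension S. The coefficients form a
  polynomial that annihilates this one vector, which suffices both for the ergodic decomposition and
  for rationality of the discounted value.\<close>

lemma annihilating_relation:
  "\<exists>c. (\<exists>i\<le>S. c i \<noteq> 0) \<and> (\<forall>s<S. (\<Sum>i\<le>S. c i * (Ppol S K q ^^ i) v s) = 0)"
  using linear_dependence[of "{..S}" S "\<lambda>i. (Ppol S K q ^^ i) v"] by auto

text \<open>Split into the kernel and the image of I - T. Factor an annihilating polynomial of
  \<open>v\<close> as (X - 1)^m g with g(1) nonzero. Then w = g(T) v is killed by (T - 1)^m, hence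
  fixed. Writing g = g(1) + (X - 1) k gives g(1) v = w - (T - 1) k(T) v, and division by g(1) yields
  the claim.\<close>

lemma ergodic_decomposition:
  assumes K: "pstoch S K q"
  shows "\<exists>f z. (\<forall>s<S. Ppol S K q f s = f s) \<and> (\<forall>s<S. v s = f s + z s - Ppol S K q z s)"
proof -
  obtain c where c: "\<exists>i\<le>S. c i \<noteq> 0" "\<forall>s<S. (\<Sum>i\<le>S. c i * (Ppol S K q ^^ i) v s) = 0"
    using annihilating_relation[of S K q v] by blast
  define p where "p = (\<Sum>i\<le>S. monom (c i) i)"
  have cf: "coeff p i = (if i \<le> S then c i else 0)" for i
    by (auto simp: p_def coeff_sum)
  have deg: "degree p \<le> S" by (intro degree_le) (auto simp: cf)
  have p0: "p \<noteq> 0"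
  proof -
    obtain i where "i \<le> S" "c i \<noteq> 0" using c(1) by blast
    then have "coeff p i \<noteq> 0" by (simp add: cf)
    then show ?thesis by auto
  qed
  have kill: "poly_act S K q p v s = 0" if "s < S" for s
    using c(2) that by (simp add: poly_act_eq[OF deg] cf)
  obtain g where g: "p = [:-1, 1:] ^ order 1 p * g" "\<not> [:-1, 1:] dvd g"
    using order_decomp[OF p0, of 1] by auto
  define y where "y = poly g 1"
  have y: "y \<noteq> 0" using g(2) by (simp add: y_def poly_eq_0_iff_dvd)
  have "poly (g - [:y:]) 1 = 0" by (simp add: y_def)
  then have "[:-1, 1:] dvd g - [:y:]" by (rule iffD1[OF poly_eq_0_iff_dvd])
  then obtain k where k: "g - [:y:] = [:-1, 1:] * k" by (elim dvdE)
  define w where "w = poly_act S K q g v"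
  define x where "x = poly_act S K q k v"
  have wfix: "Ppol S K q w s = w s" if "s < S" for s
  proof (rule fixed_if_power_kills[OF K _ that, of "order 1 p"])
    fix s assume "s < S"
    then show "poly_act S K q ([:-1, 1:] ^ order 1 p) w s = 0"
      unfolding w_def poly_act_mult[symmetric] g(1)[symmetric] by (rule kill)
  qed
  have gk: "g = [:y:] + [:-1, 1:] * k" using k by (simp add: algebra_simps)
  have "w s = y * v s + (Ppol S K q x s - x s)" for s
    unfolding w_def by (subst gk, simp only: poly_act_add poly_act_mult poly_act_minus_one x_def[symmetric])
      (simp add: poly_act_def)
  then have v: "v s = w s / y + x s / y - Ppol S K q x s / y" for s
    using y by (simp add: field_simps)
  have scale: "Ppol S K q (\<lambda>s. u s / y) s = Ppol S K q u s / y" for u s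
    unfolding Ppol_expct using expct_cmult[of S "K s (q s)" "1 / y" u] by simp
  show ?thesis
    by (intro exI[of _ "\<lambda>s. w s / y"] exI[of _ "\<lambda>s. x s / y"]) (use wfix v in \<open>auto simp: scale\<close>)
qed

lemma Ppol_add_diff: "Ppol S K q (\<lambda>s. f s + g s - h s) s = Ppol S K q f s + Ppol S K q g s - Ppol S K q h s"
  by (simp add: Ppol_expct expct_add expct_diff)

lemma funpow_decomposed:
  assumes f: "\<And>s. s < S \<Longrightarrow> Ppol S K q f s = f s"
    and v: "\<And>s. s < S \<Longrightarrow> v s = f s + z s - Ppol S K q z s" and s: "s < S"
  shows "(Ppol S K q ^^ t) v s = f s + (Ppol S K q ^^ t) z s - (Ppol S K q ^^ Suc t) z s"
  using s
proof (induction t arbitrary: s)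
  case (Suc t)
  have "(Ppol S K q ^^ Suc t) v s
      = Ppol S K q (\<lambda>s. f s + (Ppol S K q ^^ t) z s - (Ppol S K q ^^ Suc t) z s) s"
    using Ppol_cong[of S "(Ppol S K q ^^ t) v" "\<lambda>s. f s + (Ppol S K q ^^ t) z s - (Ppol S K q ^^ Suc t) z s" K q]
      Suc.IH by simp
  also have "\<dots> = f s + (Ppol S K q ^^ Suc t) z s - (Ppol S K q ^^ Suc (Suc t)) z s"
    using f[OF Suc.prems] by (simp add: Ppol_add_diff)
  finally show ?case .
qed (use v in auto)

lemma bounded_over_n_tendsto_0:
  assumes "\<And>n. \<bar>x n\<bar> \<le> (B::real)"
  shows "(\<lambda>n. x n / real n) \<longlonglongrightarrow> 0"
proof (rule tendsto_0_le[of "\<lambda>n. 1 / real n" _ _ B])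
  show "(\<lambda>n. 1 / real n) \<longlonglongrightarrow> 0" by (rule lim_1_over_n)
  show "\<forall>\<^sub>F n in sequentially. norm (x n / real n) \<le> norm (1 / real n) * B"
    using assms by (intro always_eventually) (auto simp: divide_right_mono)
qed

text \<open>The decomposition is used twice. For r = f + z - T z, telescoping identifies the gain as
  f and the partial sums of r - f as z - T^N z. For a periodic chain T^N z need not converge, but
  its averages tend to the fixed part f' of z, so the bias is z - f'.\<close>

lemma gain_bias_decomposed:
  assumes K: "pstoch S K q"
  shows "\<exists>f h. (\<forall>s<S. Ppol S K q f s = f s) \<and> (\<forall>s<S. f s + h s = r s (q s) + Ppol S K q h s) \<and>
    (\<forall>s<S. gain S K r q s = f s) \<and> (\<forall>s<S. bias S K r q s = h s)"
proof -
  let ?T = "Ppol S K q"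
  obtain f z where f: "\<And>s. s < S \<Longrightarrow> ?T f s = f s"
    and z: "\<And>s. s < S \<Longrightarrow> rpol r q s = f s + z s - ?T z s"
    using ergodic_decomposition[OF K, of "rpol r q"] by blast
  obtain f' z' where f': "\<And>s. s < S \<Longrightarrow> ?T f' s = f' s"
    and z': "\<And>s. s < S \<Longrightarrow> z s = f' s + z' s - ?T z' s"
    using ergodic_decomposition[OF K, of z] by blast
  obtain B where B: "B \<ge> 0" "\<forall>s<S. \<bar>z s\<bar> \<le> B" using exists_bound by blast
  obtain B' where B': "B' \<ge> 0" "\<forall>s<S. \<bar>z' s\<bar> \<le> B'" using exists_bound by blast
  have bd: "\<bar>(?T ^^ t) z s\<bar> \<le> B" "\<bar>(?T ^^ t) z' s\<bar> \<le> B'" if "s < S" for t s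
    using funpow_Ppol_bounded[OF K _ that] B B' by auto
  have gain: "gain S K r q s = f s" if s: "s < S" for s
  proof -
    have sum: "(\<Sum>t<N. Ppow_r S K r q t s) = real N * f s + (z s - (?T ^^ N) z s)" for N
      by (induction N) (simp_all add: Ppow_r_def funpow_decomposed[where S = S, OF f z s] algebra_simps)
    have "(\<lambda>N. f s + (z s - (?T ^^ N) z s) / real N) \<longlonglongrightarrow> f s + 0"
    proof (intro tendsto_add tendsto_const bounded_over_n_tendsto_0)
      show "\<bar>z s - (?T ^^ N) z s\<bar> \<le> B + B" for N
        using bd(1)[OF s, of N] bd(1)[OF s, of 0] by (simp del: funpow.simps(2))
    qed
    moreover have "\<forall>\<^sub>F N in sequentially. f s + (z s - (?T ^^ N) z s) / real N
        = (\<Sum>t<N. Ppow_r S K r q t s) / real N"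
      using eventually_gt_at_top[of 0] by eventually_elim (simp add: sum field_simps)
    ultimately have "(\<lambda>N. (\<Sum>t<N. Ppow_r S K r q t s) / real N) \<longlonglongrightarrow> f s"
      by (simp add: filterlim_cong)
    then show ?thesis unfolding gain_def by (rule limI)
  qed
  have bias: "bias S K r q s = z s - f' s" if s: "s < S" for s
  proof -
    have sum: "(\<Sum>t<N. Ppow_r S K r q t s - gain S K r q s) = z s - (?T ^^ N) z s" for N
      by (induction N) (simp_all add: Ppow_r_def funpow_decomposed[where S = S, OF f z s] gain[OF s])
    have sum2: "(\<Sum>t\<in>{1..N}. (?T ^^ t) z s) = real N * f' s + (?T z' s - (?T ^^ Suc N) z' s)" for N
      by (induction N) (simp_all add: funpow_decomposed[where S = S, OF f' z' s] algebra_simps del: funpow.simps,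
          simp_all add: algebra_simps)
    have "(\<lambda>N. (z s - f' s) - (?T z' s - (?T ^^ Suc N) z' s) / real N) \<longlonglongrightarrow> (z s - f' s) - 0"
    proof (intro tendsto_diff tendsto_const bounded_over_n_tendsto_0)
      show "\<bar>?T z' s - (?T ^^ Suc N) z' s\<bar> \<le> B' + B'" for N
        using bd(2)[OF s, of "Suc N"] bd(2)[OF s, of 1] by simp
    qed
    moreover have "\<forall>\<^sub>F N in sequentially. (z s - f' s) - (?T z' s - (?T ^^ Suc N) z' s) / real N
        = (\<Sum>T\<in>{1..N}. \<Sum>t<T. Ppow_r S K r q t s - gain S K r q s) / real N"
      using eventually_gt_at_top[of 0]
      by eventually_elim (simp only: sum, simp only: sum_subtractf sum2, simp add: field_simps)
    ultimately have "(\<lambda>N. (\<Sum>T\<in>{1..N}. \<Sum>t<T. Ppow_r S K r q t s - gain S K r q s) / real N)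
        \<longlonglongrightarrow> z s - f' s"
      by (simp add: filterlim_cong)
    then show ?thesis unfolding bias_def by (rule limI)
  qed
  have "f s + (z s - f' s) = r s (q s) + ?T (\<lambda>s. z s - f' s) s" if "s < S" for s
    using z[OF that] f'[OF that] by (simp add: Ppol_expct expct_diff rpol_def)
  then show ?thesis
    by (intro exI[of _ f] exI[of _ "\<lambda>s. z s - f' s"]) (use f gain bias in auto)
qed

lemma gain_harmonic:
  assumes "pstoch S K q" "s < S"
  shows "expct S (K s (q s)) (gain S K r q) = gain S K r q s"
proof -
  obtain f h where "\<forall>s<S. Ppol S K q f s = f s" "\<forall>s<S. gain S K r q s = f s"
    using gain_bias_decomposed[OF assms(1), of r] by blast
  then show ?thesis using assms(2) expct_cong[of S "gain S K r q" f] by (simp add: Ppol_expct)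
qed

lemma gain_bias_poisson:
  assumes "pstoch S K q" "s < S"
  shows "gain S K r q s + bias S K r q s = r s (q s) + expct S (K s (q s)) (bias S K r q)"
proof -
  obtain f h where "\<forall>s<S. f s + h s = r s (q s) + Ppol S K q h s"
    "\<forall>s<S. gain S K r q s = f s" "\<forall>s<S. bias S K r q s = h s"
    using gain_bias_decomposed[OF assms(1), of r] by blast
  then show ?thesis using assms(2) expct_cong[of S "bias S K r q" h] by (simp add: Ppol_expct)
qed

section \<open>The span, and the passage between gain and discounted value\<close>

lemma span_bounds:
  assumes "i < S" "j < S"
  shows "v i - v j \<le> span S v"
proof -
  have "v i \<le> Max (v ` {..<S})" "Min (v ` {..<S}) \<le> v j" using assms by (auto intro!: Max_ge Min_le)
  then show ?thesis by (simp add: span_def)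
qed

lemma span_nonneg: "0 < S \<Longrightarrow> 0 \<le> span S v"
  using span_bounds[of 0 S 0 v] by simp

lemma span_attained:
  assumes "0 < S"
  shows "\<exists>i<S. \<exists>j<S. span S v = v i - v j \<and> (\<forall>k<S. v j \<le> v k \<and> v k \<le> v i)"
proof -
  have "Max (v ` {..<S}) \<in> v ` {..<S}" "Min (v ` {..<S}) \<in> v ` {..<S}"
    using assms by (auto intro!: Max_in Min_in)
  then obtain i j where ij: "i < S" "j < S" "Max (v ` {..<S}) = v i" "Min (v ` {..<S}) = v j" by auto
  have "v j \<le> v k \<and> v k \<le> v i" if "k < S" for k
    using that by (auto intro!: Max_ge Min_le simp flip: ij(3,4))
  then show ?thesis using ij by (auto simp: span_def)
qed

lemma span_le:
  assumes "0 < S" "\<And>i j. i < S \<Longrightarrow> j < S \<Longrightarrow> v i - v j \<le> c"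
  shows "span S v \<le> c"
  using span_attained[OF assms(1), of v] assms(2) by auto

text \<open>The natural candidate is gain / (1 - \<gamma>) plus a shift of the bias. Shifted to be
  nonpositive, the bias only grows when its average is multiplied by \<gamma>, which gives a
  subsolution; shifted to be nonnegative, it gives a supersolution. The two shifts differ by the
  span.\<close>

lemma disc_value_near_gain:
  assumes K: "pstoch S K q" and g: "0 \<le> \<gamma>" "\<gamma> < 1" and s: "s < S"
  shows "\<bar>disc_value S K r q \<gamma> s - gain S K r q s / (1 - \<gamma>)\<bar> \<le> span S (bias S K r q)"
proof -
  let ?f = "gain S K r q" and ?h = "bias S K r q"
  have S: "0 < S" using s by simp
  obtain i j where ij: "i < S" "j < S" "span S ?h = ?h i - ?h j" "\<And>k. k < S \<Longrightarrow> ?h j \<le> ?h k \<and> ?h k \<le> ?h i"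
    using span_attained[OF S, of ?h] by auto
  have gg: "x / (1 - \<gamma>) = x + \<gamma> * (x / (1 - \<gamma>))" for x using g by (simp add: field_simps)
  have pe: "expct S (K k (q k)) (\<lambda>k. ?f k / (1 - \<gamma>) + (?h k - c))
      = ?f k / (1 - \<gamma>) + (expct S (K k (q k)) ?h - c)" if "k < S" for k c
    using gain_harmonic[OF K that, of r] expct_cmult[of S "K k (q k)" "1 / (1 - \<gamma>)" ?f]
    by (simp add: expct_add expct_diff expct_const[OF pstochD[OF K that]])
  have "?f s / (1 - \<gamma>) + (?h s - ?h i) \<le> disc_value S K r q \<gamma> s"
  proof (rule disc_value_ge[OF pstoch_subchain[OF K] g _ s])
    fix k assume k: "k < S"
    have "expct S (K k (q k)) ?h - ?h i \<le> 0"
      using expct_le_const'[OF pstochD[OF K k], of ?h "?h i"] ij by auto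
    then have "expct S (K k (q k)) ?h - ?h i \<le> \<gamma> * (expct S (K k (q k)) ?h - ?h i)"
      using g mult_right_mono_neg[of \<gamma> 1 "expct S (K k (q k)) ?h - ?h i"] by simp
    then show "?f k / (1 - \<gamma>) + (?h k - ?h i) \<le> r k (q k)
        + \<gamma> * expct S (K k (q k)) (\<lambda>k. ?f k / (1 - \<gamma>) + (?h k - ?h i))"
      unfolding pe[OF k] distrib_left using gain_bias_poisson[OF K k, of r] gg[of "?f k"] by linarith
  qed
  moreover have "disc_value S K r q \<gamma> s \<le> ?f s / (1 - \<gamma>) + (?h s - ?h j)"
  proof (rule disc_value_le[OF pstoch_subchain[OF K] g _ s])
    fix k assume k: "k < S"
    have "0 \<le> expct S (K k (q k)) ?h - ?h j"
      using expct_ge_const[OF pstochD[OF K k], of "?h j" ?h] ij by auto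
    then have "\<gamma> * (expct S (K k (q k)) ?h - ?h j) \<le> expct S (K k (q k)) ?h - ?h j"
      using g mult_right_mono[of \<gamma> 1 "expct S (K k (q k)) ?h - ?h j"] by simp
    then show "r k (q k) + \<gamma> * expct S (K k (q k)) (\<lambda>k. ?f k / (1 - \<gamma>) + (?h k - ?h j))
        \<le> ?f k / (1 - \<gamma>) + (?h k - ?h j)"
      unfolding pe[OF k] distrib_left using gain_bias_poisson[OF K k, of r] gg[of "?f k"] by linarith
  qed
  ultimately show ?thesis using ij(3) ij(4)[OF s] by linarith
qed

lemma abel_gain:
  assumes K: "pstoch S K q" and s: "s < S"
  shows "((\<lambda>\<gamma>. (1 - \<gamma>) * disc_value S K r q \<gamma> s) \<longlongrightarrow> gain S K r q s) (at_left 1)"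
proof -
  let ?f = "gain S K r q s" and ?c = "span S (bias S K r q)"
  have "((\<lambda>\<gamma>::real. 1 - \<gamma>) \<longlongrightarrow> 1 - 1) (at_left 1)" by (intro tendsto_intros)
  then have l: "((\<lambda>\<gamma>::real. 1 - \<gamma>) \<longlongrightarrow> 0) (at_left 1)" by simp
  have "((\<lambda>\<gamma>. (1 - \<gamma>) * disc_value S K r q \<gamma> s - ?f) \<longlongrightarrow> 0) (at_left 1)"
  proof (rule tendsto_0_le[OF l, of _ ?c])
    show "\<forall>\<^sub>F \<gamma> in at_left 1. norm ((1 - \<gamma>) * disc_value S K r q \<gamma> s - ?f) \<le> norm (1 - \<gamma>) * ?c"
      using eventually_at_left_real[of 0 "1::real", OF zero_less_one]
    proof eventually_elim
      case (elim \<gamma>)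
      then have g: "0 \<le> \<gamma>" "\<gamma> < 1" by auto
      have "(1 - \<gamma>) * disc_value S K r q \<gamma> s - ?f = (1 - \<gamma>) * (disc_value S K r q \<gamma> s - ?f / (1 - \<gamma>))"
        using g by (simp add: right_diff_distrib)
      then show ?case
        using disc_value_near_gain[OF K g s, of r] g by (simp add: abs_mult mult_left_mono)
    qed
  qed
  then show ?thesis by (simp add: Lim_null[of _ ?f])
qed

text \<open>A larger discount x amounts to discount \<gamma> with a continuation of weight x -
  \<gamma>, which is worth at least \<open>m\<close> wherever it occurs. So the \<gamma>-value plus
  the constant \<open>c\<close> is a subsolution at discount x; multiply by 1 - x and let x tend to
  1.\<close>

lemma gain_ge_disc_value:
  assumes K: "pstoch S K q" and g: "0 \<le> \<gamma>" "\<gamma> < 1" and s: "s < S"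
    and m: "\<And>s. s < S \<Longrightarrow> m \<le> disc_value S K r q \<gamma> s"
  shows "(1 - \<gamma>) * m \<le> gain S K r q s"
proof -
  let ?V = "disc_value S K r q \<gamma>"
  have "((\<lambda>x. (1 - x) * ?V s + (x - \<gamma>) * m) \<longlongrightarrow> (1 - 1) * ?V s + (1 - \<gamma>) * m) (at_left 1)"
    by (intro tendsto_intros)
  then have l: "((\<lambda>x. (1 - x) * ?V s + (x - \<gamma>) * m) \<longlongrightarrow> (1 - \<gamma>) * m) (at_left 1)" by simp
  have "\<forall>\<^sub>F x in at_left 1. (1 - x) * ?V s + (x - \<gamma>) * m \<le> (1 - x) * disc_value S K r q x s"
    using eventually_at_left_real[OF g(2)]
  proof eventually_elim
    case (elim x)
    then have x: "0 \<le> x" "x < 1" "\<gamma> \<le> x" using g by auto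
    define c where "c = (x - \<gamma>) * m / (1 - x)"
    have c: "(1 - x) * c = (x - \<gamma>) * m" using x by (simp add: c_def)
    have "?V s + c \<le> disc_value S K r q x s"
    proof (rule disc_value_ge[OF pstoch_subchain[OF K] x(1,2) _ s])
      fix k assume k: "k < S"
      have "(x - \<gamma>) * m \<le> (x - \<gamma>) * expct S (K k (q k)) ?V"
        using expct_ge_const[OF pstochD[OF K k] m] x by (intro mult_left_mono) auto
      then show "?V k + c \<le> r k (q k) + x * expct S (K k (q k)) (\<lambda>k. ?V k + c)"
        using disc_value_fixed_point[OF pstoch_subchain[OF K] g k, of r] c
        by (simp add: expct_add expct_const[OF pstochD[OF K k]] algebra_simps)
    qed
    then have "(1 - x) * (?V s + c) \<le> (1 - x) * disc_value S K r q x s"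
      using x by (intro mult_left_mono) auto
    then show ?case using c by (simp add: distrib_left)
  qed
  then show ?thesis by (intro tendsto_le[OF _ abel_gain[OF K s] l]) auto
qed

lemma gain_bounds:
  assumes K: "pstoch S K q" and r: "\<And>s. s < S \<Longrightarrow> 0 \<le> r s (q s) \<and> r s (q s) \<le> 1" and s: "s < S"
  shows "0 \<le> gain S K r q s" "gain S K r q s \<le> 1"
proof -
  have b: "0 \<le> disc_value S K r q x i" "(1 - x) * disc_value S K r q x i \<le> 1"
    if "0 \<le> x" "x < 1" "i < S" for x i
    using disc_value_bounds[where S = S and K = K and q = q and r = r and R = 1 and \<gamma> = x and s = i]
      pstoch_subchain[OF K] that r by (auto simp: field_simps)
  show "0 \<le> gain S K r q s"
    using gain_ge_disc_value[OF K _ _ s, of 0 0 r] b(1)[of 0] by simp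
  have "\<forall>\<^sub>F x in at_left 1. (1 - x) * disc_value S K r q x s \<le> 1"
    using eventually_at_left_real[of 0 "1::real", OF zero_less_one]
    by eventually_elim (use b(2) s in auto)
  then show "gain S K r q s \<le> 1"
    by (intro tendsto_upperbound[OF abel_gain[OF K s]]) auto
qed

text \<open>The anchored gain is constant, since its deviation from the gain at \<open>s0\<close>
  solves a discounted equation with zero reward. Its Poisson equation is then the (1 -
  \<eta>)-discounted equation up to a constant, and the span does not see constants.\<close>

lemma span_bias_anchor:
  assumes s0: "s0 < S" and e: "0 < \<eta>" "\<eta> \<le> 1" and K: "pstoch S K q"
  shows "span S (bias S (anchor s0 \<eta> K) r q) = span S (disc_value S K r q (1 - \<eta>))"
proof -
  let ?K = "anchor s0 \<eta> K"
  let ?f = "gain S ?K r q" and ?h = "bias S ?K r q"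
  have S: "0 < S" using s0 by simp
  have g: "0 \<le> 1 - \<eta>" "1 - \<eta> < 1" using e by auto
  have aK: "pstoch S ?K q" using pstoch_anchor[OF s0 _ _ K] e by simp
  have f: "?f s = ?f s0" if "s < S" for s
  proof -
    have "disc_value S K (\<lambda>_ _. 0) q (1 - \<eta>) s = ?f s - ?f s0"
    proof (rule disc_value_unique[OF pstoch_subchain[OF K] g _ that])
      fix k assume k: "k < S"
      show "?f k - ?f s0 = 0 + (1 - \<eta>) * expct S (K k (q k)) (\<lambda>k. ?f k - ?f s0)"
        using gain_harmonic[OF aK k, of r]
        by (simp add: expct_anchor[OF s0] expct_diff expct_const[OF pstochD[OF K k]] algebra_simps)
    qed
    moreover have "disc_value S K (\<lambda>_ _. 0) q (1 - \<eta>) s = 0"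
      by (rule disc_value_unique[OF pstoch_subchain[OF K] g _ that]) (simp add: expct_def)
    ultimately show ?thesis by simp
  qed
  \<comment> \<open>The shift for which the constant \<eta> h(s0) minus the gain, left over in the
    Poisson equation, cancels.\<close>
  define k where "k = (\<eta> * ?h s0 - ?f s0) / \<eta>"
  have V: "disc_value S K r q (1 - \<eta>) s = ?h s - k" if "s < S" for s
  proof (rule disc_value_unique[OF pstoch_subchain[OF K] g _ that])
    fix i assume i: "i < S"
    have "\<eta> * k = \<eta> * ?h s0 - ?f s0" using e by (simp add: k_def)
    then show "?h i - k = r i (q i) + (1 - \<eta>) * expct S (K i (q i)) (\<lambda>s. ?h s - k)"
      using gain_bias_poisson[OF aK i, of r] f[OF i]
      by (simp add: expct_anchor[OF s0] expct_diff expct_const[OF pstochD[OF K i]] algebra_simps)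
  qed
  show ?thesis
  proof (rule antisym)
    show "span S ?h \<le> span S (disc_value S K r q (1 - \<eta>))"
      by (rule span_le[OF S]) (use span_bounds[of _ S _ "disc_value S K r q (1 - \<eta>)"] V in force)
    show "span S (disc_value S K r q (1 - \<eta>)) \<le> span S ?h"
      by (rule span_le[OF S]) (use span_bounds[of _ S _ ?h] V in force)
  qed
qed

subsection \<open>Blackwell optimality\<close>

text \<open>The expected rewards at successive times obey a linear recurrence with constant
  coefficients, by \<open>annihilating_relation\<close>, so their generating function is a quotient
  of polynomials.\<close>

lemma disc_value_rational:
  assumes K: "subchain S K q" and s: "s < S"
  shows "\<exists>Q N :: real poly. Q \<noteq> 0 \<and> (\<forall>\<gamma>. 0 \<le> \<gamma> \<and> \<gamma> < 1 \<longrightarrow> poly Q \<gamma> * disc_value S K r q \<gamma> s = poly N \<gamma>)"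
proof -
  define a where "a t = Ppow_r S K r q t s" for t
  obtain c where c: "\<exists>i\<le>S. c i \<noteq> 0" "\<forall>s<S. (\<Sum>i\<le>S. c i * (Ppol S K q ^^ i) (rpol r q) s) = 0"
    using annihilating_relation[of S K q "rpol r q"] by blast
  have rec: "(\<Sum>i\<le>S. c i * a (t + i)) = 0" for t
  proof -
    have "\<forall>s<S. (\<Sum>i\<le>S. c i * Ppow_r S K r q (t + i) s) = 0"
    proof (induction t)
      case 0
      then show ?case using c(2) by (simp add: Ppow_r_def)
    next
      case (Suc t)
      show ?case
      proof (intro allI impI)
        fix s assume "s < S"
        have "(\<Sum>i\<le>S. c i * Ppow_r S K r q (Suc t + i) s)
            = Ppol S K q (\<lambda>s. \<Sum>i\<le>S. c i * Ppow_r S K r q (t + i) s) s"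
          by (simp add: Ppow_r_Suc) (simp add: Ppol_expct expct_sum expct_cmult)
        also have "\<dots> = Ppol S K q (\<lambda>_. 0) s"
          using Suc Ppol_cong[of S "\<lambda>s. \<Sum>i\<le>S. c i * Ppow_r S K r q (t + i) s" "\<lambda>_. 0" K q] by simp
        finally show "(\<Sum>i\<le>S. c i * Ppow_r S K r q (Suc t + i) s) = 0" by (simp add: Ppol_zero)
      qed
    qed
    then show ?thesis using s by (simp add: a_def)
  qed
  \<comment> \<open>The recurrence polynomial with its coefficients reversed; \<open>N\<close>
    collects the initial terms that the shifted series miss.\<close>
  define Q where "Q = (\<Sum>i\<le>S. monom (c i) (S - i))"
  define N where "N = (\<Sum>i\<le>S. monom (c i) (S - i) * (\<Sum>t<i. monom (a t) t))"
  have Q0: "Q \<noteq> 0"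
  proof -
    obtain j where j: "j \<le> S" "c j \<noteq> 0" using c(1) by blast
    have "coeff Q (S - j) = (\<Sum>i\<le>S. if i = j then c i else 0)"
      unfolding Q_def coeff_sum using j by (intro sum.cong) auto
    also have "\<dots> = c j" using j by simp
    finally show ?thesis using j by auto
  qed
  have "poly Q \<gamma> * disc_value S K r q \<gamma> s = poly N \<gamma>" if g: "0 \<le> \<gamma>" "\<gamma> < 1" for \<gamma>
  proof -
    let ?V = "disc_value S K r q \<gamma> s"
    have sm: "summable (\<lambda>t. \<gamma> ^ t * a t)" unfolding a_def by (rule disc_summable[OF K g s])
    have smi: "summable (\<lambda>t. \<gamma> ^ (t + i) * a (t + i))" for i
      using summable_ignore_initial_segment[OF sm, of i] .
    have tail: "(\<Sum>t. \<gamma> ^ (t + i) * a (t + i)) = ?V - (\<Sum>t<i. \<gamma> ^ t * a t)" for i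
      using suminf_split_initial_segment[OF sm, of i] by (simp add: disc_value_def a_def)
    have "poly Q \<gamma> * ?V - poly N \<gamma> = (\<Sum>i\<le>S. c i * \<gamma> ^ (S - i) * (?V - (\<Sum>t<i. \<gamma> ^ t * a t)))"
      by (simp add: Q_def N_def poly_sum poly_monom sum_distrib_left right_diff_distrib sum_subtractf mult_ac)
    also have "\<dots> = (\<Sum>i\<le>S. \<Sum>t. c i * \<gamma> ^ (S - i) * (\<gamma> ^ (t + i) * a (t + i)))"
      unfolding tail[symmetric] by (intro sum.cong refl suminf_mult[symmetric] smi)
    also have "\<dots> = (\<Sum>t. \<Sum>i\<le>S. c i * \<gamma> ^ (S - i) * (\<gamma> ^ (t + i) * a (t + i)))"
      by (intro suminf_sum[symmetric] summable_mult smi)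
    also have "\<dots> = (\<Sum>t. \<gamma> ^ (S + t) * (\<Sum>i\<le>S. c i * a (t + i)))"
      unfolding sum_distrib_left
      by (intro suminf_cong sum.cong refl) (auto simp flip: power_add simp: mult_ac)
    also have "\<dots> = 0" by (simp add: rec)
    finally show ?thesis by simp
  qed
  then show ?thesis using Q0 by blast
qed

lemma poly_nonzero_at_left:
  assumes "(p :: real poly) \<noteq> 0"
  shows "\<forall>\<^sub>F x in at_left 1. poly p x \<noteq> 0"
proof -
  have "\<forall>\<^sub>F x in at_left 1. \<forall>y\<in>{y. poly p y = 0}. x \<noteq> y"
    by (intro eventually_ball_finite poly_roots_finite assms ballI eventually_neq_at_within)
  then show ?thesis by eventually_elim auto
qed

text \<open>Between the largest root below 1 and 1 itself, a change of sign would produce a further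
  root.\<close>

lemma poly_sign_at_left:
  assumes "(p :: real poly) \<noteq> 0"
  shows "(\<forall>\<^sub>F x in at_left 1. poly p x > 0) \<or> (\<forall>\<^sub>F x in at_left 1. poly p x < 0)"
proof -
  obtain b where b: "b < 1" "\<And>x. b < x \<Longrightarrow> x < 1 \<Longrightarrow> poly p x \<noteq> 0"
    using poly_nonzero_at_left[OF assms] unfolding eventually_at_left_field by blast
  define m where "m = (b + 1) / 2"
  have m: "b < m" "m < 1" using b(1) by (auto simp: m_def)
  have same: "poly p m * poly p x > 0" if "b < x" "x < 1" for x
  proof (rule ccontr)
    assume "\<not> ?thesis"
    then have neg: "poly p m * poly p x < 0"
      using b(2)[OF m] b(2)[OF that] by (simp add: not_less order_less_le)
    have "\<not> m < x"
    proof
      assume "m < x"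
      then obtain y where "m < y" "y < x" "poly p y = 0" using poly_IVT[of m x p] neg by blast
      then show False using b(2)[of y] m that by auto
    qed
    moreover have "\<not> x < m"
    proof
      assume "x < m"
      then obtain y where "x < y" "y < m" "poly p y = 0" using poly_IVT[of x m p] neg by (auto simp: mult.commute)
      then show False using b(2)[of y] m that by auto
    qed
    ultimately have "x = m" by simp
    then show False using neg by (simp add: not_less flip: power2_eq_square)
  qed
  have ev: "\<forall>\<^sub>F x in at_left 1. b < x \<and> x < 1"
    using eventually_at_left_real[OF b(1)] by eventually_elim auto
  show ?thesis
  proof (cases "poly p m > 0")
    case True
    have "\<forall>\<^sub>F x in at_left 1. poly p x > 0"
      using ev by eventually_elim (use same True in \<open>auto simp: zero_less_mult_iff\<close>)
    then show ?thesis ..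
  next
    case False
    have "\<forall>\<^sub>F x in at_left 1. poly p x < 0"
      using ev by eventually_elim (use same False in \<open>force simp: zero_less_mult_iff\<close>)
    then show ?thesis ..
  qed
qed

text \<open>Clearing denominators gives D (V - V') = R with polynomials D and R. Multiplying once
  more by D replaces D by its square, so the sign of V - V' is that of R D, which is eventually
  constant.\<close>

lemma disc_value_comparison_stabilizes:
  assumes K: "subchain S K q" "subchain S K q'" and s: "s < S"
  shows "(\<forall>\<^sub>F \<gamma> in at_left 1. disc_value S K r q \<gamma> s \<le> disc_value S K r q' \<gamma> s) \<or>
    (\<forall>\<^sub>F \<gamma> in at_left 1. \<not> disc_value S K r q \<gamma> s \<le> disc_value S K r q' \<gamma> s)"
proof -
  obtain Q N where Q: "Q \<noteq> 0" "\<And>\<gamma>. 0 \<le> \<gamma> \<and> \<gamma> < 1 \<Longrightarrow> poly Q \<gamma> * disc_value S K r q \<gamma> s = poly N \<gamma>"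
    using disc_value_rational[OF K(1) s, of r] by blast
  obtain Q' N' where Q': "Q' \<noteq> 0" "\<And>\<gamma>. 0 \<le> \<gamma> \<and> \<gamma> < 1 \<Longrightarrow> poly Q' \<gamma> * disc_value S K r q' \<gamma> s = poly N' \<gamma>"
    using disc_value_rational[OF K(2) s, of r] by blast
  define D where "D = Q * Q'"
  define R where "R = N * Q' - N' * Q"
  have D0: "D \<noteq> 0" using Q(1) Q'(1) by (simp add: D_def)
  have ev: "\<forall>\<^sub>F \<gamma> in at_left 1. poly D \<gamma> \<noteq> 0 \<and>
      poly D \<gamma> * (disc_value S K r q \<gamma> s - disc_value S K r q' \<gamma> s) = poly R \<gamma>"
    using eventually_at_left_real[of 0 "1::real", OF zero_less_one] poly_nonzero_at_left[OF D0]
  proof eventually_elim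
    case (elim \<gamma>)
    then have "poly Q \<gamma> * disc_value S K r q \<gamma> s = poly N \<gamma>" "poly Q' \<gamma> * disc_value S K r q' \<gamma> s = poly N' \<gamma>"
      using Q(2)[of \<gamma>] Q'(2)[of \<gamma>] by auto
    then show ?case using elim by (simp add: D_def R_def algebra_simps flip: \<open>_ = poly N \<gamma>\<close> \<open>_ = poly N' \<gamma>\<close>)
  qed
  show ?thesis
  proof (cases "R = 0")
    case True
    have "\<forall>\<^sub>F \<gamma> in at_left 1. disc_value S K r q \<gamma> s \<le> disc_value S K r q' \<gamma> s"
      using ev by eventually_elim (use True in auto)
    then show ?thesis ..
  next
    case False
    then have RD: "R * D \<noteq> 0" using D0 by simp
    have sg: "\<forall>\<^sub>F \<gamma> in at_left 1. poly D \<gamma> \<noteq> 0 \<and> poly (R * D) \<gamma>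
        = (poly D \<gamma>)\<^sup>2 * (disc_value S K r q \<gamma> s - disc_value S K r q' \<gamma> s)"
      using ev
    proof eventually_elim
      case (elim \<gamma>)
      then show ?case by (metis mult.assoc mult.commute poly_mult power2_eq_square)
    qed
    from poly_sign_at_left[OF RD] show ?thesis
    proof
      assume "\<forall>\<^sub>F x in at_left 1. poly (R * D) x > 0"
      with sg have "\<forall>\<^sub>F \<gamma> in at_left 1. \<not> disc_value S K r q \<gamma> s \<le> disc_value S K r q' \<gamma> s"
        by eventually_elim (auto simp: zero_less_mult_iff)
      then show ?thesis ..
    next
      assume "\<forall>\<^sub>F x in at_left 1. poly (R * D) x < 0"
      with sg have "\<forall>\<^sub>F \<gamma> in at_left 1. disc_value S K r q \<gamma> s \<le> disc_value S K r q' \<gamma> s"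
        by eventually_elim (auto simp: mult_less_0_iff)
      then show ?thesis ..
    qed
  qed
qed

text \<open>There are finitely many comparisons between policies and states, each eventually frozen.
  A policy that is optimal at one discount in the common frozen range is optimal throughout
  it.\<close>

lemma blackwell_exists:
  assumes K: "stochkernel S A K" and A: "0 < A"
  shows "\<exists>p. blackwell_optimal S A K r p"
proof -
  define le where "le q q' s \<gamma> \<longleftrightarrow> disc_value S K r q \<gamma> s \<le> disc_value S K r q' \<gamma> s" for q q' s \<gamma>
  have sub: "subchain S K q" if "q \<in> pols S A" for q
    using subkernelD[OF stochkernel_subkernel[OF K] pols_is_policy[OF that]] .
  have "\<forall>\<^sub>F \<gamma> in at_left 1. \<forall>q\<in>pols S A. \<forall>q'\<in>pols S A. \<forall>s\<in>{..<S}.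
      le q q' s \<gamma> = (\<forall>\<^sub>F \<gamma> in at_left 1. le q q' s \<gamma>)"
  proof (intro eventually_ball_finite finite_pols ballI)
    fix q q' s assume "q \<in> pols S A" "q' \<in> pols S A" "s \<in> {..<S}"
    then have "(\<forall>\<^sub>F \<gamma> in at_left 1. le q q' s \<gamma>) \<or> (\<forall>\<^sub>F \<gamma> in at_left 1. \<not> le q q' s \<gamma>)"
      unfolding le_def by (intro disc_value_comparison_stabilizes sub) auto
    then show "\<forall>\<^sub>F \<gamma> in at_left 1. le q q' s \<gamma> = (\<forall>\<^sub>F \<gamma> in at_left 1. le q q' s \<gamma>)"
    proof
      assume a: "\<forall>\<^sub>F \<gamma> in at_left 1. le q q' s \<gamma>"
      then show ?thesis by eventually_elim (use a in auto)
    next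
      assume a: "\<forall>\<^sub>F \<gamma> in at_left 1. \<not> le q q' s \<gamma>"
      have n: "\<not> (\<forall>\<^sub>F \<gamma> in at_left 1. le q q' s \<gamma>)"
      proof
        assume "\<forall>\<^sub>F \<gamma> in at_left 1. le q q' s \<gamma>"
        with a have "\<forall>\<^sub>F \<gamma>::real in at_left 1. False" by eventually_elim auto
        then show False by simp
      qed
      show ?thesis using a by eventually_elim (use n in auto)
    qed
  qed simp
  then obtain b where b: "b < 1" and st: "\<And>\<gamma> q q' s. b < \<gamma> \<Longrightarrow> \<gamma> < 1 \<Longrightarrow> q \<in> pols S A \<Longrightarrow> q' \<in> pols S A \<Longrightarrow>
      s < S \<Longrightarrow> le q q' s \<gamma> = (\<forall>\<^sub>F \<gamma> in at_left 1. le q q' s \<gamma>)"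
    unfolding eventually_at_left_field by (auto simp: Ball_def)
  define g where "g = (max b 0 + 1) / 2"
  have g: "0 \<le> g" "g < 1" "b < g" using b by (auto simp: g_def max_def)
  obtain p where p: "p \<in> pols S A" "disc_optimal S A K r g p"
    using disc_optimal_exists[OF stochkernel_subkernel[OF K] g(1,2) A] by blast
  have "disc_value S K r q \<gamma> s \<le> disc_value S K r p \<gamma> s"
    if h: "g \<le> \<gamma>" "\<gamma> < 1" and q: "is_policy S A q" and s: "s < S" for \<gamma> q s
  proof -
    let ?q = "restrict q {..<S}"
    have rq: "?q \<in> pols S A" by (rule restrict_pols[OF q])
    have "le ?q p s g" using p(2) rq s by (auto simp: disc_optimal_def le_def)
    then have "le ?q p s \<gamma>" using st[OF g(3,2) rq p(1) s] st[of \<gamma>, OF _ h(2) rq p(1) s] h g by simp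
    then show ?thesis using disc_value_restrict[OF s, of K r q \<gamma>] by (simp add: le_def)
  qed
  then show ?thesis
    unfolding blackwell_optimal_def using pols_is_policy[OF p(1)] g(2) by (intro exI[of _ p]) blast
qed

section \<open>Optimal gain of a weakly communicating model\<close>

lemma blackwell_gain_superharmonic:
  assumes K: "stochkernel S A K" and bw: "blackwell_optimal S A K r p" and s: "s < S" and a: "a < A"
  shows "expct S (K s a) (gain S K r p) \<le> gain S K r p s"
proof -
  obtain g0 where g0: "g0 < 1" and opt: "\<And>g q s. g0 \<le> g \<Longrightarrow> g < 1 \<Longrightarrow> is_policy S A q \<Longrightarrow> s < S \<Longrightarrow>
      disc_value S K r q g s \<le> disc_value S K r p g s"
    using bw by (auto simp: blackwell_optimal_def)
  have p: "is_policy S A p" using bw by (simp add: blackwell_optimal_def)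
  have Kp: "pstoch S K p" by (rule stochkernel_pstoch[OF K p])
  let ?V = "\<lambda>g. disc_value S K r p g"
  have "((\<lambda>g. (1 - g) * r s a + g * (\<Sum>s'<S. K s a s' * ((1 - g) * ?V g s'))) \<longlongrightarrow>
      (1 - 1) * r s a + 1 * (\<Sum>s'<S. K s a s' * gain S K r p s')) (at_left 1)"
    by (intro tendsto_intros abel_gain[OF Kp]) auto
  then have l: "((\<lambda>g. (1 - g) * r s a + g * (\<Sum>s'<S. K s a s' * ((1 - g) * ?V g s'))) \<longlongrightarrow>
      expct S (K s a) (gain S K r p)) (at_left 1)" by (simp add: expct_def)
  have "max g0 0 < 1" using g0 by simp
  from eventually_at_left_real[OF this]
  have "\<forall>\<^sub>F g in at_left 1. (1 - g) * r s a + g * (\<Sum>s'<S. K s a s' * ((1 - g) * ?V g s'))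
      \<le> (1 - g) * ?V g s"
  proof eventually_elim
    case g: (elim g)
    have "disc_optimal S A K r g p"
      unfolding disc_optimal_def using p opt[of g] g pols_is_policy by auto
    then have "r s a + g * expct S (K s a) (?V g) \<le> ?V g s"
      using disc_optimal_bellman[OF stochkernel_subkernel[OF K] _ _ _ s a] g by auto
    then have "(1 - g) * (r s a + g * expct S (K s a) (?V g)) \<le> (1 - g) * ?V g s"
      using g by (intro mult_left_mono) auto
    then show ?case
      by (simp add: distrib_left expct_def sum_distrib_left mult_ac)
  qed
  then show ?thesis by (intro tendsto_le[OF _ abel_gain[OF Kp s] l]) auto
qed

text \<open>A state with a minimal set of reachable states is recurrent.\<close>

lemma closed_set_has_recurrent:
  assumes C: "C \<subseteq> {..<S}" "C \<noteq> {}" and cl: "\<And>s s'. s \<in> C \<Longrightarrow> chain_edge S A K mu s s' \<Longrightarrow> s' \<in> C"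
  shows "\<exists>s\<in>C. \<not> transient_under S A K mu s"
proof -
  let ?E = "chain_edge S A K mu"
  define R where "R s = {s'. ?E\<^sup>*\<^sup>* s s'}" for s
  have RC: "s' \<in> C" if "?E\<^sup>*\<^sup>* s s'" "s \<in> C" for s s'
    using that by (induction rule: rtranclp_induct) (auto intro: cl)
  have fin: "finite (R s)" if "s \<in> C" for s
    using RC[OF _ that] C(1) finite_subset[of "R s" "{..<S}"] by (auto simp: R_def)
  obtain s where s: "s \<in> C" "\<And>y. y \<in> C \<Longrightarrow> card (R s) \<le> card (R y)"
    using ex_has_least_nat[of "\<lambda>s. s \<in> C" _ "\<lambda>s. card (R s)"] C(2) by blast
  have "\<not> transient_under S A K mu s"
    unfolding transient_under_def
  proof clarify
    fix s' assume s': "?E\<^sup>*\<^sup>* s s'" "\<not> ?E\<^sup>*\<^sup>* s' s"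
    have "R s' \<subseteq> R s" using s'(1) by (auto simp: R_def)
    moreover have "s \<in> R s" "s \<notin> R s'" using s'(2) by (auto simp: R_def)
    ultimately have "card (R s') < card (R s)" by (intro psubset_card_mono fin s) auto
    then show False using s(2)[OF RC[OF s'(1) s(1)]] by simp
  qed
  then show ?thesis using s(1) by blast
qed

lemma expct_eq_bound_imp:
  assumes k: "stoch S k" and v: "\<And>s. s < S \<Longrightarrow> m \<le> v s" and le: "expct S k v \<le> m"
    and s: "s < S" "0 < k s"
  shows "v s = m"
proof (rule ccontr)
  assume "v s \<noteq> m"
  then have "m < v s" using v[OF s(1)] by simp
  then have "expct S k (\<lambda>_. m) < expct S k v"
    unfolding expct_def
  proof (intro sum_strict_mono_ex1)
    show "\<exists>s\<in>{..<S}. k s * m < k s * v s" using \<open>m < v s\<close> s by (intro bexI[of _ s]) auto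
  qed (use k v in \<open>auto simp: stoch_def intro!: mult_left_mono\<close>)
  then show False using le expct_const[OF k, of m] by simp
qed

text \<open>Superharmonicity makes the set of minimal gain closed under every action; harmonicity
  makes the set of maximal gain closed under the optimal policy. Each set contains a state recurrent
  for that policy, which must lie in \<open>Cl\<close>. A path inside \<open>Cl\<close> leads from
  the first to the second without leaving the minimal set.\<close>

lemma weakly_communicating_gain_const:
  assumes K: "stochkernel S A K" and A: "0 < A" and wc: "weakly_communicating S A K"
    and bw: "blackwell_optimal S A K r p" and s: "s < S" "s' < S"
  shows "gain S K r p s = gain S K r p s'"
proof -
  let ?f = "gain S K r p"
  have S: "0 < S" using s by simp
  have p: "is_policy S A p" using bw by (simp add: blackwell_optimal_def)
  have Kp: "pstoch S K p" by (rule stochkernel_pstoch[OF K p])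
  obtain Tr Cl where TC: "Tr \<inter> Cl = {}" "Tr \<union> Cl = {..<S}"
    and tr: "\<And>s mu. s \<in> Tr \<Longrightarrow> stationary_policy S A mu \<Longrightarrow> transient_under S A K mu s"
    and cl: "\<And>s s'. s \<in> Cl \<Longrightarrow> s' \<in> Cl \<Longrightarrow> (mdp_edge S A K)\<^sup>*\<^sup>* s s'"
    using wc unfolding weakly_communicating_def by blast
  define mu where "mu s a = (if a = p s then 1 else 0 :: real)" for s a
  have mu: "stationary_policy S A mu"
    using p by (auto simp: stationary_policy_def mu_def is_policy_def)
  have meets: "\<exists>s\<in>C. s \<in> Cl"
    if "C \<subseteq> {..<S}" "C \<noteq> {}" "\<And>s s'. s \<in> C \<Longrightarrow> s' < S \<Longrightarrow> 0 < K s (p s) s' \<Longrightarrow> s' \<in> C" for C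
  proof -
    have "\<exists>s\<in>C. \<not> transient_under S A K mu s"
      by (rule closed_set_has_recurrent[OF that(1,2)])
         (use that(3) in \<open>auto simp: chain_edge_def mu_def split: if_splits\<close>)
    then show ?thesis using tr[OF _ mu] that(1) TC by blast
  qed
  obtain i j where ij: "i < S" "j < S" "\<And>k. k < S \<Longrightarrow> ?f j \<le> ?f k \<and> ?f k \<le> ?f i"
    using span_attained[OF S, of ?f] by auto
  define Mn where "Mn = {s. s < S \<and> ?f s = ?f j}"
  define Mx where "Mx = {s. s < S \<and> ?f s = ?f i}"
  have Mn: "y \<in> Mn" if "x \<in> Mn" "a < A" "y < S" "0 < K x a y" for x y a
  proof -
    have x: "x < S" "?f x = ?f j" using that by (auto simp: Mn_def)
    have "?f y = ?f j"
      by (rule expct_eq_bound_imp[of S "K x a"])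
         (use K x that blackwell_gain_superharmonic[OF K bw x(1) that(2)] ij(3) in \<open>auto simp: stochkernel_def\<close>)
    then show ?thesis using that by (simp add: Mn_def)
  qed
  have Mx: "y \<in> Mx" if "x \<in> Mx" "y < S" "0 < K x (p x) y" for x y
  proof -
    have x: "x < S" "?f x = ?f i" using that by (auto simp: Mx_def)
    have "- ?f y = - ?f i"
    proof (rule expct_eq_bound_imp[of S "K x (p x)" _ "\<lambda>s. - ?f s"])
      show "stoch S (K x (p x))" by (rule pstochD[OF Kp x(1)])
      show "expct S (K x (p x)) (\<lambda>s. - ?f s) \<le> - ?f i"
        using gain_harmonic[OF Kp x(1), of r] x expct_cmult[of S "K x (p x)" "-1" ?f] by simp
    qed (use ij(3) that in auto)
    then show ?thesis using that by (simp add: Mx_def)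
  qed
  have "\<exists>x\<in>Mn. x \<in> Cl"
  proof (rule meets)
    show "Mn \<subseteq> {..<S}" "Mn \<noteq> {}" using ij by (auto simp: Mn_def)
    fix x y assume "x \<in> Mn" "y < S" "0 < K x (p x) y"
    then show "y \<in> Mn" using p by (intro Mn[of x "p x" y]) (auto simp: Mn_def is_policy_def)
  qed
  then obtain x where x: "x \<in> Mn" "x \<in> Cl" by blast
  have "\<exists>x\<in>Mx. x \<in> Cl"
  proof (rule meets)
    show "Mx \<subseteq> {..<S}" "Mx \<noteq> {}" using ij by (auto simp: Mx_def)
  qed (rule Mx)
  then obtain y where y: "y \<in> Mx" "y \<in> Cl" by blast
  have "(mdp_edge S A K)\<^sup>*\<^sup>* x y" by (rule cl[OF x(2) y(2)])
  then have "y \<in> Mn"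
    using x(1) by (induction rule: rtranclp_induct) (auto simp: mdp_edge_def intro: Mn)
  then have "?f i = ?f j" using y by (simp add: Mn_def Mx_def)
  then show ?thesis using ij(3)[OF s(1)] ij(3)[OF s(2)] by linarith
qed

lemma sum_squares_bound_double: "(x + y)\<^sup>2 \<le> 2 * x\<^sup>2 + 2 * (y::real)\<^sup>2"
  using sum_squares_bound[of x y] by (simp add: power2_sum)

subsection \<open>Propagation of local errors to value functions\<close>

definition vari :: "nat \<Rightarrow> (nat \<Rightarrow> real) \<Rightarrow> (nat \<Rightarrow> real) \<Rightarrow> real" where
  "vari S k v = expct S k (\<lambda>s. (v s - expct S k v)\<^sup>2)"

lemma vari_nonneg: "stoch S k \<Longrightarrow> 0 \<le> vari S k v"
  unfolding vari_def by (intro expct_nonneg stoch_imp_substoch) auto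

lemma vari_around:
  assumes k: "stoch S k"
  shows "expct S k (\<lambda>s. (v s - c)\<^sup>2) = vari S k v + (expct S k v - c)\<^sup>2"
proof -
  have *: "expct S k (\<lambda>s. (v s - x)\<^sup>2) = expct S k (\<lambda>s. (v s)\<^sup>2) - 2 * x * expct S k v + x\<^sup>2" for x
  proof -
    have "expct S k (\<lambda>s. (v s - x)\<^sup>2) = expct S k (\<lambda>s. ((v s)\<^sup>2 - (2 * x) * v s) + x\<^sup>2)"
      by (intro expct_cong) (simp add: power2_diff)
    then show ?thesis by (simp only: expct_add expct_diff expct_cmult expct_const[OF k])
  qed
  show ?thesis unfolding vari_def *[of c] *[of "expct S k v"] by (simp add: power2_eq_square algebra_simps)
qed

lemma vari_eq:
  assumes k: "stoch S k"
  shows "vari S k v = expct S k (\<lambda>s. (v s)\<^sup>2) - (expct S k v)\<^sup>2"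
  using vari_around[OF k, of v 0] by simp

lemma vari_shift:
  assumes k: "stoch S k"
  shows "vari S k (\<lambda>s. v s - c) = vari S k v"
  by (simp add: vari_def expct_diff expct_const[OF k])

text \<open>The function \<open>|U - V| + 2 \<beta> W\<^sup>2\<close>, with \<open>W\<close> the value shifted to have minimum 0, is a
  subsolution of a discounted equation with constant right-hand side: the discounted drift of
  \<open>W\<^sup>2\<close> absorbs the variance, and the weight \<open>\<beta>\<close> balances the two terms of AM-GM.\<close>

lemma value_perturbation:
  fixes n :: nat and L :: real
  assumes K: "pstoch S K q" and K': "pstoch S K' q" and n: "4 \<le> n" and L: "1 \<le> L"
    and r: "\<And>s. s < S \<Longrightarrow> 0 \<le> r s (q s) \<and> r s (q s) \<le> 2"
    and gd: "\<gamma> = 1 - 1 / real n" and V: "V = disc_value S K r q \<gamma>" and B: "B = span S V + 1"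
    and e: "\<And>s. s < S \<Longrightarrow> \<bar>expct S (K s (q s)) V - expct S (K' s (q s)) V\<bar>
       \<le> 8 * sqrt (vari S (K' s (q s)) V * (L / real n)) + 8 * B * (L / real n)"
    and s: "s < S"
  shows "\<bar>disc_value S K' r q \<gamma> s - V s\<bar> \<le> 500 * L * sqrt (real n * B)"
proof -
  define N where "N = real n"
  have N: "4 \<le> N" using n by (simp add: N_def)
  have g: "0 \<le> \<gamma>" "\<gamma> < 1" "3/4 \<le> \<gamma>" using N by (auto simp: gd N_def[symmetric] field_simps)
  have S: "0 < S" using s by simp
  let ?U = "disc_value S K' r q \<gamma>"
  obtain i j where ij: "i < S" "j < S" "span S V = V i - V j" "\<And>k. k < S \<Longrightarrow> V j \<le> V k \<and> V k \<le> V i"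
    using span_attained[OF S, of V] by auto
  have Vb: "0 \<le> V k" "V k \<le> 2 * N" if "k < S" for k
    using disc_value_bounds[where r = r and R = 2, OF pstoch_subchain[OF K] g(1,2) _ that] r
    unfolding V by (auto simp: gd N_def)
  have B1: "1 \<le> B" using span_nonneg[OF S] by (simp add: B)
  have B3: "B \<le> 3 * N" using Vb(1)[OF ij(2)] Vb(2)[OF ij(1)] N by (simp add: B ij(3))
  define R where "R = sqrt (N * B)"
  have NB: "0 < N * B" using N B1 by (intro mult_pos_pos) auto
  have R0: "0 < R" using NB by (simp add: R_def)
  have R2: "R * R = N * B" using NB by (simp add: R_def)
  have BR: "B \<le> 7 / 4 * R"
  proof (rule power2_le_imp_le)
    have "B\<^sup>2 \<le> 3 * (N * B)" using B1 B3 by (simp add: power2_eq_square mult_right_mono)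
    also have "\<dots> \<le> 49 / 16 * (R * R)" using NB unfolding R2 by linarith
    also have "\<dots> = (7 / 4 * R)\<^sup>2" by (simp add: power2_eq_square)
    finally show "B\<^sup>2 \<le> (7 / 4 * R)\<^sup>2" .
  qed (use R0 in auto)
  \<comment> \<open>The AM-GM weight is of order 1 / R, so that both resulting terms are of order L
    R after multiplication by the horizon. The factor 56 makes 2 B \<beta> at most 1/2, and \<beta>
    is set so that \<beta> \<gamma>^2 = 4 \<alpha>.\<close>
  define \<alpha> where "\<alpha> = 1 / (56 * R)"
  define \<beta> where "\<beta> = 4 * \<alpha> / \<gamma>\<^sup>2"
  have al: "0 < \<alpha>" using R0 by (simp add: \<alpha>_def)
  have g2: "9/16 \<le> \<gamma>\<^sup>2" using power_mono[OF g(3), of 2] by (simp add: power2_eq_square)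
  have be0: "0 \<le> \<beta>" using al by (simp add: \<beta>_def)
  have be: "\<beta> * R \<le> 64 / 504"
  proof -
    have "\<beta> * R = (4 / 56) / \<gamma>\<^sup>2" using R0 by (simp add: \<beta>_def \<alpha>_def)
    also have "\<dots> \<le> (4 / 56) / (9 / 16)" using g2 by (intro divide_left_mono) auto
    finally show ?thesis by simp
  qed
  have beB: "2 * B * \<beta> \<le> 1 / 2"
  proof -
    have "B * \<beta> \<le> 7 / 4 * R * \<beta>" using BR be0 by (intro mult_right_mono)
    moreover have "7 / 4 * R * \<beta> = 7 / 4 * (\<beta> * R)" by simp
    ultimately show ?thesis using be by linarith
  qed
  define W where "W k = V k - V j" for k
  have W: "0 \<le> W k" "W k \<le> B" if "k < S" for k
    using ij(4)[OF that] ij(3) by (auto simp: W_def B)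
  define E where "E k = expct S (K' k (q k))" for k
  define err where "err k = \<bar>expct S (K k (q k)) V - E k V\<bar>" for k
  \<comment> \<open>The constants left over once half of the error has been moved to the left and
    the inequality doubled.\<close>
  define \<kappa> where "\<kappa> = 8 * B * \<beta> + 8 * L / (N * \<alpha>) + 16 * B * L / N"
  have drift: "err k \<le> 2 * \<beta> * (\<gamma> * E k (\<lambda>x. (W x)\<^sup>2) - (W k)\<^sup>2) + \<kappa>" if k: "k < S" for k
  proof -
    note st = pstochD[OF K' k]
    define v where "v = vari S (K' k (q k)) V"
    define d where "d = expct S (K k (q k)) V - E k V"
    define u where "u = r k (q k) + \<gamma> * d - (1 - \<gamma>) * V j"
    have v0: "0 \<le> v" unfolding v_def by (rule vari_nonneg[OF st])
    have "expct S (K k (q k)) V = d + (E k W + V j)"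
      unfolding d_def E_def W_def by (simp add: expct_diff expct_const[OF st])
    then have Wk: "W k = u + \<gamma> * E k W"
      using disc_value_fixed_point[OF pstoch_subchain[OF K] g(1,2) k, of r]
      unfolding V[symmetric] W_def u_def by (simp add: algebra_simps)
    have "v = E k (\<lambda>x. (W x)\<^sup>2) - (E k W)\<^sup>2"
      unfolding v_def E_def vari_eq[OF st, symmetric] W_def vari_shift[OF st] ..
    \<comment> \<open>Expanding the square of W = u + \<gamma> E W turns the discounted variance
      into a drift of the square of W, at the price of the cross term 2 W u.\<close>
    then have "\<gamma>\<^sup>2 * v = \<gamma>\<^sup>2 * E k (\<lambda>x. (W x)\<^sup>2) - (\<gamma> * E k W)\<^sup>2"
      by (simp add: right_diff_distrib power_mult_distrib)
    also have "(\<gamma> * E k W)\<^sup>2 = (W k)\<^sup>2 - 2 * (W k * u) + u\<^sup>2" using Wk by (simp add: power2_eq_square algebra_simps)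
    also have "\<gamma>\<^sup>2 * E k (\<lambda>x. (W x)\<^sup>2) \<le> \<gamma> * E k (\<lambda>x. (W x)\<^sup>2)"
    proof (intro mult_right_mono)
      show "\<gamma>\<^sup>2 \<le> \<gamma>" using g by (simp add: power2_eq_square mult_left_le)
      show "0 \<le> E k (\<lambda>x. (W x)\<^sup>2)" unfolding E_def by (intro expct_nonneg stoch_imp_substoch st) auto
    qed
    finally have gv: "\<gamma>\<^sup>2 * v \<le> \<gamma> * E k (\<lambda>x. (W x)\<^sup>2) - (W k)\<^sup>2 + 2 * (W k * u)"
      using zero_le_power2[of u] by linarith
    have "\<gamma> * d \<le> \<gamma> * err k" unfolding err_def d_def using g by (intro mult_left_mono) auto
    also have "\<dots> \<le> 1 * err k" using g by (intro mult_right_mono) (auto simp: err_def)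
    finally have "\<gamma> * d \<le> 1 * err k" .
    then have "u \<le> 2 + err k" using r[OF k] Vb(1)[OF ij(2)] g unfolding u_def by (smt (verit) mult_nonneg_nonneg)
    then have "W k * u \<le> W k * (2 + err k)" using W(1)[OF k] by (rule mult_left_mono)
    also have "\<dots> \<le> B * (2 + err k)" using W(2)[OF k] by (intro mult_right_mono) (auto simp: err_def)
    finally have Wu: "W k * u \<le> B * (2 + err k)" .
    have "4 * \<alpha> * v = \<beta> * (\<gamma>\<^sup>2 * v)" using g by (simp add: \<beta>_def)
    also have "\<dots> \<le> \<beta> * (\<gamma> * E k (\<lambda>x. (W x)\<^sup>2) - (W k)\<^sup>2 + 2 * (B * (2 + err k)))"
      using gv Wu be0 by (intro mult_left_mono) auto
    also have "\<dots> = \<beta> * (\<gamma> * E k (\<lambda>x. (W x)\<^sup>2) - (W k)\<^sup>2) + 4 * B * \<beta> + (2 * B * \<beta>) * err k"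
      by (simp add: algebra_simps)
    \<comment> \<open>The error returns here because \<open>W\<close> solves the equation of the
      other kernel, so \<open>u\<close> contains the deviation \<open>d\<close>. The choice of
      \<beta> lets it be absorbed.\<close>
    also have "(2 * B * \<beta>) * err k \<le> 1 / 2 * err k" using beB by (intro mult_right_mono) (auto simp: err_def)
    finally have av: "4 * \<alpha> * v \<le> \<beta> * (\<gamma> * E k (\<lambda>x. (W x)\<^sup>2) - (W k)\<^sup>2) + 4 * B * \<beta> + 1 / 2 * err k" by simp
    have "sqrt (v * (L / N)) = sqrt ((\<alpha> * v) * (L / (N * \<alpha>)))" using al by simp
    also have "\<dots> \<le> (\<alpha> * v + L / (N * \<alpha>)) / 2"
      using al v0 L N by (intro arith_geo_mean_sqrt) auto
    finally have "8 * sqrt (v * (L / N)) \<le> 4 * \<alpha> * v + 4 * (L / (N * \<alpha>))" by simp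
    moreover have "err k \<le> 8 * sqrt (v * (L / N)) + 8 * B * (L / N)"
      using e[OF k] by (simp add: err_def v_def N_def E_def)
    moreover have "\<kappa> = 8 * B * \<beta> + 8 * (L / (N * \<alpha>)) + 16 * (B * (L / N))" by (simp add: \<kappa>_def)
    ultimately show ?thesis using av by (simp add: mult.assoc)
  qed
  have "\<bar>?U s - V s\<bar> + 2 * \<beta> * (W s)\<^sup>2 \<le> \<kappa> / (1 - \<gamma>)"
  proof (rule discounted_max_principle[where M = "\<lambda>s. K' s (q s)" and S = S and s = s
        and w = "\<lambda>s. \<bar>?U s - V s\<bar> + 2 * \<beta> * (W s)\<^sup>2"])
    show "0 \<le> \<kappa>" unfolding \<kappa>_def using be0 B1 L al N by (intro add_nonneg_nonneg) auto
    fix k assume k: "k < S"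
    note st = pstochD[OF K' k]
    have "?U k - V k = \<gamma> * E k (\<lambda>x. ?U x - V x) + \<gamma> * (E k V - expct S (K k (q k)) V)"
      using disc_value_fixed_point[OF pstoch_subchain[OF K] g(1,2) k, of r]
        disc_value_fixed_point[OF pstoch_subchain[OF K'] g(1,2) k, of r]
      unfolding V[symmetric] E_def expct_diff by (simp add: algebra_simps)
    then have "\<bar>?U k - V k\<bar> \<le> \<gamma> * \<bar>E k (\<lambda>x. ?U x - V x)\<bar> + \<gamma> * err k"
      unfolding err_def using g
        abs_triangle_ineq[of "\<gamma> * E k (\<lambda>x. ?U x - V x)" "\<gamma> * (E k V - expct S (K k (q k)) V)"]
      by (simp add: abs_mult abs_minus_commute)
    also have "\<gamma> * \<bar>E k (\<lambda>x. ?U x - V x)\<bar> \<le> \<gamma> * E k (\<lambda>x. \<bar>?U x - V x\<bar>)"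
      unfolding E_def using g by (intro mult_left_mono expct_abs_le stoch_imp_substoch st) auto
    also have "\<gamma> * err k \<le> 1 * err k" using g by (intro mult_right_mono) (auto simp: err_def)
    finally have "\<bar>?U k - V k\<bar> + 2 * \<beta> * (W k)\<^sup>2
        \<le> \<gamma> * E k (\<lambda>x. \<bar>?U x - V x\<bar>) + \<gamma> * (2 * \<beta> * E k (\<lambda>x. (W x)\<^sup>2)) + \<kappa>"
      using drift[OF k] by (simp add: algebra_simps)
    also have "\<dots> = \<gamma> * E k (\<lambda>x. \<bar>?U x - V x\<bar> + 2 * \<beta> * (W x)\<^sup>2) + \<kappa>"
      unfolding E_def expct_add_cmult by (simp add: distrib_left)
    finally show "\<bar>?U k - V k\<bar> + 2 * \<beta> * (W k)\<^sup>2
        \<le> \<gamma> * expct S (K' k (q k)) (\<lambda>k. \<bar>?U k - V k\<bar> + 2 * \<beta> * (W k)\<^sup>2) + \<kappa>" by (simp add: E_def)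
  qed (use g s stoch_imp_substoch[OF pstochD[OF K']] in auto)
  moreover have "0 \<le> 2 * \<beta> * (W s)\<^sup>2" using be0 by simp
  moreover have "\<kappa> / (1 - \<gamma>) = \<kappa> * N" by (simp add: gd N_def)
  ultimately have "\<bar>?U s - V s\<bar> \<le> \<kappa> * N" by linarith
  also have "\<kappa> * N = 8 * (\<beta> * R) * R + 448 * L * R + 16 * B * L"
  proof -
    have "8 * L / (N * \<alpha>) * N = 448 * L * R" using N R0 by (simp add: \<alpha>_def)
    moreover have "16 * B * L / N * N = 16 * B * L" using N by simp
    moreover have "8 * B * \<beta> * N = 8 * (\<beta> * R) * R" using R2 by (simp add: algebra_simps)
    ultimately show ?thesis unfolding \<kappa>_def distrib_right by linarith
  qed
  also have "\<dots> \<le> 2 * (L * R) + 448 * (L * R) + 28 * (L * R)"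
  proof -
    have "(\<beta> * R) * R \<le> 64 / 504 * R" using be R0 by (intro mult_right_mono) auto
    moreover have "R \<le> L * R" using L R0 by simp
    ultimately have "8 * ((\<beta> * R) * R) \<le> 2 * (L * R)" using R0 by linarith
    moreover have "B * L \<le> 7 / 4 * R * L" using BR L by (intro mult_right_mono) auto
    then have "16 * (B * L) \<le> 28 * (L * R)" by (simp add: mult_ac)
    ultimately show ?thesis unfolding mult.assoc by linarith
  qed
  also have "\<dots> \<le> 500 * L * R" using L R0 by simp
  finally show ?thesis by (simp add: R_def N_def)
qed

subsection \<open>Concentration of an empirical row at a fixed vector\<close>

text \<open>The second clause is a one-sided Bernstein bound for the squared deviations from the
  true mean. It bounds the true variance by the empirical one, so the same event serves both
  directions of comparison. The 1 added to the span keeps the range parameter positive for constant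
  vectors.\<close>

definition bern :: "nat \<Rightarrow> nat \<Rightarrow> real \<Rightarrow> (nat \<Rightarrow> real) \<Rightarrow> (nat \<Rightarrow> real) \<Rightarrow> (nat \<Rightarrow> real) \<Rightarrow> bool" where
  "bern S n L p k v \<longleftrightarrow> (let b = span S v + 1; W2 = (\<lambda>s. (v s - expct S p v)\<^sup>2) in
     \<bar>expct S k v - expct S p v\<bar> \<le> 2 * sqrt (vari S p v * (L / real n)) + b * (L / real n) \<and>
     expct S p W2 - expct S k W2 \<le> 2 * sqrt (vari S p W2 * (L / real n)) + b\<^sup>2 * (L / real n))"

lemma centered_le_span:
  assumes p: "stoch S p" and i: "i < S"
  shows "\<bar>v i - expct S p v\<bar> \<le> span S v"
proof -
  have "expct S p v \<le> v i + span S v"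
    by (intro expct_le_const'[OF p]) (use span_bounds[OF _ i, of _ v] in \<open>simp add: algebra_simps\<close>)
  moreover have "v i - span S v \<le> expct S p v"
    by (intro expct_ge_const[OF p]) (use span_bounds[OF i, of _ v] in \<open>simp add: algebra_simps\<close>)
  ultimately show ?thesis by (simp add: abs_le_iff)
qed

lemma bern_true_variance:
  assumes "bern S n L p k v" "stoch S p" "0 \<le> L" "0 < S"
  shows "\<bar>expct S k v - expct S p v\<bar> \<le> 4 * sqrt (vari S p v * (L / real n)) + 7 * (span S v + 1) * (L / real n)"
proof -
  have "0 \<le> sqrt (vari S p v * (L / real n))" "0 \<le> (span S v + 1) * (L / real n)"
    using assms vari_nonneg[OF assms(2), of v] span_nonneg[OF assms(4), of v] by auto
  then show ?thesis using assms(1) unfolding bern_def Let_def by linarith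
qed

text \<open>Self-bounding: squared deviations are at most b^2, so their variance is at most b^2
  times the true variance V, and AM-GM puts V / 4 on the right. The squared error of the mean costs
  V / 8, since L / n \<le> 1/64. Solving for V leaves at most twice the empirical variance plus 9
  b^2 L / n.\<close>

lemma bern_empirical_variance:
  assumes bern: "bern S n L p k v" and p: "stoch S p" and k: "stoch S k" and L: "0 \<le> L"
    and n: "0 < n" and Ln: "64 * L \<le> real n" and S: "0 < S"
  shows "\<bar>expct S k v - expct S p v\<bar> \<le> 4 * sqrt (vari S k v * (L / real n)) + 7 * (span S v + 1) * (L / real n)"
proof -
  define b where "b = span S v + 1"
  define x where "x = L / real n"
  define W2 where "W2 s = (v s - expct S p v)\<^sup>2" for s
  define V where "V = vari S p v"
  define V' where "V' = vari S k v"
  have b: "1 \<le> b" using span_nonneg[OF S] by (simp add: b_def)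
  have x: "0 \<le> x" "x \<le> 1 / 64" using L n Ln by (auto simp: x_def field_simps)
  have V: "0 \<le> V" unfolding V_def by (rule vari_nonneg[OF p])
  have V': "0 \<le> V'" unfolding V'_def by (rule vari_nonneg[OF k])
  define d where "d = \<bar>expct S k v - expct S p v\<bar>"
  have b1: "d \<le> 2 * sqrt (V * x) + b * x"
    using bern by (simp add: bern_def Let_def V_def x_def b_def d_def)
  have b2: "expct S p W2 - expct S k W2 \<le> 2 * sqrt (vari S p W2 * x) + b\<^sup>2 * x"
    using bern by (simp add: bern_def Let_def W2_def[abs_def] x_def b_def)
  have W2b: "0 \<le> W2 i" "W2 i \<le> b\<^sup>2" if "i < S" for i
    using centered_le_span[OF p that, of v] b by (auto simp: W2_def b_def abs_le_square_iff[symmetric])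
  have pW2: "expct S p W2 = V" by (simp add: V_def vari_def W2_def[abs_def])
  have kW2: "expct S k W2 = V' + d\<^sup>2"
    using vari_around[OF k, of v "expct S p v"] by (simp add: V'_def W2_def[abs_def] d_def)
  have "vari S p W2 \<le> expct S p (\<lambda>s. (W2 s)\<^sup>2)" using vari_eq[OF p, of W2] by simp
  also have "\<dots> \<le> expct S p (\<lambda>s. b\<^sup>2 * W2 s)"
    using W2b by (intro expct_mono stoch_imp_substoch p) (auto simp: power2_eq_square[of "W2 _"] intro!: mult_right_mono)
  also have "\<dots> = b\<^sup>2 * V" by (simp add: expct_cmult pW2)
  finally have "vari S p W2 * x \<le> b\<^sup>2 * V * x" using x by (intro mult_right_mono) auto
  then have "sqrt (vari S p W2 * x) \<le> sqrt (V / 4 * (4 * b\<^sup>2 * x))"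
    by (intro real_sqrt_le_mono) (simp add: mult_ac)
  also have "\<dots> \<le> (V / 4 + 4 * b\<^sup>2 * x) / 2" using V x by (intro arith_geo_mean_sqrt) auto
  finally have s2: "2 * sqrt (vari S p W2 * x) \<le> V / 4 + 4 * b\<^sup>2 * x" by simp
  have bx: "b\<^sup>2 * x * x \<le> b\<^sup>2 * x * (1 / 64)" using x by (intro mult_left_mono) auto
  have Vx: "V * x \<le> V * (1 / 64)" using x V by (intro mult_left_mono) auto
  have "d\<^sup>2 \<le> (2 * sqrt (V * x) + b * x)\<^sup>2" using b1 by (intro power_mono) (auto simp: d_def)
  also have "\<dots> \<le> 2 * (2 * sqrt (V * x))\<^sup>2 + 2 * (b * x)\<^sup>2" by (rule sum_squares_bound_double)
  also have "\<dots> = 8 * (V * x) + 2 * (b\<^sup>2 * x * x)" using V x by (simp add: power_mult_distrib power2_eq_square)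
  also have "\<dots> \<le> V / 8 + b\<^sup>2 * x / 32" using Vx bx by simp
  finally have "V \<le> V' + V / 8 + b\<^sup>2 * x / 32 + V / 4 + 4 * b\<^sup>2 * x + b\<^sup>2 * x"
    using b2 s2 pW2 kW2 by linarith
  moreover have "0 \<le> b\<^sup>2 * x" using x by simp
  ultimately have "V \<le> 2 * V' + 9 * (b\<^sup>2 * x)" using V' by linarith
  then have "V * x \<le> (2 * V' + 9 * (b\<^sup>2 * x)) * x" using x by (intro mult_right_mono) auto
  also have "\<dots> \<le> (2 * sqrt (V' * x) + 3 * (b * x))\<^sup>2"
  proof -
    have "(2 * sqrt (V' * x) + 3 * (b * x))\<^sup>2 = 4 * (V' * x) + 12 * sqrt (V' * x) * (b * x) + 9 * (b * x)\<^sup>2"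
      using V' x by (simp add: power2_sum power_mult_distrib)
    moreover have "0 \<le> sqrt (V' * x) * (b * x)" "0 \<le> V' * x" using V' x b by auto
    ultimately show ?thesis by (simp add: power2_eq_square algebra_simps)
  qed
  finally have "sqrt (V * x) \<le> 2 * sqrt (V' * x) + 3 * (b * x)"
    using V' x b by (intro real_le_lsqrt) auto
  then have "d \<le> 4 * sqrt (V' * x) + 7 * (b * x)" using b1 by linarith
  then show ?thesis by (simp only: d_def V'_def x_def b_def mult.assoc)
qed

text \<open>Replacing \<open>w\<close> by a net point costs at most 28 e in total: 2 from the two
  means, 12 from the variance and 14 from the span. Since 40 e \<le> L / n, this fits into one more
  copy of the range term. Splitting the square doubles the coefficient of the root.\<close>

lemma bern_near:
  assumes bern: "bern S n L p k v" and p: "stoch S p" and k: "stoch S k" and L: "1 \<le> L"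
    and n: "0 < n" and Ln: "L \<le> real n" and S: "0 < S"
    and near: "\<And>i. i < S \<Longrightarrow> \<bar>v i - w i\<bar> \<le> e" and e: "40 * e * real n \<le> 1"
  shows "\<bar>expct S k w - expct S p w\<bar> \<le> 8 * sqrt (vari S p w * (L / real n)) + 8 * (span S w + 1) * (L / real n)"
proof -
  define x where "x = L / real n"
  have x: "0 < x" "x \<le> 1" using L n Ln by (auto simp: x_def)
  have e0: "0 \<le> e" using near[OF S] by linarith
  have ex: "40 * e \<le> x"
  proof -
    have "40 * e * real n \<le> L" using e L by linarith
    then show ?thesis using n by (simp add: x_def pos_le_divide_eq)
  qed
  have dk: "\<bar>expct S k v - expct S k w\<bar> \<le> e" if "stoch S k" for k
  proof -
    have "\<bar>expct S k (\<lambda>i. v i - w i)\<bar> \<le> expct S k (\<lambda>_. e)"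
      using near by (intro expct_abs_le stoch_imp_substoch that) auto
    then show ?thesis by (simp add: expct_diff expct_const[OF that])
  qed
  have sp: "span S v \<le> span S w + 2 * e"
  proof (rule span_le[OF S])
    fix i j assume "i < S" "j < S"
    then show "v i - v j \<le> span S w + 2 * e" using near[of i] near[of j] span_bounds[of i S j w] by linarith
  qed
  have "vari S p v \<le> expct S p (\<lambda>s. 2 * (w s - expct S p w)\<^sup>2 + 8 * e\<^sup>2)"
    unfolding vari_def
  proof (rule expct_mono[OF stoch_imp_substoch[OF p]])
    fix i assume i: "i < S"
    define y where "y = (v i - w i) - (expct S p v - expct S p w)"
    have "\<bar>y\<bar> \<le> 2 * e" using near[OF i] dk[OF p] by (simp add: y_def)
    then have "y\<^sup>2 \<le> (2 * e)\<^sup>2" using e0 abs_le_square_iff[of y "2 * e"] by simp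
    moreover have "v i - expct S p v = (w i - expct S p w) + y" by (simp add: y_def)
    ultimately show "(v i - expct S p v)\<^sup>2 \<le> 2 * (w i - expct S p w)\<^sup>2 + 8 * e\<^sup>2"
      using sum_squares_bound_double[of "w i - expct S p w" y] by (simp add: power_mult_distrib)
  qed
  also have "\<dots> = 2 * vari S p w + 8 * e\<^sup>2"
    by (simp add: expct_add expct_cmult expct_const[OF p] vari_def)
  finally have "vari S p v * x \<le> (2 * vari S p w + 8 * e\<^sup>2) * x" using x by (intro mult_right_mono) auto
  also have "\<dots> \<le> 4 * (vari S p w * x) + (3 * e)\<^sup>2"
  proof -
    have "(3 * e)\<^sup>2 = 9 * e\<^sup>2" by (simp add: power_mult_distrib)
    moreover have "e\<^sup>2 * x \<le> e\<^sup>2" "0 \<le> vari S p w * x" "0 \<le> e\<^sup>2"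
      using x vari_nonneg[OF p, of w] by (auto intro: mult_left_le)
    moreover have "(2 * vari S p w + 8 * e\<^sup>2) * x = 2 * (vari S p w * x) + 8 * (e\<^sup>2 * x)"
      by (simp add: distrib_right)
    ultimately show ?thesis by linarith
  qed
  finally have "sqrt (vari S p v * x) \<le> sqrt (4 * (vari S p w * x) + (3 * e)\<^sup>2)" by simp
  also have "\<dots> \<le> sqrt (4 * (vari S p w * x)) + sqrt ((3 * e)\<^sup>2)"
    using vari_nonneg[OF p, of w] x by (intro sqrt_add_le_add_sqrt) auto
  also have "\<dots> = 2 * sqrt (vari S p w * x) + 3 * e" using e0 by (simp add: real_sqrt_mult)
  finally have sv: "sqrt (vari S p v * x) \<le> 2 * sqrt (vari S p w * x) + 3 * e" .
  have sx: "(span S v + 1) * x \<le> (span S w + 1) * x + 2 * e"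
  proof -
    have "(span S v + 1) * x \<le> (span S w + 1 + 2 * e) * x" using sp x by (intro mult_right_mono) auto
    moreover have "2 * e * x \<le> 2 * e * 1" using x e0 by (intro mult_left_mono) auto
    ultimately show ?thesis by (simp add: distrib_right)
  qed
  have "\<bar>expct S k v - expct S p v\<bar> \<le> 4 * sqrt (vari S p v * x) + 7 * ((span S v + 1) * x)"
    using bern_true_variance[OF bern p _ S] L unfolding x_def mult.assoc by linarith
  then have "\<bar>expct S k w - expct S p w\<bar> \<le> 8 * sqrt (vari S p w * x) + 7 * ((span S w + 1) * x) + 28 * e"
    using dk[OF k] dk[OF p] sv sx by linarith
  moreover have "28 * e \<le> (span S w + 1) * x"
    using ex e0 mult_right_mono[of 1 "span S w + 1" x] span_nonneg[OF S, of w] x by linarith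
  ultimately have "\<bar>expct S k w - expct S p w\<bar> \<le> 8 * sqrt (vari S p w * x) + 8 * ((span S w + 1) * x)"
    by linarith
  then show ?thesis by (simp only: x_def mult.assoc)
qed

subsection \<open>Bernstein's inequality\<close>

text \<open>Validity for all negative arguments matters: the Chernoff argument then requires
  boundedness from above only, as is exploited for the squared deviations.\<close>

lemma exp_le_quadratic:
  fixes x :: real
  assumes "x \<le> 1"
  shows "exp x \<le> 1 + x + x\<^sup>2"
proof (cases "0 \<le> x")
  case True
  show ?thesis using exp_bound[OF True assms] .
next
  case False
  define y where "y = - x"
  have y: "0 \<le> y" using False by (simp add: y_def)
  have q: "1 + y + y\<^sup>2 / 2 \<le> exp y" by (rule exp_lower_Taylor_quadratic[OF y])
  have q0: "0 < 1 + y + y\<^sup>2 / 2" using y by (simp add: add_pos_nonneg)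
  have "exp x = 1 / exp y" by (simp add: y_def exp_minus field_simps)
  also have "\<dots> \<le> 1 / (1 + y + y\<^sup>2 / 2)" using q q0 by (intro divide_left_mono) auto
  also have "\<dots> \<le> 1 - y + y\<^sup>2"
  proof -
    have "(1 - y + y\<^sup>2) * (1 + y + y\<^sup>2 / 2) = 1 + y\<^sup>2 / 2 + y ^ 3 / 2 + y ^ 4 / 2"
      by (simp add: power2_eq_square power3_eq_cube power4_eq_xxxx algebra_simps add_divide_distrib diff_divide_distrib)
    then have "1 \<le> (1 - y + y\<^sup>2) * (1 + y + y\<^sup>2 / 2)" using y by simp
    then show ?thesis using q0 by (simp add: divide_le_eq)
  qed
  finally show ?thesis by (simp add: y_def)
qed

text \<open>The product of finitely many discrete spaces is countable with measurable points. Any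
  event in the samples is thus measurable, even one defined through optimal policies or arbitrary
  choices.\<close>

lemma PiM_measure_pmf_discrete:
  fixes p :: "'i \<Rightarrow> nat pmf"
  assumes "finite I" "B \<subseteq> space (PiM I (\<lambda>i. measure_pmf (p i)))"
  shows "B \<in> sets (PiM I (\<lambda>i. measure_pmf (p i)))"
proof (rule sets.countable)
  have sp: "space (PiM I (\<lambda>i. measure_pmf (p i))) = PiE I (\<lambda>_. UNIV)" by (simp add: space_PiM)
  show "countable B"
    using countable_subset[OF assms(2)] countable_PiE[OF assms(1), of "\<lambda>_. UNIV :: nat set"] by (simp add: sp)
  fix x assume "x \<in> B"
  then have x: "x \<in> PiE I (\<lambda>_. UNIV)" using assms(2) sp by blast
  then have "{x} = PiE I (\<lambda>i. {x i})"
    by (intro PiE_singleton[symmetric]) (auto simp: PiE_def)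
  also have "\<dots> \<in> sets (PiM I (\<lambda>i. measure_pmf (p i)))"
    by (intro sets_PiM_I_finite assms) auto
  finally show "{x} \<in> sets (PiM I (\<lambda>i. measure_pmf (p i)))" .
qed

text \<open>Exponential Markov inequality: mean zero removes the linear term of
  \<open>exp_le_quadratic\<close>, so each factor is at most the exponential of l^2 times the second
  moment.\<close>

lemma chernoff_iid:
  fixes p :: "nat pmf" and f :: "nat \<Rightarrow> real" and I :: "'i set"
  assumes I: "finite I" and fs: "finite (set_pmf p)" and lam: "0 \<le> l"
    and m: "measure_pmf.expectation p f = 0" and b: "\<And>x. x \<in> set_pmf p \<Longrightarrow> l * f x \<le> 1"
  shows "emeasure (PiM I (\<lambda>_. measure_pmf p)) {y \<in> space (PiM I (\<lambda>_. measure_pmf p)). t < (\<Sum>i\<in>I. f (y i))}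
     \<le> ennreal (exp (real (card I) * l\<^sup>2 * measure_pmf.expectation p (\<lambda>x. (f x)\<^sup>2) - l * t))"
proof -
  let ?M = "PiM I (\<lambda>_. measure_pmf p)"
  let ?A = "{y \<in> space ?M. t < (\<Sum>i\<in>I. f (y i))}"
  let ?v = "measure_pmf.expectation p (\<lambda>x. (f x)\<^sup>2)"
  interpret product_sigma_finite "\<lambda>_::'i. measure_pmf p"
    by (intro product_sigma_finite.intro prob_space_imp_sigma_finite measure_pmf.prob_space_axioms)
  have int: "integrable (measure_pmf p) g" for g :: "nat \<Rightarrow> real"
    by (rule integrable_measure_pmf_finite[OF fs])
  have mg: "(\<integral>\<^sup>+x. ennreal (exp (l * f x)) \<partial>measure_pmf p) \<le> ennreal (exp (l\<^sup>2 * ?v))"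
  proof -
    have "(\<integral>\<^sup>+x. ennreal (exp (l * f x)) \<partial>measure_pmf p)
        \<le> (\<integral>\<^sup>+x. ennreal (1 + l * f x + l\<^sup>2 * (f x)\<^sup>2) \<partial>measure_pmf p)"
      using exp_le_quadratic[OF b] by (intro nn_integral_mono_AE) (auto simp: AE_measure_pmf_iff power_mult_distrib intro!: ennreal_leI)
    also have "\<dots> = ennreal (measure_pmf.expectation p (\<lambda>x. 1 + l * f x + l\<^sup>2 * (f x)\<^sup>2))"
    proof (rule nn_integral_eq_integral[OF int])
      have "0 \<le> 1 + y + y\<^sup>2" for y :: real
        using zero_le_power2[of "y + 1 / 2"] by (simp add: power2_eq_square algebra_simps)
      from this[of "l * f _"] show "AE x in measure_pmf p. 0 \<le> 1 + l * f x + l\<^sup>2 * (f x)\<^sup>2"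
        by (simp add: power_mult_distrib)
    qed
    also have "measure_pmf.expectation p (\<lambda>x. 1 + l * f x + l\<^sup>2 * (f x)\<^sup>2) = 1 + l\<^sup>2 * ?v"
      by (simp add: int m)
    also have "\<dots> \<le> exp (l\<^sup>2 * ?v)" by (rule exp_ge_add_one_self)
    finally show ?thesis by (simp add: ennreal_leI)
  qed
  have "emeasure ?M ?A = (\<integral>\<^sup>+y. indicator ?A y \<partial>?M)"
    using PiM_measure_pmf_discrete[OF I, of ?A "\<lambda>_. p"] by (subst nn_integral_indicator) auto
  also have "\<dots> \<le> (\<integral>\<^sup>+y. ennreal (exp (- (l * t))) * (\<Prod>i\<in>I. ennreal (exp (l * f (y i)))) \<partial>?M)"
  proof (rule nn_integral_mono)
    fix y
    show "indicator ?A y \<le> ennreal (exp (- (l * t))) * (\<Prod>i\<in>I. ennreal (exp (l * f (y i))))"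
    proof (cases "y \<in> ?A")
      case True
      have "ennreal (exp (- (l * t))) * (\<Prod>i\<in>I. ennreal (exp (l * f (y i))))
          = ennreal (exp (l * (\<Sum>i\<in>I. f (y i)) - l * t))"
        using I by (simp add: prod_ennreal exp_sum[symmetric] sum_distrib_left ennreal_mult'[symmetric] exp_add[symmetric])
      moreover have "l * t \<le> l * (\<Sum>i\<in>I. f (y i))" using True lam by (intro mult_left_mono) auto
      ultimately show ?thesis using True by simp
    qed simp
  qed
  also have "\<dots> = ennreal (exp (- (l * t))) * (\<integral>\<^sup>+y. (\<Prod>i\<in>I. ennreal (exp (l * f (y i)))) \<partial>?M)"
  proof (rule nn_integral_cmult)
    show "(\<lambda>y. \<Prod>i\<in>I. ennreal (exp (l * f (y i)))) \<in> borel_measurable ?M"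
    proof (intro borel_measurable_prod_ennreal)
      fix i assume "i \<in> I"
      then have "(\<lambda>y. y i) \<in> measurable ?M (measure_pmf p)" by (rule measurable_component_singleton)
      then show "(\<lambda>y. ennreal (exp (l * f (y i)))) \<in> borel_measurable ?M"
        by (rule measurable_compose[where g = "\<lambda>x. ennreal (exp (l * f x))"]) simp
    qed
  qed
  also have "(\<integral>\<^sup>+y. (\<Prod>i\<in>I. ennreal (exp (l * f (y i)))) \<partial>?M)
      = (\<integral>\<^sup>+x. ennreal (exp (l * f x)) \<partial>measure_pmf p) ^ card I"
    by (subst product_nn_integral_prod[OF I]) auto
  also have "ennreal (exp (- (l * t))) * \<dots> \<le> ennreal (exp (- (l * t))) * ennreal (exp (l\<^sup>2 * ?v)) ^ card I"
    by (intro mult_left_mono power_mono mg) auto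
  also have "\<dots> = ennreal (exp (real (card I) * l\<^sup>2 * ?v - l * t))"
    by (simp add: ennreal_power exp_of_nat_mult[symmetric] ennreal_mult'[symmetric] exp_add[symmetric] mult_ac)
  finally show ?thesis .
qed

text \<open>With w the total variance, the unconstrained choice l = sqrt (L / w) is used if it
  respects l b \<le> 1; otherwise l = 1 / b, in which case w \<le> b^2 L keeps the quadratic term
  below the root term.\<close>

lemma bernstein_iid:
  fixes p :: "nat pmf" and f :: "nat \<Rightarrow> real" and I :: "'i set"
  assumes I: "finite I" "card I = n" and fs: "finite (set_pmf p)" and b0: "0 < b" and L: "0 \<le> L"
    and m: "measure_pmf.expectation p f = 0" and b: "\<And>x. x \<in> set_pmf p \<Longrightarrow> f x \<le> b"
    and v: "v = measure_pmf.expectation p (\<lambda>x. (f x)\<^sup>2)"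
  shows "emeasure (PiM I (\<lambda>_. measure_pmf p))
      {y \<in> space (PiM I (\<lambda>_. measure_pmf p)). 2 * sqrt (real n * v * L) + b * L < (\<Sum>i\<in>I. f (y i))}
     \<le> ennreal (exp (- L))"
proof -
  let ?t = "2 * sqrt (real n * v * L) + b * L"
  have v0: "0 \<le> v" unfolding v by simp
  define w where "w = real n * v"
  have w0: "0 \<le> w" using v0 by (simp add: w_def)
  have "\<exists>l. 0 \<le> l \<and> l * b \<le> 1 \<and> w * l\<^sup>2 - l * ?t \<le> - L"
  proof (cases "b\<^sup>2 * L \<le> w \<and> 0 < w")
    case True
    define l where "l = sqrt (L / w)"
    have wl: "w * l\<^sup>2 = L" using True L by (simp add: l_def)
    have "l * b = sqrt (b\<^sup>2 * L / w)" using b0 by (simp add: l_def real_sqrt_mult real_sqrt_divide)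
    also have "\<dots> \<le> 1" using True by simp
    finally have lb: "l * b \<le> 1" .
    have "l * sqrt (w * L) = L"
    proof -
      have "l * sqrt (w * L) = sqrt ((L / w) * (w * L))" by (simp only: l_def real_sqrt_mult)
      also have "\<dots> = L" using True L by simp
      finally show ?thesis .
    qed
    moreover have "0 \<le> l * (b * L)" using b0 L True by (auto simp: l_def)
    ultimately have "w * l\<^sup>2 - l * ?t \<le> - L" using wl by (simp add: w_def algebra_simps)
    then show ?thesis using lb True L by (intro exI[of _ l]) (auto simp: l_def)
  next
    case False
    then have wb: "w \<le> b\<^sup>2 * L" using w0 L b0 by (cases "w = 0") auto
    have "w \<le> sqrt (w * L) * b"
    proof -
      have "w = sqrt (w * w)" using w0 by simp
      also have "\<dots> \<le> sqrt (w * (b\<^sup>2 * L))" using wb w0 by (intro real_sqrt_le_mono mult_left_mono)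
      also have "\<dots> = sqrt (w * L) * b" using b0 by (simp add: real_sqrt_mult)
      finally show ?thesis .
    qed
    then have "w * (1 / b)\<^sup>2 \<le> sqrt (w * L) * b * (1 / b)\<^sup>2" by (intro mult_right_mono) auto
    also have "\<dots> = (1 / b) * sqrt (w * L)" using b0 by (simp add: power2_eq_square)
    moreover have "(1 / b) * (b * L) = L" using b0 by simp
    moreover have "0 \<le> (1 / b) * sqrt (w * L)" using b0 w0 L by simp
    ultimately have "w * (1 / b)\<^sup>2 - (1 / b) * ?t \<le> - L" unfolding w_def distrib_left by linarith
    then show ?thesis using b0 by (intro exI[of _ "1 / b"]) auto
  qed
  then obtain l where l: "0 \<le> l" "l * b \<le> 1" "w * l\<^sup>2 - l * ?t \<le> - L" by blast
  have "emeasure (PiM I (\<lambda>_. measure_pmf p)) {y \<in> space (PiM I (\<lambda>_. measure_pmf p)). ?t < (\<Sum>i\<in>I. f (y i))}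
     \<le> ennreal (exp (real (card I) * l\<^sup>2 * measure_pmf.expectation p (\<lambda>x. (f x)\<^sup>2) - l * ?t))"
    by (rule chernoff_iid[OF I(1) fs l(1) m]) (use l b mult_left_mono[OF b l(1)] in force)
  also have "\<dots> \<le> ennreal (exp (- L))"
    using l(3) unfolding w_def I(2) v[symmetric] by (intro ennreal_leI) (simp add: mult_ac)
  finally show ?thesis .
qed

subsection \<open>Concentration of an empirical row at an independent vector\<close>

definition sample_measure :: "nat \<Rightarrow> nat \<Rightarrow> nat \<Rightarrow> (nat \<Rightarrow> nat \<Rightarrow> nat pmf)
    \<Rightarrow> (nat \<times> nat \<times> nat \<Rightarrow> nat) measure" where
  "sample_measure S A n P = PiM ({..<S} \<times> {..<A} \<times> {..<n}) (\<lambda>(s, a, i). measure_pmf (P s a))"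

lemma sample_measure_eq: "sample_measure S A n P
    = PiM ({..<S} \<times> {..<A} \<times> {..<n}) (\<lambda>j. measure_pmf (case j of (s, a, i) \<Rightarrow> P s a))"
  unfolding sample_measure_def by (intro arg_cong[where f = "PiM _"] ext) (auto split: prod.split)

lemma sample_measure_discrete: "B \<subseteq> space (sample_measure S A n P) \<Longrightarrow> B \<in> sets (sample_measure S A n P)"
  unfolding sample_measure_eq by (rule PiM_measure_pmf_discrete) auto

lemma countable_space_sample_measure: "countable (space (sample_measure S A n P))"
  unfolding sample_measure_eq space_PiM by (intro countable_PiE) auto

lemma prob_space_sample_measure: "prob_space (sample_measure S A n P)"
  unfolding sample_measure_eq by (intro prob_space_PiM measure_pmf.prob_space_axioms)

text \<open>Samples outside the state set are null but still points of the space;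
  \<open>expct\<close> ignores them, hence the conditional on the right.\<close>

lemma expct_emp:
  "real n * expct S (emp_kernel n X s a) v = (\<Sum>i<n. if X (s, a, i) < S then v (X (s, a, i)) else 0)"
proof (cases "n = 0")
  case False
  have "real n * expct S (emp_kernel n X s a) v = (\<Sum>s'<S. real (card {i. i < n \<and> X (s, a, i) = s'}) * v s')"
    using False by (simp add: expct_def emp_kernel_def sum_distrib_left)
  also have "\<dots> = (\<Sum>s'<S. \<Sum>i<n. if X (s, a, i) = s' then v s' else 0)"
  proof (intro sum.cong refl)
    fix s'
    have "{i. i < n \<and> X (s, a, i) = s'} = {i\<in>{..<n}. X (s, a, i) = s'}" by auto
    then show "real (card {i. i < n \<and> X (s, a, i) = s'}) * v s' = (\<Sum>i<n. if X (s, a, i) = s' then v s' else 0)"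
      by (simp add: sum.inter_filter[symmetric])
  qed
  also have "\<dots> = (\<Sum>i<n. \<Sum>s'<S. if X (s, a, i) = s' then v s' else 0)" by (rule sum.swap)
  also have "\<dots> = (\<Sum>i<n. if X (s, a, i) < S then v (X (s, a, i)) else 0)"
    by (intro sum.cong refl) simp
  finally show ?thesis .
qed simp

lemma emp_stoch:
  assumes "0 < n" "\<And>i. i < n \<Longrightarrow> X (s, a, i) < S"
  shows "stoch S (emp_kernel n X s a)"
proof -
  have "real n * sum (emp_kernel n X s a) {..<S} = real n"
    using expct_emp[of n S X s a "\<lambda>_. 1"] assms(2) by (simp add: expct_def)
  then show ?thesis using assms(1) by (auto simp: stoch_def emp_kernel_def)
qed

lemma expectation_pmf_expct:
  assumes "set_pmf p \<subseteq> {..<S}"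
  shows "measure_pmf.expectation p f = expct S (pmf p) f"
  unfolding expct_def using assms by (subst integral_measure_pmf_real[of "{..<S}"]) (auto simp: mult.commute)

lemma stoch_pmf:
  assumes "set_pmf p \<subseteq> {..<S}"
  shows "stoch S (pmf p)"
  unfolding stoch_def using assms by (simp add: sum_pmf_eq_1)

text \<open>Subtracting the true mean times the empirical mass inside the state set makes the
  deviation an exact i.i.d. sum at every sample point. The mass is 1 once the row is in
  range.\<close>

lemma emp_deviation:
  fixes p :: "nat pmf"
  assumes sup: "set_pmf p \<subseteq> {..<S}" and n: "0 < n" and L: "0 \<le> L" and b0: "0 < b"
    and b: "\<And>x. x < S \<Longrightarrow> w x - expct S (pmf p) w \<le> b"
  shows "emeasure (PiM ({s} \<times> {a} \<times> {..<n}) (\<lambda>_. measure_pmf p))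
     {X \<in> space (PiM ({s} \<times> {a} \<times> {..<n}) (\<lambda>_. measure_pmf p)).
        2 * sqrt (vari S (pmf p) w * (L / real n)) + b * (L / real n)
          < expct S (emp_kernel n X s a) w - expct S (emp_kernel n X s a) (\<lambda>_. 1) * expct S (pmf p) w}
     \<le> ennreal (exp (- L))" (is "emeasure ?M ?A \<le> _")
proof -
  define f where "f x = (if x < S then w x - expct S (pmf p) w else 0)" for x
  have fs: "finite (set_pmf p)" using sup finite_subset by blast
  note st = stoch_pmf[OF sup]
  have m: "measure_pmf.expectation p f = 0"
  proof -
    have "measure_pmf.expectation p f = expct S (pmf p) (\<lambda>x. w x - expct S (pmf p) w)"
      unfolding expectation_pmf_expct[OF sup] by (intro expct_cong) (simp add: f_def)
    then show ?thesis by (simp add: expct_diff expct_const[OF st])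
  qed
  have v: "vari S (pmf p) w = measure_pmf.expectation p (\<lambda>x. (f x)\<^sup>2)"
    unfolding expectation_pmf_expct[OF sup] vari_def by (intro expct_cong) (simp add: f_def)
  let ?I = "{s} \<times> {a} \<times> {..<n}"
  have "?A \<subseteq> {y \<in> space ?M. 2 * sqrt (real n * vari S (pmf p) w * L) + b * L < (\<Sum>i\<in>?I. f (y i))}"
  proof clarify
    fix X assume dev: "2 * sqrt (vari S (pmf p) w * (L / real n)) + b * (L / real n)
          < expct S (emp_kernel n X s a) w - expct S (emp_kernel n X s a) (\<lambda>_. 1) * expct S (pmf p) w"
    have "real n * sqrt (vari S (pmf p) w * (L / real n)) = sqrt ((real n)\<^sup>2 * (vari S (pmf p) w * (L / real n)))"
      by (simp only: real_sqrt_mult real_sqrt_abs abs_of_nat)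
    also have "(real n)\<^sup>2 * (vari S (pmf p) w * (L / real n)) = real n * vari S (pmf p) w * L"
      using n by (simp add: power2_eq_square)
    finally have sq: "real n * sqrt (vari S (pmf p) w * (L / real n)) = sqrt (real n * vari S (pmf p) w * L)" .
    have "(\<Sum>i\<in>?I. f (X i)) = (\<Sum>i<n. f (X (s, a, i)))"
      by (rule sum.reindex_bij_witness[of _ "\<lambda>i. (s, a, i)" "\<lambda>(s, a, i). i"]) auto
    also have "\<dots> = (\<Sum>i<n. (if X (s, a, i) < S then w (X (s, a, i)) else 0)
        - (if X (s, a, i) < S then 1 else 0) * expct S (pmf p) w)"
      by (intro sum.cong) (auto simp: f_def)
    also have "\<dots> = real n * (expct S (emp_kernel n X s a) w - expct S (emp_kernel n X s a) (\<lambda>_. 1) * expct S (pmf p) w)"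
      unfolding sum_subtractf sum_distrib_right[symmetric] right_diff_distrib mult.assoc[symmetric] expct_emp ..
    finally have "(\<Sum>i\<in>?I. f (X i)) = real n * (expct S (emp_kernel n X s a) w
      - expct S (emp_kernel n X s a) (\<lambda>_. 1) * expct S (pmf p) w)" .
    moreover have "real n * (2 * sqrt (vari S (pmf p) w * (L / real n)) + b * (L / real n))
        < real n * (expct S (emp_kernel n X s a) w - expct S (emp_kernel n X s a) (\<lambda>_. 1) * expct S (pmf p) w)"
      using dev n by (intro mult_strict_left_mono) auto
    moreover have "real n * (2 * sqrt (vari S (pmf p) w * (L / real n)) + b * (L / real n))
        = 2 * sqrt (real n * vari S (pmf p) w * L) + b * L"
      using n sq by (simp add: distrib_left)
    ultimately show "2 * sqrt (real n * vari S (pmf p) w * L) + b * L < (\<Sum>i\<in>?I. f (X i))" by linarith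
  qed
  then have "emeasure ?M ?A \<le> emeasure ?M {y \<in> space ?M. 2 * sqrt (real n * vari S (pmf p) w * L) + b * L < (\<Sum>i\<in>?I. f (y i))}"
    by (intro emeasure_mono PiM_measure_pmf_discrete) auto
  also have "\<dots> \<le> ennreal (exp (- L))"
    by (rule bernstein_iid[OF _ _ fs b0 L m _ v]) (use b b0 sup in \<open>auto simp: f_def card_cartesian_product\<close>)
  finally show ?thesis .
qed

text \<open>Three one-sided deviations, each of probability at most exp (-L): of \<open>v\<close>,
  of its negative, and of the negated squared deviations.\<close>

lemma bern_failure_row:
  fixes p :: "nat pmf"
  assumes sup: "set_pmf p \<subseteq> {..<S}" and n: "0 < n" and L: "0 \<le> L" and S: "0 < S"
  shows "emeasure (PiM ({s} \<times> {a} \<times> {..<n}) (\<lambda>_. measure_pmf p))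
     {X \<in> space (PiM ({s} \<times> {a} \<times> {..<n}) (\<lambda>_. measure_pmf p)). (\<forall>i<n. X (s, a, i) < S) \<and>
        \<not> bern S n L (pmf p) (emp_kernel n X s a) v} \<le> ennreal (3 * exp (- L))" (is "emeasure ?M ?A \<le> _")
proof -
  define b where "b = span S v + 1"
  define W2 where "W2 = (\<lambda>s. (v s - expct S (pmf p) v)\<^sup>2)"
  note st = stoch_pmf[OF sup]
  define B where "B c w = {X \<in> space ?M. 2 * sqrt (vari S (pmf p) w * (L / real n)) + c * (L / real n)
          < expct S (emp_kernel n X s a) w - expct S (emp_kernel n X s a) (\<lambda>_. 1) * expct S (pmf p) w}" for c w
  have b1: "1 \<le> b" using span_nonneg[OF S] by (simp add: b_def)
  have cs: "\<bar>v x - expct S (pmf p) v\<bar> \<le> b" if "x < S" for x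
    using centered_le_span[OF st that, of v] by (simp add: b_def)
  have neg: "expct S k (\<lambda>s. - w s) = - expct S k w" for k w using expct_cmult[of S k "-1" w] by simp
  have vneg: "vari S (pmf p) (\<lambda>s. - w s) = vari S (pmf p) w" for w
    unfolding vari_def neg by (intro expct_cong) (simp add: power2_commute)
  have B1: "emeasure ?M (B b v) \<le> ennreal (exp (- L))"
    unfolding B_def by (rule emp_deviation[OF sup n L]) (use b1 cs in \<open>auto simp: abs_le_iff\<close>)
  have B2: "emeasure ?M (B b (\<lambda>s. - v s)) \<le> ennreal (exp (- L))"
    unfolding B_def by (rule emp_deviation[OF sup n L]) (use b1 cs in \<open>auto simp: abs_le_iff neg\<close>)
  have W2: "0 \<le> W2 x" "W2 x \<le> b\<^sup>2" if "x < S" for x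
    using cs[OF that] b1 abs_le_square_iff[of "v x - expct S (pmf p) v" b] by (auto simp: W2_def)
  have EW2: "expct S (pmf p) W2 \<le> b\<^sup>2" by (rule expct_le_const'[OF st W2(2)])
  have B3: "emeasure ?M (B (b\<^sup>2) (\<lambda>s. - W2 s)) \<le> ennreal (exp (- L))"
    unfolding B_def
  proof (rule emp_deviation[OF sup n L])
    show "0 < b\<^sup>2" using b1 by simp
    show "- W2 x - expct S (pmf p) (\<lambda>s. - W2 s) \<le> b\<^sup>2" if "x < S" for x
      using W2(1)[OF that] EW2 unfolding neg by linarith
  qed
  have sets: "B c w \<in> sets ?M" for c w unfolding B_def by (intro PiM_measure_pmf_discrete) auto
  have "?A \<subseteq> B b v \<union> B b (\<lambda>s. - v s) \<union> B (b\<^sup>2) (\<lambda>s. - W2 s)"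
  proof clarify
    fix X assume X: "X \<in> space ?M" "\<forall>i<n. X (s, a, i) < S" and nb: "\<not> bern S n L (pmf p) (emp_kernel n X s a) v"
      and n2: "X \<notin> B (b\<^sup>2) (\<lambda>s. - W2 s)" and n1: "X \<notin> B b (\<lambda>s. - v s)"
    have one: "expct S (emp_kernel n X s a) (\<lambda>_. 1) = 1"
      using X(2) by (intro expct_const emp_stoch n) auto
    show "X \<in> B b v"
      using nb n1 n2 X(1) unfolding bern_def B_def Let_def b_def[symmetric] W2_def[symmetric]
      by (auto simp: one neg vneg abs_le_iff)
  qed
  then have "emeasure ?M ?A \<le> emeasure ?M (B b v \<union> B b (\<lambda>s. - v s) \<union> B (b\<^sup>2) (\<lambda>s. - W2 s))"
    by (intro emeasure_mono) (auto intro: sets)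
  also have "\<dots> \<le> emeasure ?M (B b v) + emeasure ?M (B b (\<lambda>s. - v s)) + emeasure ?M (B (b\<^sup>2) (\<lambda>s. - W2 s))"
    using emeasure_subadditive[OF sets.Un[OF sets sets] sets, of b v b "\<lambda>s. - v s" "b\<^sup>2" "\<lambda>s. - W2 s"]
      emeasure_subadditive[OF sets sets, of b v b "\<lambda>s. - v s"] by (meson add_right_mono order_trans)
  also have "\<dots> \<le> ennreal (exp (- L)) + ennreal (exp (- L)) + ennreal (exp (- L))"
    by (intro add_mono B1 B2 B3)
  also have "\<dots> = ennreal (3 * exp (- L))" by (simp add: ennreal_plus[symmetric] del: ennreal_plus)
  finally show ?thesis .
qed

text \<open>Fubini: conditionally on all other samples, the vector is deterministic.\<close>

lemma bern_failure_sample: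
  assumes sup: "\<And>s a. s < S \<Longrightarrow> a < A \<Longrightarrow> set_pmf (P s a) \<subseteq> {..<S}" and n: "0 < n" and L: "0 \<le> L"
    and s: "s < S" and a: "a < A"
    and indep: "\<And>X Y. (\<And>s' a' i. (s', a') \<noteq> (s, a) \<Longrightarrow> X (s', a', i) = Y (s', a', i)) \<Longrightarrow> v X = v Y"
  shows "emeasure (sample_measure S A n P) {X \<in> space (sample_measure S A n P). (\<forall>i<n. X (s, a, i) < S) \<and>
     \<not> bern S n L (pmf (P s a)) (emp_kernel n X s a) (v X)} \<le> ennreal (3 * exp (- L))"
    (is "emeasure ?M ?A \<le> _")
proof -
  define M where "M = (\<lambda>j. measure_pmf (case j of (s, a, i :: nat) \<Rightarrow> P s a))"
  define J where "J = {s} \<times> {a} \<times> {..<n}"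
  define I where "I = {..<S} \<times> {..<A} \<times> {..<n} - J"
  have IJ: "I \<inter> J = {}" "finite I" "finite J" "I \<union> J = {..<S} \<times> {..<A} \<times> {..<n}"
    using s a by (auto simp: I_def J_def)
  have MM: "?M = PiM (I \<union> J) M" unfolding sample_measure_eq M_def IJ(4) ..
  interpret product_sigma_finite M
    unfolding M_def by (intro product_sigma_finite.intro prob_space_imp_sigma_finite measure_pmf.prob_space_axioms)
  have A: "?A \<in> sets (PiM (I \<union> J) M)"
    unfolding MM[symmetric] by (rule sample_measure_discrete) auto
  have MJ: "PiM J M = PiM J (\<lambda>_. measure_pmf (P s a))"
    by (intro PiM_cong) (auto simp: J_def M_def)
  have "emeasure (PiM (I \<union> J) M) ?A = (\<integral>\<^sup>+X. indicator ?A X \<partial>PiM (I \<union> J) M)"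
    by (rule nn_integral_indicator[OF A, symmetric])
  also have "\<dots> = (\<integral>\<^sup>+x. (\<integral>\<^sup>+y. indicator ?A (merge I J (x, y)) \<partial>PiM J M) \<partial>PiM I M)"
    by (rule product_nn_integral_fold[OF IJ(1-3) borel_measurable_indicator[OF A]])
  also have "\<dots> \<le> (\<integral>\<^sup>+x. ennreal (3 * exp (- L)) \<partial>PiM I M)"
  proof (rule nn_integral_mono)
    fix x :: "nat \<times> nat \<times> nat \<Rightarrow> nat"
    let ?D = "\<lambda>v. {X \<in> space (PiM J M). (\<forall>i<n. X (s, a, i) < S) \<and>
        \<not> bern S n L (pmf (P s a)) (emp_kernel n X s a) v}"
    \<comment> \<open>The row at (s, a) is filled with an arbitrary value: \<open>v\<close> does not
      look at it, so its value here is the one for every completion \<open>y\<close>.\<close>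
    let ?z = "merge I J (x, undefined)"
    have on: "merge I J (x, y) (s, a, i) = y (s, a, i)" if "i < n" for y i
      using that by (auto simp: merge_def I_def J_def)
    have off: "merge I J (x, y) (s', a', i) = ?z (s', a', i)" if "(s', a') \<noteq> (s, a)" for y s' a' i
      using that by (auto simp: merge_def J_def)
    have emp: "emp_kernel n (merge I J (x, y)) s a = emp_kernel n y s a" for y
    proof -
      have "{i. i < n \<and> merge I J (x, y) (s, a, i) = s'} = {i. i < n \<and> y (s, a, i) = s'}" for s'
        using on by auto
      then show ?thesis by (simp add: emp_kernel_def fun_eq_iff)
    qed
    have "(\<integral>\<^sup>+y. indicator ?A (merge I J (x, y)) \<partial>PiM J M) \<le> (\<integral>\<^sup>+y. indicator (?D (v ?z)) y \<partial>PiM J M)"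
    proof (rule nn_integral_mono)
      fix y assume y: "y \<in> space (PiM J M)"
      have "v (merge I J (x, y)) = v ?z" by (intro indep off)
      then show "indicator ?A (merge I J (x, y)) \<le> (indicator (?D (v ?z)) y :: ennreal)"
        using y on by (auto simp: emp split: split_indicator)
    qed
    also have "\<dots> = emeasure (PiM J M) (?D (v ?z))"
      unfolding MJ by (intro nn_integral_indicator PiM_measure_pmf_discrete) (auto simp: J_def)
    also have "\<dots> \<le> ennreal (3 * exp (- L))"
      unfolding MJ unfolding J_def using s by (intro bern_failure_row sup s a n L) auto
    finally show "(\<integral>\<^sup>+y. indicator ?A (merge I J (x, y)) \<partial>PiM J M) \<le> ennreal (3 * exp (- L))" .
  qed
  also have "\<dots> = ennreal (3 * exp (- L))"
  proof -
    have "prob_space (PiM I M)" unfolding M_def by (intro prob_space_PiM measure_pmf.prob_space_axioms)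
    then show ?thesis by (simp add: prob_space.emeasure_space_1)
  qed
  finally show ?thesis unfolding MM .
qed

lemma sample_range_null:
  assumes sup: "\<And>s a. s < S \<Longrightarrow> a < A \<Longrightarrow> set_pmf (P s a) \<subseteq> {..<S}"
  shows "AE X in sample_measure S A n P. \<forall>s<S. \<forall>a<A. \<forall>i<n. X (s, a, i) < S"
proof -
  let ?I = "{..<S} \<times> {..<A} \<times> {..<n}"
  have "AE X in sample_measure S A n P. \<forall>j\<in>?I. X j < S"
  proof (intro AE_finite_allI)
    fix j assume j: "j \<in> ?I"
    show "AE X in sample_measure S A n P. X j < S"
      unfolding sample_measure_eq
    proof (rule AE_PiM_component[OF _ j])
      show "AE x in measure_pmf (case j of (s, a, i) \<Rightarrow> P s a). x < S"
        using j sup by (auto simp: AE_measure_pmf_iff)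
    qed (rule measure_pmf.prob_space_axioms)
  qed auto
  then show ?thesis by eventually_elim auto
qed

subsection \<open>Value gap on a good sample\<close>

text \<open>Optimality of \<open>ph\<close> in the empirical model links two evaluation errors. The
  reference policy is compared at its true value. For \<open>ph\<close> the comparison is made
  twice: at its true value (\<open>B2\<close>, via empirical variances) and at its empirical value
  (\<open>B1\<close>, via true variances); the better one gives the minimum. The reward noise shifts
  any value by at most 1 / (2 n).\<close>

lemma good_sample_value_gap:
  fixes n :: nat and L :: real
  assumes K: "stochkernel S A K" and Kh: "stochkernel S A Kh" and n: "4 \<le> n" and gd: "\<gamma> = 1 - 1 / real n"
    and L: "1 \<le> L" "64 * L \<le> real n"
    and r: "\<And>s a. s < S \<Longrightarrow> a < A \<Longrightarrow> 0 \<le> r s a \<and> r s a \<le> 1"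
    and rt: "\<And>s a. s < S \<Longrightarrow> a < A \<Longrightarrow> r s a \<le> rt s a \<and> rt s a \<le> r s a + 1 / (2 * real n ^ 2)"
    and p: "is_policy S A p" and opt: "disc_optimal S A Kh rt \<gamma> ph"
    and A: "\<And>s. s < S \<Longrightarrow> bern S n L (K s (p s)) (Kh s (p s)) (disc_value S K r p \<gamma>)"
    and B1: "\<And>s. s < S \<Longrightarrow> \<exists>v. bern S n L (K s (ph s)) (Kh s (ph s)) v \<and>
       (\<forall>i<S. \<bar>v i - disc_value S Kh rt ph \<gamma> i\<bar> \<le> e)"
    and e: "40 * e * real n \<le> 1"
    and B2: "\<And>s. s < S \<Longrightarrow> bern S n L (K s (ph s)) (Kh s (ph s)) (disc_value S K r ph \<gamma>)"
    and s: "s < S"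
  shows "disc_value S K r p \<gamma> s - disc_value S K r ph \<gamma> s
     \<le> 1 + 500 * L * sqrt (real n * (span S (disc_value S K r p \<gamma>) + 1))
       + 500 * L * sqrt (real n * (min (span S (disc_value S Kh r ph \<gamma>)) (span S (disc_value S K r ph \<gamma>)) + 2))"
proof -
  have S: "0 < S" using s by simp
  have n0: "0 < n" using n by simp
  have g: "0 \<le> \<gamma>" "\<gamma> < 1" using n by (auto simp: gd)
  have ph: "is_policy S A ph" using opt by (simp add: disc_optimal_def)
  note Kp = stochkernel_pstoch[OF K] and Khp = stochkernel_pstoch[OF Kh]
  have L0: "0 \<le> L" using L by simp
  have fixed: "\<bar>disc_value S Kh r q \<gamma> i - disc_value S K r q \<gamma> i\<bar>
      \<le> 500 * L * sqrt (real n * (span S (disc_value S K r q \<gamma>) + 1))"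
    if q: "is_policy S A q" and i: "i < S"
      and bq: "\<And>s. s < S \<Longrightarrow> bern S n L (K s (q s)) (Kh s (q s)) (disc_value S K r q \<gamma>)" for q i
  proof (rule value_perturbation[OF Kp[OF q] Khp[OF q] n L(1) _ gd refl refl _ i])
    fix k assume k: "k < S"
    have qk: "q k < A" using q k by (simp add: is_policy_def)
    show "0 \<le> r k (q k) \<and> r k (q k) \<le> 2" using r[OF k qk] by auto
    let ?V = "disc_value S K r q \<gamma>"
    have 1: "\<bar>expct S (Kh k (q k)) ?V - expct S (K k (q k)) ?V\<bar>
        \<le> 4 * sqrt (vari S (Kh k (q k)) ?V * (L / real n)) + 7 * (span S ?V + 1) * (L / real n)"
      by (rule bern_empirical_variance[OF bq[OF k] pstochD[OF Kp[OF q] k] pstochD[OF Khp[OF q] k] L0 n0 L(2) S])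
    have 2: "0 \<le> sqrt (vari S (Kh k (q k)) ?V * (L / real n))"
      using vari_nonneg[OF pstochD[OF Khp[OF q] k]] L0 by simp
    have 3: "0 \<le> (span S ?V + 1) * (L / real n)" using span_nonneg[OF S, of ?V] L0 by simp
    show "\<bar>expct S (K k (q k)) ?V - expct S (Kh k (q k)) ?V\<bar>
        \<le> 8 * sqrt (vari S (Kh k (q k)) ?V * (L / real n)) + 8 * (span S ?V + 1) * (L / real n)"
      using 1 2 3 unfolding mult.assoc by linarith
  qed
  have shift: "\<bar>disc_value S M rt q \<gamma> i - disc_value S M r q \<gamma> i\<bar> \<le> 1 / 8"
    if M: "stochkernel S A M" and q: "is_policy S A q" and i: "i < S" for M q i
  proof -
    have "\<bar>disc_value S M rt q \<gamma> i - disc_value S M r q \<gamma> i\<bar> \<le> (1 / (2 * real n ^ 2)) / (1 - \<gamma>)"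
    proof (rule disc_value_reward_shift[OF pstoch_subchain[OF stochkernel_pstoch[OF M q]] g _ i])
      fix k assume k: "k < S"
      then have "q k < A" using q by (simp add: is_policy_def)
      then show "\<bar>rt k (q k) - r k (q k)\<bar> \<le> 1 / (2 * real n ^ 2)" using rt[OF k] by fastforce
    qed
    also have "\<dots> = 1 / (2 * real n)" using n0 by (simp add: gd power2_eq_square)
    also have "\<dots> \<le> 1 / 8" using n by (simp add: field_simps)
    finally show ?thesis .
  qed
  have dA: "disc_value S K r p \<gamma> s - 500 * L * sqrt (real n * (span S (disc_value S K r p \<gamma>) + 1)) - 1 / 8
      \<le> disc_value S Kh rt ph \<gamma> s"
    using fixed[OF p s A] shift[OF Kh p s] disc_optimal_ge[OF opt p s] by linarith
  have dB2: "disc_value S Kh rt ph \<gamma> s - 500 * L * sqrt (real n * (span S (disc_value S K r ph \<gamma>) + 1)) - 1 / 8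
      \<le> disc_value S K r ph \<gamma> s"
    using fixed[OF ph s B2] shift[OF Kh ph s] by linarith
  have "\<bar>disc_value S K rt ph \<gamma> s - disc_value S Kh rt ph \<gamma> s\<bar>
      \<le> 500 * L * sqrt (real n * (span S (disc_value S Kh rt ph \<gamma>) + 1))"
  proof (rule value_perturbation[OF Khp[OF ph] Kp[OF ph] n L(1) _ gd refl refl _ s])
    fix k assume k: "k < S"
    have qk: "ph k < A" using ph k by (simp add: is_policy_def)
    have "1 \<le> real n ^ 2" using n by (intro one_le_power) auto
    then have "1 / (2 * real n ^ 2) \<le> 1" by (simp add: divide_le_eq)
    then show "0 \<le> rt k (ph k) \<and> rt k (ph k) \<le> 2" using r[OF k qk] rt[OF k qk] by linarith
    obtain v where v: "bern S n L (K k (ph k)) (Kh k (ph k)) v" "\<And>i. i < S \<Longrightarrow> \<bar>v i - disc_value S Kh rt ph \<gamma> i\<bar> \<le> e"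
      using B1[OF k] by blast
    show "\<bar>expct S (Kh k (ph k)) (disc_value S Kh rt ph \<gamma>) - expct S (K k (ph k)) (disc_value S Kh rt ph \<gamma>)\<bar>
      \<le> 8 * sqrt (vari S (K k (ph k)) (disc_value S Kh rt ph \<gamma>) * (L / real n))
        + 8 * (span S (disc_value S Kh rt ph \<gamma>) + 1) * (L / real n)"
      by (rule bern_near[OF v(1) pstochD[OF Kp[OF ph] k] pstochD[OF Khp[OF ph] k] L(1) n0 _ S v(2) e]) (use L in auto)
  qed
  moreover have "span S (disc_value S Kh rt ph \<gamma>) \<le> span S (disc_value S Kh r ph \<gamma>) + 1"
  proof (rule span_le[OF S])
    fix i j assume ij: "i < S" "j < S"
    show "disc_value S Kh rt ph \<gamma> i - disc_value S Kh rt ph \<gamma> j \<le> span S (disc_value S Kh r ph \<gamma>) + 1"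
      using shift[OF Kh ph ij(1)] shift[OF Kh ph ij(2)] span_bounds[OF ij, of "disc_value S Kh r ph \<gamma>"] by linarith
  qed
  then have "500 * L * sqrt (real n * (span S (disc_value S Kh rt ph \<gamma>) + 1))
      \<le> 500 * L * sqrt (real n * (span S (disc_value S Kh r ph \<gamma>) + 2))"
    using L0 by (intro mult_left_mono real_sqrt_le_mono) auto
  ultimately have dB1: "disc_value S Kh rt ph \<gamma> s - 500 * L * sqrt (real n * (span S (disc_value S Kh r ph \<gamma>) + 2)) - 1 / 8
      \<le> disc_value S K r ph \<gamma> s"
    using shift[OF K ph s] by linarith
  have dB2': "500 * L * sqrt (real n * (span S (disc_value S K r ph \<gamma>) + 1))
      \<le> 500 * L * sqrt (real n * (span S (disc_value S K r ph \<gamma>) + 2))"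
    using L0 by (intro mult_left_mono real_sqrt_le_mono) auto
  show ?thesis
  proof (cases "span S (disc_value S Kh r ph \<gamma>) \<le> span S (disc_value S K r ph \<gamma>)")
    case True
    then show ?thesis unfolding min_absorb1[OF True] using dA dB1 by linarith
  next
    case False
    then have mm: "min (span S (disc_value S Kh r ph \<gamma>)) (span S (disc_value S K r ph \<gamma>)) = span S (disc_value S K r ph \<gamma>)"
      by simp
    show ?thesis unfolding mm using dA dB2 dB2' by linarith
  qed
qed

subsection \<open>Union bound over the samples\<close>

definition in_range :: "nat \<Rightarrow> nat \<Rightarrow> nat \<Rightarrow> (nat \<times> nat \<times> nat \<Rightarrow> nat) \<Rightarrow> bool" where
  "in_range S A n X \<longleftrightarrow> (\<forall>s<S. \<forall>a<A. \<forall>i<n. X (s, a, i) < S)"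

definition agree_off :: "nat \<Rightarrow> nat \<Rightarrow> (nat \<times> nat \<times> nat \<Rightarrow> nat) \<Rightarrow> (nat \<times> nat \<times> nat \<Rightarrow> nat) \<Rightarrow> bool" where
  "agree_off s a X Y \<longleftrightarrow> (\<forall>s' a' i. (s', a') \<noteq> (s, a) \<longrightarrow> X (s', a', i) = Y (s', a', i))"

text \<open>The vector may change with the pair whose row is tested, because each pair has its own
  leave-one-out model; it must only ignore that row.\<close>

lemma bern_failure_union:
  assumes sup: "\<And>s a. s < S \<Longrightarrow> a < A \<Longrightarrow> set_pmf (P s a) \<subseteq> {..<S}" and n: "0 < n" and L: "0 \<le> L"
    and T: "finite T"
    and indep: "\<And>s a j X Y. j \<in> T \<Longrightarrow> agree_off s a X Y \<Longrightarrow> v s a j X = v s a j Y"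
  shows "emeasure (sample_measure S A n P) {X \<in> space (sample_measure S A n P). in_range S A n X \<and>
     (\<exists>s<S. \<exists>a<A. \<exists>j\<in>T. \<not> bern S n L (pmf (P s a)) (emp_kernel n X s a) (v s a j X))}
     \<le> ennreal (real S * real A * real (card T) * (3 * exp (- L)))" (is "emeasure ?M ?B \<le> _")
proof -
  let ?I = "{..<S} \<times> {..<A} \<times> T"
  define F where "F = (\<lambda>(s, a, j). {X \<in> space ?M. (\<forall>i<n. X (s, a, i) < S) \<and>
     \<not> bern S n L (pmf (P s a)) (emp_kernel n X s a) (v s a j X)})"
  have F: "F j \<in> sets ?M" for j
    by (rule sample_measure_discrete) (auto simp: F_def split: prod.split)
  have "?B \<subseteq> (\<Union>j\<in>?I. F j)" by (auto simp: F_def in_range_def)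
  then have "emeasure ?M ?B \<le> emeasure ?M (\<Union>j\<in>?I. F j)"
    using F T by (intro emeasure_mono sets.finite_UN) auto
  also have "\<dots> \<le> (\<Sum>j\<in>?I. emeasure ?M (F j))"
    using F T by (intro emeasure_subadditive_finite) auto
  also have "\<dots> \<le> (\<Sum>j\<in>?I. ennreal (3 * exp (- L)))"
  proof (rule sum_mono)
    fix j assume "j \<in> ?I"
    then obtain s a t where j: "j = (s, a, t)" "s < S" "a < A" "t \<in> T" by auto
    show "emeasure ?M (F j) \<le> ennreal (3 * exp (- L))"
      unfolding j(1) F_def prod.case
      by (intro bern_failure_sample[OF sup n L j(2,3)] indep[OF j(4)]) (auto simp: agree_off_def)
  qed
  also have "\<dots> = ennreal (real S * real A * real (card T) * (3 * exp (- L)))"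
  proof -
    have "(\<Sum>j\<in>?I. ennreal (3 * exp (- L))) = ennreal (real (card ?I)) * ennreal (3 * exp (- L))"
      by (simp only: sum_constant ennreal_of_nat_eq_real_of_nat)
    also have "\<dots> = ennreal (real (card ?I) * (3 * exp (- L)))" by (rule ennreal_mult[symmetric]) auto
    finally show ?thesis by (simp add: card_cartesian_product mult.assoc)
  qed
  finally show ?thesis .
qed

subsection \<open>Ties are unlikely under the reward perturbation\<close>

definition noise :: "nat \<Rightarrow> nat \<Rightarrow> real \<Rightarrow> (nat \<times> nat \<Rightarrow> real) measure" where
  "noise S A \<xi> = PiM ({..<S} \<times> {..<A}) (\<lambda>_. uniform_measure lborel {0..\<xi>})"

lemma prob_space_uniform_interval: "0 < \<xi> \<Longrightarrow> prob_space (uniform_measure lborel {0..\<xi> :: real})"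
  by (intro prob_space_uniform_measure) auto

lemma prob_space_noise: "0 < \<xi> \<Longrightarrow> prob_space (noise S A \<xi>)"
  unfolding noise_def by (intro prob_space_PiM prob_space_uniform_interval)

section \<open>Measurability in the reward noise\<close>

lemma measurable_noise_component [measurable]:
  assumes "s < S" "a < A"
  shows "(\<lambda>D. D (s, a)) \<in> borel_measurable (noise S A \<xi>)"
proof -
  have "(\<lambda>D. D (s, a)) \<in> measurable (noise S A \<xi>) (uniform_measure lborel {0..\<xi>})"
    unfolding noise_def using assms by (intro measurable_component_singleton) auto
  then show ?thesis by (simp cong: measurable_cong_sets)
qed

lemma measurable_disc_value:
  assumes r: "\<And>s. s < S \<Longrightarrow> (\<lambda>D. r D s (q s)) \<in> borel_measurable M" and s: "s < S"
  shows "(\<lambda>D. disc_value S K (r D) q \<gamma> s) \<in> borel_measurable M"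
proof -
  have "\<forall>s<S. (\<lambda>D. Ppow_r S K (r D) q t s) \<in> borel_measurable M" for t
    by (induction t) (auto simp: Ppow_r_0 rpol_def Ppow_r_Suc Ppol_def r intro!: borel_measurable_sum borel_measurable_times)
  then show ?thesis unfolding disc_value_def using s
    by (intro borel_measurable_suminf borel_measurable_times) auto
qed

lemma measurable_optv:
  assumes r: "\<And>s a. s < S \<Longrightarrow> a < A \<Longrightarrow> (\<lambda>D. r D s a) \<in> borel_measurable M" and s: "s < S"
  shows "(\<lambda>D. optv S A K (r D) \<gamma> s) \<in> borel_measurable M"
  unfolding optv_def
proof (rule borel_measurable_Max)
  fix q assume "q \<in> pols S A"
  then show "(\<lambda>D. disc_value S K (r D) q \<gamma> s) \<in> borel_measurable M"
    by (intro measurable_disc_value r s) (auto simp: pols_def)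
qed simp

lemma measurable_expct:
  assumes "\<And>i. i < S \<Longrightarrow> (\<lambda>D. v D i) \<in> borel_measurable M"
  shows "(\<lambda>D. expct S k (v D)) \<in> borel_measurable M"
  unfolding expct_def using assms by (intro borel_measurable_sum borel_measurable_times) auto

lemma measurable_vari:
  assumes "\<And>i. i < S \<Longrightarrow> (\<lambda>D. v D i) \<in> borel_measurable M"
  shows "(\<lambda>D. vari S k (v D)) \<in> borel_measurable M"
  unfolding vari_def using assms
  by (intro measurable_expct borel_measurable_power borel_measurable_diff) auto

lemma measurable_span:
  assumes "\<And>i. i < S \<Longrightarrow> (\<lambda>D. v D i) \<in> borel_measurable M"
  shows "(\<lambda>D. span S (v D)) \<in> borel_measurable M"
  unfolding span_def using assms
  by (intro borel_measurable_diff borel_measurable_Max borel_measurable_Min) auto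

lemma pred_le_real:
  fixes f g :: "'a \<Rightarrow> real"
  assumes [measurable]: "f \<in> borel_measurable M" "g \<in> borel_measurable M"
  shows "Measurable.pred M (\<lambda>x. f x \<le> g x)"
  by measurable

lemma measurable_bern:
  assumes v: "\<And>i. i < S \<Longrightarrow> (\<lambda>D. v D i) \<in> borel_measurable M"
  shows "Measurable.pred M (\<lambda>D. bern S n L p k (v D))"
proof -
  have w: "(\<lambda>D. (v D i - expct S p (v D))\<^sup>2) \<in> borel_measurable M" if "i < S" for i
    by (intro borel_measurable_power borel_measurable_diff measurable_expct v that)
  note W = measurable_expct[where v = "\<lambda>D s. (v D s - expct S p (v D))\<^sup>2", OF w]
    measurable_vari[where v = "\<lambda>D s. (v D s - expct S p (v D))\<^sup>2", OF w]
  show ?thesis unfolding bern_def Let_def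
    by (intro pred_intros_logic pred_le_real borel_measurable_add borel_measurable_diff borel_measurable_times
        borel_measurable_abs measurable_compose[OF _ borel_measurable_sqrt] borel_measurable_power borel_measurable_const W
        measurable_expct measurable_vari measurable_span v)
qed

lemma measurable_disc_optimal:
  assumes r: "\<And>s a. s < S \<Longrightarrow> a < A \<Longrightarrow> (\<lambda>D. r D s a) \<in> borel_measurable M" and q: "is_policy S A q"
  shows "Measurable.pred M (\<lambda>D. disc_optimal S A K (r D) \<gamma> q)"
proof -
  have "Measurable.pred M (\<lambda>D. \<forall>q'\<in>pols S A. \<forall>s\<in>{..<S}. disc_value S K (r D) q' \<gamma> s \<le> disc_value S K (r D) q \<gamma> s)"
  proof (intro pred_intros_finite finite_pols finite_lessThan pred_le_real)
    fix q' s assume "q' \<in> pols S A" "s \<in> {..<S}"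
    then show "(\<lambda>D. disc_value S K (r D) q' \<gamma> s) \<in> borel_measurable M"
      "(\<lambda>D. disc_value S K (r D) q \<gamma> s) \<in> borel_measurable M"
      using q by (auto intro!: measurable_disc_value r simp: pols_def is_policy_def)
  qed
  then show ?thesis using q by (simp add: disc_optimal_def Ball_def)
qed

lemma measurable_perturb:
  "s < S \<Longrightarrow> a < A \<Longrightarrow> (\<lambda>D. perturb r D s a) \<in> borel_measurable (noise S A \<xi>)"
  unfolding perturb_def by measurable

lemma measurable_cutr_perturb:
  "s' < S \<Longrightarrow> a' < A \<Longrightarrow> (\<lambda>D. cutr s a u (perturb r D) s' a') \<in> borel_measurable (noise S A \<xi>)"
  unfolding cutr_def using measurable_perturb[of s' S a' A r \<xi>] by (cases "s' = s \<and> a' = a") simp_all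

lemma measurable_near_tie:
  assumes "s < S" "a < A"
  shows "Measurable.pred (noise S A \<xi>) (\<lambda>D. near_tie S A K (perturb r D) \<gamma> w s a)"
proof -
  let ?V = "\<lambda>D. optv S A (cutk s a K) (cutr s a 0 (perturb r D)) \<gamma>"
  have V: "(\<lambda>D. ?V D i) \<in> borel_measurable (noise S A \<xi>)" if "i < S" for i
    by (intro measurable_optv measurable_cutr_perturb that)
  show ?thesis unfolding near_tie_def Let_def qval_def
    by (intro pred_intros_logic pred_le_real borel_measurable_add borel_measurable_diff borel_measurable_times
        borel_measurable_const measurable_expct measurable_perturb V assms)
qed

lemma emeasure_uniform_interval:
  assumes "0 < \<xi>" "0 \<le> w"
  shows "emeasure (uniform_measure lborel {0..\<xi>}) {c - w..c} \<le> ennreal (w / \<xi>)"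
proof -
  have "emeasure (uniform_measure lborel {0..\<xi>}) {c - w..c}
      = emeasure lborel ({0..\<xi>} \<inter> {c - w..c}) / emeasure lborel {0..\<xi>}"
    by (intro emeasure_uniform_measure) auto
  also have "\<dots> \<le> emeasure lborel {c - w..c} / emeasure lborel {0..\<xi>}"
    by (intro divide_right_mono_ennreal emeasure_mono) auto
  also have "\<dots> = ennreal (w / \<xi>)" using assms by (simp add: divide_ennreal)
  finally show ?thesis .
qed

text \<open>Integrate over the noise at (s, a) with all other coordinates fixed. The cut model does
  not move, so the event confines that coordinate to an interval of length \<open>w\<close>, against
  a uniform density of 1 / \<xi>.\<close>

lemma near_tie_unlikely:
  assumes xi: "0 < \<xi>" and w: "0 \<le> w" and s: "s < S" and a: "a < A"
  shows "emeasure (noise S A \<xi>) {D \<in> space (noise S A \<xi>). near_tie S A K (perturb r D) \<gamma> w s a} \<le> ennreal (w / \<xi>)"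
    (is "emeasure ?M ?B \<le> _")
proof -
  define U where "U = (\<lambda>_ :: nat \<times> nat. uniform_measure lborel {0..\<xi>})"
  define I where "I = {..<S} \<times> {..<A} - {(s, a)}"
  have I: "finite I" "(s, a) \<notin> I" "insert (s, a) I = {..<S} \<times> {..<A}" using s a by (auto simp: I_def)
  have M: "?M = PiM (insert (s, a) I) U" unfolding noise_def U_def I(3) ..
  interpret product_sigma_finite U
    unfolding U_def by (intro product_sigma_finite.intro prob_space_imp_sigma_finite prob_space_uniform_interval xi)
  have B: "?B \<in> sets ?M" using measurable_near_tie[OF s a] by (rule predE)
  have "emeasure ?M ?B = (\<integral>\<^sup>+D. indicator ?B D \<partial>?M)" by (rule nn_integral_indicator[OF B, symmetric])
  also have "\<dots> = (\<integral>\<^sup>+D. (\<integral>\<^sup>+y. indicator ?B (D((s, a) := y)) \<partial>U (s, a)) \<partial>PiM I U)"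
    unfolding M by (rule product_nn_integral_insert[OF I(1,2) borel_measurable_indicator[OF B[unfolded M]]])
  also have "\<dots> \<le> (\<integral>\<^sup>+D. ennreal (w / \<xi>) \<partial>PiM I U)"
  proof (rule nn_integral_mono)
    fix D
    define V where "V = optv S A (cutk s a K) (cutr s a 0 (perturb r D)) \<gamma>"
    define c where "c = V s - r s a - \<gamma> * expct S (K s a) V"
    have cut: "cutr s a 0 (perturb r (D((s, a) := y))) = cutr s a 0 (perturb r D)" for y
      by (auto simp: cutr_def perturb_def fun_eq_iff)
    have "(\<integral>\<^sup>+y. indicator ?B (D((s, a) := y)) \<partial>U (s, a)) \<le> (\<integral>\<^sup>+y. indicator {c - w..c} y \<partial>U (s, a))"
      by (intro nn_integral_mono)
        (auto simp: near_tie_def cut V_def[symmetric] qval_def perturb_def c_def split: split_indicator)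
    also have "\<dots> = emeasure (U (s, a)) {c - w..c}"
      by (intro nn_integral_indicator) (simp add: U_def)
    also have "\<dots> \<le> ennreal (w / \<xi>)" unfolding U_def by (rule emeasure_uniform_interval[OF xi w])
    finally show "(\<integral>\<^sup>+y. indicator ?B (D((s, a) := y)) \<partial>U (s, a)) \<le> ennreal (w / \<xi>)" .
  qed
  also have "\<dots> = ennreal (w / \<xi>)"
  proof -
    have "prob_space (PiM I U)" unfolding U_def by (intro prob_space_PiM prob_space_uniform_interval xi)
    then show ?thesis by (simp add: prob_space.emeasure_space_1)
  qed
  finally show ?thesis .
qed

lemma noise_range:
  assumes "0 < \<xi>"
  shows "AE D in noise S A \<xi>. \<forall>s\<in>{..<S}. \<forall>a\<in>{..<A}. 0 \<le> D (s, a) \<and> D (s, a) \<le> \<xi>"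
proof (intro AE_finite_allI finite_lessThan)
  fix s a assume sa: "s \<in> {..<S}" "a \<in> {..<A}"
  have "AE y in uniform_measure lborel {0..\<xi>}. y \<in> {0..\<xi>}"
    by (rule AE_uniform_measureI) auto
  then show "AE D in noise S A \<xi>. 0 \<le> D (s, a) \<and> D (s, a) \<le> \<xi>"
    unfolding noise_def using sa
    by (intro AE_PiM_component prob_space_uniform_interval assms) auto
qed

subsection \<open>The good event\<close>

text \<open>Uniqueness turns the optimal policy of a cut model into a function of the data outside
  one row, so a union bound over all policies is avoided.\<close>

definition unique_optimal :: "nat \<Rightarrow> nat \<Rightarrow> (nat \<Rightarrow> nat \<Rightarrow> nat \<Rightarrow> real) \<Rightarrow> (nat \<Rightarrow> nat \<Rightarrow> real) \<Rightarrow> real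
    \<Rightarrow> (nat \<Rightarrow> nat) \<Rightarrow> bool" where
  "unique_optimal S A K r \<gamma> q \<longleftrightarrow> q \<in> pols S A \<and> disc_optimal S A K r \<gamma> q \<and>
     (\<forall>q'\<in>pols S A. disc_optimal S A K r \<gamma> q' \<longrightarrow> q' = q)"

text \<open>\<open>vr\<close> is the true value of the reference policy, and \<open>k * e\<close> for \<open>k \<le> N\<close> is the net of
  candidate values for the removed pair.\<close>

definition good_rows :: "nat \<Rightarrow> nat \<Rightarrow> nat \<Rightarrow> (nat \<Rightarrow> nat \<Rightarrow> nat pmf) \<Rightarrow> (nat \<Rightarrow> nat \<Rightarrow> real) \<Rightarrow> real \<Rightarrow> real
    \<Rightarrow> real \<Rightarrow> nat \<Rightarrow> (nat \<Rightarrow> real) \<Rightarrow> (nat \<times> nat \<times> nat \<Rightarrow> nat) \<Rightarrow> (nat \<times> nat \<Rightarrow> real) \<Rightarrow> bool" where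
  "good_rows S A n P r \<gamma> L e N vr X D \<longleftrightarrow> in_range S A n X \<and>
     (\<forall>s\<in>{..<S}. \<forall>a\<in>{..<A}. bern S n L (pmf (P s a)) (emp_kernel n X s a) vr) \<and>
     (\<forall>s\<in>{..<S}. \<forall>a\<in>{..<A}. \<forall>k\<in>{..N}. bern S n L (pmf (P s a)) (emp_kernel n X s a)
        (optv S A (cutk s a (emp_kernel n X)) (cutr s a (real k * e) (perturb r D)) \<gamma>)) \<and>
     (\<forall>s\<in>{..<S}. \<forall>a\<in>{..<A}. \<forall>k\<in>{..N}. \<forall>q\<in>pols S A.
        unique_optimal S A (cutk s a (emp_kernel n X)) (cutr s a (real k * e) (perturb r D)) \<gamma> q \<longrightarrow>
        bern S n L (pmf (P s a)) (emp_kernel n X s a) (disc_value S (pmf_kernel P) r q \<gamma>))"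

definition good_noise :: "nat \<Rightarrow> nat \<Rightarrow> nat \<Rightarrow> (nat \<Rightarrow> nat \<Rightarrow> real) \<Rightarrow> real \<Rightarrow> real \<Rightarrow> real
    \<Rightarrow> (nat \<times> nat \<times> nat \<Rightarrow> nat) \<Rightarrow> (nat \<times> nat \<Rightarrow> real) \<Rightarrow> bool" where
  "good_noise S A n r \<gamma> w \<xi> X D \<longleftrightarrow>
     (\<forall>s\<in>{..<S}. \<forall>a\<in>{..<A}. 0 \<le> D (s, a) \<and> D (s, a) \<le> \<xi>) \<and>
     (\<forall>s\<in>{..<S}. \<forall>a\<in>{..<A}. \<not> near_tie S A (emp_kernel n X) (perturb r D) \<gamma> w s a)"

lemma measurable_good_rows:
  "Measurable.pred (noise S A \<xi>) (\<lambda>D. good_rows S A n P r \<gamma> L e N vr X D)"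
proof -
  have u: "Measurable.pred (noise S A \<xi>) (\<lambda>D. unique_optimal S A K (cutr s a u (perturb r D)) \<gamma> q)"
    if q: "q \<in> pols S A" for K s a u q
    unfolding unique_optimal_def
    by (intro pred_intros_logic pred_intros_finite finite_pols measurable_disc_optimal measurable_cutr_perturb
        pols_is_policy q; (assumption | simp))
  show ?thesis unfolding good_rows_def
    by (intro pred_intros_logic pred_intros_finite finite_lessThan finite_atMost finite_pols measurable_bern u
        measurable_optv measurable_cutr_perturb; (assumption | simp))
qed

lemma measurable_good_noise:
  "Measurable.pred (noise S A \<xi>') (\<lambda>D. good_noise S A n r \<gamma> w \<xi> X D)"
  unfolding good_noise_def
  by (intro pred_intros_logic pred_intros_finite finite_lessThan measurable_near_tie pred_le_real
      measurable_noise_component borel_measurable_const; simp)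

text \<open>With a countable first factor the event is a countable union of rectangles; hence
  measurability in the noise for each fixed sample suffices.\<close>

lemma discrete_pair_sets:
  assumes c: "countable (space M1)" and sg: "\<And>x. x \<in> space M1 \<Longrightarrow> {x} \<in> sets M1"
    and Q: "\<And>x. x \<in> space M1 \<Longrightarrow> Measurable.pred M2 (Q x)"
  shows "{z \<in> space (M1 \<Otimes>\<^sub>M M2). Q (fst z) (snd z)} \<in> sets (M1 \<Otimes>\<^sub>M M2)"
proof -
  have "{z \<in> space (M1 \<Otimes>\<^sub>M M2). Q (fst z) (snd z)} = (\<Union>x\<in>space M1. {x} \<times> {y \<in> space M2. Q x y})"
    by (auto simp: space_pair_measure)
  also have "\<dots> \<in> sets (M1 \<Otimes>\<^sub>M M2)"
    by (rule sets.countable_UN'[OF c]) (use Q sg in \<open>auto intro!: pair_measureI predE\<close>)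
  finally show ?thesis .
qed

lemma cutk_emp_agree:
  assumes "agree_off s a X Y"
  shows "cutk s a (emp_kernel n X) = cutk s a (emp_kernel n Y)"
proof (intro ext)
  fix s1 a1 s2
  show "cutk s a (emp_kernel n X) s1 a1 s2 = cutk s a (emp_kernel n Y) s1 a1 s2"
  proof (cases "s1 = s \<and> a1 = a")
    case False
    then have "X (s1, a1, i) = Y (s1, a1, i)" for i using assms by (auto simp: agree_off_def)
    then show ?thesis by (simp add: cutk_def emp_kernel_def)
  qed (simp add: cutk_def)
qed

lemma bad_rows_unlikely:
  assumes sup: "\<And>s a. s < S \<Longrightarrow> a < A \<Longrightarrow> set_pmf (P s a) \<subseteq> {..<S}" and n: "0 < n" and L: "0 \<le> L"
  shows "emeasure (sample_measure S A n P) {X \<in> space (sample_measure S A n P). \<not> good_rows S A n P r \<gamma> L e N vr X D}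
    \<le> ennreal (real S * real A * real (2 * N + 3) * (3 * exp (- L)))" (is "emeasure ?M ?B \<le> _")
proof -
  let ?K = "pmf_kernel P"
  define F where "F T v = {X \<in> space ?M. in_range S A n X \<and>
     (\<exists>s<S. \<exists>a<A. \<exists>j\<in>T. \<not> bern S n L (pmf (P s a)) (emp_kernel n X s a) (v s a j X))}"
    for T :: "nat set" and v
  define u where "u s a k X q \<longleftrightarrow> unique_optimal S A (cutk s a (emp_kernel n X)) (cutr s a (real k * e) (perturb r D)) \<gamma> q"
    for s a k X q
  define v1 where "v1 s a k X = optv S A (cutk s a (emp_kernel n X)) (cutr s a (real k * e) (perturb r D)) \<gamma>"
    for s a k X
  \<comment> \<open>The choice depends on the cut model only, hence ignores the removed row even
    when no unique optimum exists; in that case the vector is arbitrary, and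
    \<open>good_rows\<close> asserts nothing about it. The three families contribute 1 + (N + 1) +
    (N + 1) = 2 N + 3 vectors per pair.\<close>
  define v2 where "v2 s a k X = disc_value S ?K r (SOME q. u s a k X q) \<gamma>" for s a k X
  define c where "c = real S * real A * (3 * exp (- L))"
  have c0: "0 \<le> c" by (simp add: c_def)
  define R where "R = {X \<in> space ?M. \<not> in_range S A n X}"
  have disc: "B \<subseteq> space ?M \<Longrightarrow> B \<in> sets ?M" for B by (rule sample_measure_discrete)
  have R: "emeasure ?M R = 0"
  proof -
    have "AE X in ?M. in_range S A n X" using sample_range_null[OF sup] by (simp add: in_range_def)
    then show ?thesis by (subst (asm) AE_iff_measurable[OF disc[of R]]) (auto simp: R_def)
  qed
  have F: "emeasure ?M (F T v) \<le> ennreal (real (card T) * c)"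
    if "finite T" "\<And>s a j X Y. j \<in> T \<Longrightarrow> agree_off s a X Y \<Longrightarrow> v s a j X = v s a j Y" for T v
    using bern_failure_union[where T = T and v = v, OF sup n L that] by (simp add: F_def c_def mult_ac)
  have F0: "emeasure ?M (F {0} (\<lambda>_ _ _ _. vr)) \<le> ennreal (1 * c)" using F[of "{0}" "\<lambda>_ _ _ _. vr"] by simp
  have F1: "emeasure ?M (F {..N} v1) \<le> ennreal (real (N + 1) * c)"
    using F[of "{..N}" v1] by (simp add: v1_def cutk_emp_agree)
  have F2: "emeasure ?M (F {..N} v2) \<le> ennreal (real (N + 1) * c)"
    using F[of "{..N}" v2] by (simp add: v2_def u_def cutk_emp_agree)
  have "?B \<subseteq> R \<union> (F {0} (\<lambda>_ _ _ _. vr) \<union> (F {..N} v1 \<union> F {..N} v2))"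
  proof
    fix X assume X: "X \<in> ?B"
    show "X \<in> R \<union> (F {0} (\<lambda>_ _ _ _. vr) \<union> (F {..N} v1 \<union> F {..N} v2))"
    proof (rule ccontr)
      assume no: "\<not> ?thesis"
      have rg: "in_range S A n X" using no X by (auto simp: R_def)
      have b0: "bern S n L (pmf (P s a)) (emp_kernel n X s a) vr" if "s < S" "a < A" for s a
        using no X rg that by (auto simp: F_def)
      have b1: "bern S n L (pmf (P s a)) (emp_kernel n X s a) (v1 s a k X)" if "s < S" "a < A" "k \<le> N" for s a k
        using no X rg that by (auto simp: F_def)
      have b2: "bern S n L (pmf (P s a)) (emp_kernel n X s a) (v2 s a k X)" if "s < S" "a < A" "k \<le> N" for s a k
        using no X rg that by (auto simp: F_def)
      have "bern S n L (pmf (P s a)) (emp_kernel n X s a) (disc_value S ?K r q \<gamma>)"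
        if h: "s < S" "a < A" "k \<le> N" and q: "q \<in> pols S A" "u s a k X q" for s a k q
      proof -
        have "u s a k X (SOME q. u s a k X q)" by (rule someI[of "u s a k X", OF q(2)])
        then have "(SOME q. u s a k X q) = q" using q(2) unfolding u_def unique_optimal_def by blast
        then show ?thesis using b2[OF h] by (simp add: v2_def)
      qed
      then have "good_rows S A n P r \<gamma> L e N vr X D"
        unfolding good_rows_def using rg b0 b1 by (auto simp: v1_def u_def)
      then show False using X by simp
    qed
  qed
  then have "emeasure ?M ?B \<le> emeasure ?M (R \<union> (F {0} (\<lambda>_ _ _ _. vr) \<union> (F {..N} v1 \<union> F {..N} v2)))"
    by (intro emeasure_mono disc) (auto simp: R_def F_def)
  also have "\<dots> \<le> emeasure ?M R + emeasure ?M (F {0} (\<lambda>_ _ _ _. vr) \<union> (F {..N} v1 \<union> F {..N} v2))"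
    by (intro emeasure_subadditive disc) (auto simp: R_def F_def)
  also have "\<dots> \<le> emeasure ?M R + (emeasure ?M (F {0} (\<lambda>_ _ _ _. vr)) + emeasure ?M (F {..N} v1 \<union> F {..N} v2))"
    by (intro add_left_mono emeasure_subadditive disc) (auto simp: F_def)
  also have "\<dots> \<le> emeasure ?M R + (emeasure ?M (F {0} (\<lambda>_ _ _ _. vr)) + (emeasure ?M (F {..N} v1) + emeasure ?M (F {..N} v2)))"
    by (intro add_left_mono emeasure_subadditive disc) (auto simp: F_def)
  also have "\<dots> \<le> 0 + (ennreal (1 * c) + (ennreal (real (N + 1) * c) + ennreal (real (N + 1) * c)))"
    using R by (intro add_mono F0 F1 F2) auto
  also have "\<dots> = ennreal (1 * c + (real (N + 1) * c + real (N + 1) * c))"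
    using c0 by (simp add: ennreal_plus[symmetric] del: ennreal_plus)
  also have "1 * c + (real (N + 1) * c + real (N + 1) * c) = real S * real A * real (2 * N + 3) * (3 * exp (- L))"
    by (simp add: c_def algebra_simps)
  finally show ?thesis .
qed

lemma bad_noise_unlikely:
  assumes xi: "0 < \<xi>" and w: "0 \<le> w"
  shows "emeasure (noise S A \<xi>) {D \<in> space (noise S A \<xi>). \<not> good_noise S A n r \<gamma> w \<xi> X D}
    \<le> ennreal (real S * real A * (w / \<xi>))" (is "emeasure ?M ?B \<le> _")
proof -
  let ?I = "{..<S} \<times> {..<A}"
  define R where "R = {D \<in> space ?M. \<not> (\<forall>s\<in>{..<S}. \<forall>a\<in>{..<A}. 0 \<le> D (s, a) \<and> D (s, a) \<le> \<xi>)}"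
  define F where "F j = {D \<in> space ?M. near_tie S A (emp_kernel n X) (perturb r D) \<gamma> w (fst j) (snd j)}" for j
  have Rs: "R \<in> sets ?M" unfolding R_def
    by (intro predE pred_intros_logic pred_intros_finite finite_lessThan pred_le_real
      measurable_noise_component borel_measurable_const; simp)
  have R: "emeasure ?M R = 0"
    using noise_range[OF xi, of S A] by (subst (asm) AE_iff_measurable[OF Rs]) (auto simp: R_def)
  have Fs: "F j \<in> sets ?M" if "j \<in> ?I" for j
    unfolding F_def by (rule predE[OF measurable_near_tie]) (use that in auto)
  have "?B \<subseteq> R \<union> (\<Union>j\<in>?I. F j)" by (auto simp: good_noise_def R_def F_def)
  then have "emeasure ?M ?B \<le> emeasure ?M (R \<union> (\<Union>j\<in>?I. F j))"
    by (intro emeasure_mono sets.Un Rs sets.finite_UN Fs) auto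
  also have "\<dots> \<le> emeasure ?M R + emeasure ?M (\<Union>j\<in>?I. F j)"
    by (intro emeasure_subadditive Rs sets.finite_UN Fs) auto
  also have "\<dots> \<le> 0 + (\<Sum>j\<in>?I. emeasure ?M (F j))"
    using R Fs by (intro add_mono emeasure_subadditive_finite) auto
  also have "\<dots> \<le> 0 + (\<Sum>j\<in>?I. ennreal (w / \<xi>))"
    unfolding F_def by (intro add_left_mono sum_mono near_tie_unlikely xi w) auto
  also have "\<dots> = ennreal (real (card ?I)) * ennreal (w / \<xi>)"
    by (simp only: sum_constant ennreal_of_nat_eq_real_of_nat add_0)
  also have "\<dots> = ennreal (real (card ?I) * (w / \<xi>))" using xi w by (intro ennreal_mult[symmetric]) auto
  also have "real (card ?I) * (w / \<xi>) = real S * real A * (w / \<xi>)" by (simp add: card_cartesian_product)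
  finally show ?thesis .
qed

lemma sample_space_eq: "sample_space S A n P \<xi> = sample_measure S A n P \<Otimes>\<^sub>M noise S A \<xi>"
  by (simp add: sample_space_def sample_measure_def noise_def)

text \<open>The two failures are sliced in opposite orders: row failures with the noise fixed, where
  leave-one-out applies, and tie failures with the samples fixed, where only the noise is
  random.\<close>

lemma good_event_likely:
  assumes sup: "\<And>s a. s < S \<Longrightarrow> a < A \<Longrightarrow> set_pmf (P s a) \<subseteq> {..<S}" and n: "0 < n" and L: "0 \<le> L"
    and xi: "0 < \<xi>" and w: "0 \<le> w"
    and Edef: "E = {z \<in> space (sample_space S A n P \<xi>). good_rows S A n P r \<gamma> L e N vr (fst z) (snd z) \<and>
      good_noise S A n r \<gamma> w \<xi> (fst z) (snd z)}"
  shows "E \<in> sets (sample_space S A n P \<xi>)"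
    and "1 - (real S * real A * real (2 * N + 3) * (3 * exp (- L)) + real S * real A * (w / \<xi>))
      \<le> measure (sample_space S A n P \<xi>) E"
proof -
  let ?M1 = "sample_measure S A n P" and ?M2 = "noise S A \<xi>"
  let ?M = "?M1 \<Otimes>\<^sub>M ?M2"
  interpret M1: prob_space ?M1 by (rule prob_space_sample_measure)
  interpret M2: prob_space ?M2 by (rule prob_space_noise[OF xi])
  interpret M: pair_prob_space ?M1 ?M2 ..
  define b1 where "b1 = real S * real A * real (2 * N + 3) * (3 * exp (- L))"
  define b2 where "b2 = real S * real A * (w / \<xi>)"
  have b0: "0 \<le> b1" "0 \<le> b2" using xi w by (auto simp: b1_def b2_def)
  have sets: "{z \<in> space ?M. Q (fst z) (snd z)} \<in> sets ?M"
    if "\<And>X. Measurable.pred ?M2 (Q X)" for Q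
    by (rule discrete_pair_sets[OF countable_space_sample_measure]) (auto intro: sample_measure_discrete that)
  define B1 where "B1 = {z \<in> space ?M. \<not> good_rows S A n P r \<gamma> L e N vr (fst z) (snd z)}"
  define B2 where "B2 = {z \<in> space ?M. \<not> good_noise S A n r \<gamma> w \<xi> (fst z) (snd z)}"
  have s1: "B1 \<in> sets ?M" unfolding B1_def
    by (rule sets) (intro pred_intros_logic measurable_good_rows)
  have s2: "B2 \<in> sets ?M" unfolding B2_def
    by (rule sets) (intro pred_intros_logic measurable_good_noise)
  have E: "E = space ?M - (B1 \<union> B2)" by (auto simp: Edef B1_def B2_def sample_space_eq)
  show "E \<in> sets (sample_space S A n P \<xi>)" unfolding E sample_space_eq using s1 s2 by auto
  have "emeasure ?M B1 = (\<integral>\<^sup>+D. emeasure ?M1 ((\<lambda>X. (X, D)) -` B1) \<partial>?M2)"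
    by (rule M.emeasure_pair_measure_alt2[OF s1])
  also have "\<dots> \<le> (\<integral>\<^sup>+D. ennreal b1 \<partial>?M2)"
  proof (rule nn_integral_mono)
    fix D assume "D \<in> space ?M2"
    then have "(\<lambda>X. (X, D)) -` B1 = {X \<in> space ?M1. \<not> good_rows S A n P r \<gamma> L e N vr X D}"
      by (auto simp: B1_def space_pair_measure)
    then show "emeasure ?M1 ((\<lambda>X. (X, D)) -` B1) \<le> ennreal b1"
      using bad_rows_unlikely[where P = P and S = S and A = A and r = r and \<gamma> = \<gamma> and e = e and N = N
          and vr = vr and D = D, OF sup n L] by (simp add: b1_def)
  qed
  finally have e1: "emeasure ?M B1 \<le> ennreal b1" by (simp add: M2.emeasure_space_1)
  have "emeasure ?M B2 = (\<integral>\<^sup>+X. emeasure ?M2 (Pair X -` B2) \<partial>?M1)"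
    by (rule M2.emeasure_pair_measure_alt[OF s2])
  also have "\<dots> \<le> (\<integral>\<^sup>+X. ennreal b2 \<partial>?M1)"
  proof (rule nn_integral_mono)
    fix X assume "X \<in> space ?M1"
    then have "Pair X -` B2 = {D \<in> space ?M2. \<not> good_noise S A n r \<gamma> w \<xi> X D}"
      by (auto simp: B2_def space_pair_measure)
    then show "emeasure ?M2 (Pair X -` B2) \<le> ennreal b2"
      using bad_noise_unlikely[OF xi w, of S A n r \<gamma> X] by (simp add: b2_def)
  qed
  finally have e2: "emeasure ?M B2 \<le> ennreal b2" by (simp add: M1.emeasure_space_1)
  have "measure ?M B1 \<le> b1" "measure ?M B2 \<le> b2"
    using e1 e2 b0 by (simp_all add: M.P.emeasure_eq_measure)
  then have "measure ?M (B1 \<union> B2) \<le> b1 + b2"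
    using measure_Un_le[OF s1 s2] by linarith
  moreover have "measure ?M E = 1 - measure ?M (B1 \<union> B2)"
    unfolding E by (rule M.P.prob_compl) (use s1 s2 in auto)
  ultimately show "1 - (real S * real A * real (2 * N + 3) * (3 * exp (- L)) + real S * real A * (w / \<xi>))
      \<le> measure (sample_space S A n P \<xi>) E"
    unfolding sample_space_eq by (simp add: b1_def b2_def)
qed

lemma bern_cong:
  assumes "\<And>i. i < S \<Longrightarrow> v i = w i"
  shows "bern S n L p k v = bern S n L p k w"
proof -
  have "span S v = span S w" unfolding span_def using assms by (intro arg_cong2[where f = "(-)"] arg_cong[where f = Max] arg_cong[where f = Min] image_cong) auto
  moreover have "expct S m v = expct S m w" for m by (intro expct_cong assms)
  moreover have "expct S m (\<lambda>s. (v s - c)\<^sup>2) = expct S m (\<lambda>s. (w s - c)\<^sup>2)"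
    "expct S m (\<lambda>s. ((v s - c)\<^sup>2 - d)\<^sup>2) = expct S m (\<lambda>s. ((w s - c)\<^sup>2 - d)\<^sup>2)" for m c d
    using assms by (auto intro!: expct_cong)
  ultimately show ?thesis unfolding bern_def vari_def Let_def by simp
qed

subsection \<open>From the good event to the gain\<close>

text \<open>The net and the action gap turn the uniform statements of the good event into the
  hypotheses of \<open>good_sample_value_gap\<close>; the value gap at horizon n is then divided by
  n. Only rows used by one of the two policies are consulted.\<close>

lemma good_event_gain_gap:
  fixes n :: nat and L :: real
  assumes sup: "\<And>s a. s < S \<Longrightarrow> a < A \<Longrightarrow> set_pmf (P s a) \<subseteq> {..<S}" and A: "0 < A"
    and r: "\<And>s a. s < S \<Longrightarrow> a < A \<Longrightarrow> 0 \<le> r s a \<and> r s a \<le> 1"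
    and wc: "weakly_communicating S A (pmf_kernel P)" and s0: "s0 < S"
    and n: "4 \<le> n" and gd: "\<gamma> = 1 - 1 / real n" and L: "1 \<le> L" "64 * L \<le> real n"
    and e: "0 < e" "40 * e * real n \<le> 1" and ew: "2 * e \<le> w" and N: "2 * real n \<le> real N * e"
    and p: "blackwell_optimal S A (pmf_kernel P) r p"
    and rows: "good_rows S A n P r \<gamma> L e N (disc_value S (pmf_kernel P) r p \<gamma>) X D"
    and noise: "good_noise S A n r \<gamma> w (1 / (2 * real n ^ 2)) X D"
    and ph: "blackwell_optimal S A (anchor s0 (1 / real n) (emp_kernel n X)) (perturb r D) ph"
    and s: "s < S"
  defines "H \<equiv> span S (bias S (pmf_kernel P) r p)"
    and "m \<equiv> min (span S (bias S (anchor s0 (1 / real n) (emp_kernel n X)) r ph))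
                    (span S (bias S (anchor s0 (1 / real n) (pmf_kernel P)) r ph))"
  shows "gain S (pmf_kernel P) r p s - gain S (pmf_kernel P) r ph s
    \<le> (H + 1 + 500 * L * sqrt (real n * (2 * H + 1)) + 500 * L * sqrt (real n * (m + 2))) / real n"
proof -
  let ?K = "pmf_kernel P" and ?Kh = "emp_kernel n X" and ?rt = "perturb r D"
  have S: "0 < S" using s by simp
  have n0: "0 < n" using n by simp
  have g: "0 \<le> \<gamma>" "\<gamma> < 1" using n by (auto simp: gd)
  have K: "stochkernel S A ?K"
    using stoch_pmf[OF sup] by (simp add: stochkernel_def pmf_kernel_def[abs_def])
  have rg: "in_range S A n X" using rows by (simp add: good_rows_def)
  have Kh: "stochkernel S A ?Kh"
    unfolding stochkernel_def using rg n0 by (auto intro!: emp_stoch simp: in_range_def)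
  note sKh = stochkernel_subkernel[OF Kh]
  have pp: "is_policy S A p" using p by (simp add: blackwell_optimal_def)
  have eta: "0 < 1 / real n" "1 / real n \<le> 1" using n by auto
  have opt: "disc_optimal S A ?Kh ?rt \<gamma> ph"
    unfolding gd by (rule blackwell_anchor_disc_optimal[OF s0 eta Kh A ph])
  have php: "is_policy S A ph" using opt by (simp add: disc_optimal_def)
  have D: "0 \<le> D (i, a)" "D (i, a) \<le> 1 / (2 * real n ^ 2)" if "i < S" "a < A" for i a
    using noise that by (auto simp: good_noise_def)
  have nt: "\<not> near_tie S A ?Kh ?rt \<gamma> w i a" if "i < S" "a < A" for i a
    using noise that by (auto simp: good_noise_def)
  have rt: "r i a \<le> ?rt i a \<and> ?rt i a \<le> r i a + 1 / (2 * real n ^ 2)" if "i < S" "a < A" for i a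
    using D[OF that] by (simp add: perturb_def)
  have "1 \<le> real n ^ 2" using n by (intro one_le_power) auto
  then have "1 / (2 * real n ^ 2) \<le> 1" by (simp add: divide_le_eq)
  then have rt2: "0 \<le> ?rt i a" "?rt i a \<le> 2" if "i < S" "a < A" for i a
    using rt[OF that] r[OF that] by linarith+
  let ?V = "disc_value S ?Kh ?rt ph \<gamma>"
  have Vb: "0 \<le> ?V i" "?V i \<le> 2 * real n" if "i < S" for i
  proof -
    have *: "\<And>k. k < S \<Longrightarrow> 0 \<le> ?rt k (ph k) \<and> ?rt k (ph k) \<le> 2" using rt2 php by (auto simp: is_policy_def)
    show "0 \<le> ?V i" by (rule disc_value_bounds(1)[where R = 2, OF subkernelD[OF sKh php] g _ that]) (rule *)
    have "?V i \<le> 2 / (1 - \<gamma>)" by (rule disc_value_bounds(2)[OF subkernelD[OF sKh php] g _ that]) (rule *)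
    then show "?V i \<le> 2 * real n" by (simp add: gd)
  qed
  have gap: "qval S ?Kh ?rt \<gamma> ?V i a < ?V i - w" if "i < S" "a < A" "a \<noteq> ph i" for i a
    by (rule action_gap[OF sKh g opt _ _ that(1,2) nt[OF that(1,2)]]) (use rt2 that in auto)
  \<comment> \<open>At the action of \<open>ph\<close> the Q-value is the value itself, which lies
    in [0, 2 n] because perturbed rewards are at most 2; this is the range the net has to
    cover.\<close>
  have net: "\<exists>k\<le>N. \<bar>real k * e - qval S ?Kh ?rt \<gamma> ?V i (ph i)\<bar> \<le> e" if i: "i < S" for i
  proof -
    have a: "ph i < A" using php i by (simp add: is_policy_def)
    define u where "u = qval S ?Kh ?rt \<gamma> ?V i (ph i)"
    have "u = ?V i"
      using disc_value_fixed_point[OF subkernelD[OF sKh php] g i, of ?rt] by (simp add: u_def qval_def)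
    then have ub: "0 \<le> u" "u \<le> real N * e" using Vb[OF i] N by auto
    define k where "k = nat \<lfloor>u / e\<rfloor>"
    have ue: "0 \<le> u / e" using ub e by simp
    have kf: "real k = of_int \<lfloor>u / e\<rfloor>" using ue by (simp add: k_def)
    have "real k \<le> u / e" "u / e < real k + 1" unfolding kf by linarith+
    then have k: "real k * e \<le> u" "u \<le> real k * e + e" using e by (auto simp: field_simps)
    have "real k * e \<le> real N * e" using k ub by linarith
    then have "k \<le> N" using e by simp
    then show ?thesis using k e by (intro exI[of _ k]) (auto simp: u_def abs_le_iff)
  qed
  have B1: "\<exists>v. bern S n L (?K i (ph i)) (?Kh i (ph i)) v \<and> (\<forall>j<S. \<bar>v j - ?V j\<bar> \<le> e)" if i: "i < S" for i
  proof -
    have a: "ph i < A" using php i by (simp add: is_policy_def)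
    obtain k where k: "k \<le> N" "\<bar>real k * e - qval S ?Kh ?rt \<gamma> ?V i (ph i)\<bar> \<le> e" using net[OF i] by blast
    let ?v = "optv S A (cutk i (ph i) ?Kh) (cutr i (ph i) (real k * e) ?rt) \<gamma>"
    have "bern S n L (?K i (ph i)) (?Kh i (ph i)) ?v"
      using rows i a k(1) by (simp add: good_rows_def pmf_kernel_def[abs_def])
    moreover have "\<bar>?v j - ?V j\<bar> \<le> e" if j: "j < S" for j
      using cut_optv_lipschitz[OF sKh g A j, of i "ph i" "real k * e" ?rt "qval S ?Kh ?rt \<gamma> ?V i (ph i)"]
        optv_cut_at_qval[OF sKh g opt j refl, of i "ph i"] k(2) by simp
    ultimately show ?thesis by blast
  qed
  have B2: "bern S n L (?K i (ph i)) (?Kh i (ph i)) (disc_value S ?K r ph \<gamma>)" if i: "i < S" for i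
  proof -
    have a: "ph i < A" using php i by (simp add: is_policy_def)
    obtain k where k: "k \<le> N" "\<bar>real k * e - qval S ?Kh ?rt \<gamma> ?V i (ph i)\<bar> \<le> e" using net[OF i] by blast
    let ?C = "cutk i (ph i) ?Kh" and ?c = "cutr i (ph i) (real k * e) ?rt" and ?q = "restrict ph {..<S}"
    \<comment> \<open>The action gap makes every optimal policy of the cut model agree with
      \<open>ph\<close> on all states, so \<open>ph\<close> is one of the policies already covered
      by the event, although it depends on all samples.\<close>
    have uniq: "q = ?q" if q: "q \<in> pols S A" "disc_optimal S A ?C ?c \<gamma> q" for q
    proof
      fix j
      show "q j = ?q j"
        using cut_unique_optimal[OF sKh g opt gap k(2) ew q(2) _ A, of j] q(1)
        by (cases "j < S") (auto simp: pols_def)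
    qed
    obtain q where q: "q \<in> pols S A" "disc_optimal S A ?C ?c \<gamma> q"
      using disc_optimal_exists[OF subkernel_cut[OF sKh] g A] by blast
    have "unique_optimal S A ?C ?c \<gamma> ?q"
      unfolding unique_optimal_def using q uniq restrict_pols[OF php] by blast
    then have "bern S n L (?K i (ph i)) (?Kh i (ph i)) (disc_value S ?K r ?q \<gamma>)"
      using rows i a k(1) restrict_pols[OF php] by (simp add: good_rows_def pmf_kernel_def[abs_def])
    then show ?thesis
      using bern_cong[of S "disc_value S ?K r ?q \<gamma>" "disc_value S ?K r ph \<gamma>" n L] disc_value_restrict by blast
  qed
  have Ap: "bern S n L (?K i (p i)) (?Kh i (p i)) (disc_value S ?K r p \<gamma>)" if "i < S" for i
    using rows pp that by (simp add: good_rows_def pmf_kernel_def[abs_def] is_policy_def)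
  define Vp where "Vp = disc_value S ?K r p \<gamma>"
  define G where "G = 1 + 500 * L * sqrt (real n * (2 * H + 1)) + 500 * L * sqrt (real n * (m + 2))"
  define \<rho> where "\<rho> = gain S ?K r p s"
  \<comment> \<open>Constancy of the optimal gain is used here: one number serves all states, so the
    discounted value of the reference policy has span at most 2 H.\<close>
  have near: "\<bar>Vp i - real n * \<rho>\<bar> \<le> H" if i: "i < S" for i
    using disc_value_near_gain[OF stochkernel_pstoch[OF K pp] g i, of r]
      weakly_communicating_gain_const[OF K A wc p i s]
    by (simp add: Vp_def \<rho>_def H_def gd mult.commute)
  have "span S Vp \<le> 2 * H"
  proof (rule span_le[OF S])
    fix i j assume "i < S" "j < S"
    then show "Vp i - Vp j \<le> 2 * H" using near[of i] near[of j] by linarith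
  qed
  then have spV: "500 * L * sqrt (real n * (span S Vp + 1)) \<le> 500 * L * sqrt (real n * (2 * H + 1))"
    using L by (intro mult_left_mono real_sqrt_le_mono) auto
  have mm: "m = min (span S (disc_value S ?Kh r ph \<gamma>)) (span S (disc_value S ?K r ph \<gamma>))"
    unfolding m_def gd
    by (simp only: span_bias_anchor[OF s0 eta stochkernel_pstoch[OF Kh php]]
        span_bias_anchor[OF s0 eta stochkernel_pstoch[OF K php]])
  have "Vp i - disc_value S ?K r ph \<gamma> i \<le> G" if i: "i < S" for i
    using good_sample_value_gap[OF K Kh n gd L r rt pp opt Ap B1 e(2) B2 i] spV
    unfolding G_def mm Vp_def by linarith
  then have "real n * \<rho> - H - G \<le> disc_value S ?K r ph \<gamma> i" if "i < S" for i
    using near[OF that] that by fastforce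
  then have "(1 - \<gamma>) * (real n * \<rho> - H - G) \<le> gain S ?K r ph s"
    by (intro gain_ge_disc_value[OF stochkernel_pstoch[OF K php] g s])
  moreover have "(1 - \<gamma>) * (real n * \<rho> - H - G) = \<rho> - (H + G) / real n"
    using n0 by (simp add: gd field_simps)
  ultimately show ?thesis by (simp add: \<rho>_def G_def add.assoc)
qed

section \<open>Numerical estimates and the choice of parameters\<close>

lemma ln_ge_half: "2 \<le> x \<Longrightarrow> 1 / 2 \<le> ln (x :: real)"
proof -
  assume x: "2 \<le> x"
  have "exp (1 / 2 :: real) \<le> 1 + 1 / 2 + (1 / 2)\<^sup>2" by (rule exp_bound) auto
  then have "exp (1 / 2 :: real) \<le> x" using x by (simp add: power2_eq_square)
  then show ?thesis using x by (subst ln_ge_iff) auto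
qed

text \<open>Gains lie in [0, 1], so nothing is left to prove when the right-hand side is at least 1.
  This covers small n and large spans.\<close>

lemma rate_trivial:
  fixes l Y :: real
  assumes l: "1 / 2 \<le> l" and n: "0 < n" and Y: "1 \<le> Y" and big: "real n \<le> 512 * l \<or> real n \<le> Y"
  shows "1 \<le> sqrt (10^9 * l ^ 3 / real n * Y)"
proof -
  have l3: "1 / 8 \<le> l ^ 3" using power_mono[OF l, of 3] by (simp add: power3_eq_cube)
  have "real n \<le> 10^9 * l ^ 3 * Y"
    using big
  proof
    assume b: "real n \<le> 512 * l"
    have "(1 / 4) * l \<le> l\<^sup>2 * l" using power_mono[OF l, of 2] l by (intro mult_right_mono) (auto simp: power2_eq_square)
    then have "512 * l \<le> 10^9 * l ^ 3 * 1" using l by (simp add: power3_eq_cube power2_eq_square)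
    also have "\<dots> \<le> 10^9 * l ^ 3 * Y" using Y l by (intro mult_left_mono) auto
    finally show ?thesis using b by linarith
  next
    assume b: "real n \<le> Y"
    have "1 * Y \<le> (10^9 * l ^ 3) * Y" using l3 Y by (intro mult_right_mono) auto
    then show ?thesis using b by simp
  qed
  then have "1 \<le> 10^9 * l ^ 3 / real n * Y" using n by (simp add: field_simps)
  then show ?thesis by simp
qed

text \<open>With y = (H + m + 1) / n \<le> 1, each root term is at most 4000 l times (3/2) sqrt y,
  as sqrt 2 \<le> 3/2, and the rest is at most sqrt y \<le> 2 l sqrt y. The total is 12002 l sqrt y;
  passing from l^2 to l^3 costs a factor 2, which leaves room below 10^9.\<close>

lemma rate_bound:
  fixes l H m d :: real
  assumes l: "1 / 2 \<le> l" and n: "0 < n" and H: "0 \<le> H" and m: "0 \<le> m" and d1: "d \<le> 1"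
    and d: "d \<le> (H + 1 + 500 * (8 * l) * sqrt (real n * (2 * H + 1)) + 500 * (8 * l) * sqrt (real n * (m + 2))) / real n"
  shows "d \<le> sqrt (10^9 * l ^ 3 / real n * (H + m + 1))"
proof (cases "real n \<le> H + m + 1")
  case True
  show ?thesis by (rule order_trans[OF d1 rate_trivial[OF l n _ disjI2[OF True]]]) (use H m in auto)
next
  case False
  define y where "y = (H + m + 1) / real n"
  have y: "0 \<le> y" "y \<le> 1" using False H m n by (auto simp: y_def)
  have sq: "sqrt (real n * z) / real n \<le> 3 / 2 * sqrt y" if z: "0 \<le> z" "z \<le> 2 * (H + m + 1)" for z
  proof -
    have "sqrt (real n * z) / real n = sqrt (real n * z / (real n)\<^sup>2)" using n by (simp add: real_sqrt_divide)
    also have "\<dots> = sqrt (z / real n)" using n by (simp add: power2_eq_square)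
    also have "\<dots> \<le> sqrt ((3 / 2)\<^sup>2 * y)"
    proof (intro real_sqrt_le_mono)
      have "z / real n \<le> 2 * (H + m + 1) / real n" using z by (intro divide_right_mono) auto
      also have "\<dots> = 2 * y" by (simp add: y_def)
      also have "\<dots> \<le> (3 / 2)\<^sup>2 * y" using y by (intro mult_right_mono) (auto simp: power2_eq_square)
      finally show "z / real n \<le> (3 / 2)\<^sup>2 * y" .
    qed
    also have "\<dots> = 3 / 2 * sqrt y" by (simp add: real_sqrt_mult)
    finally show ?thesis .
  qed
  have "(H + 1) / real n \<le> y" using m by (simp add: y_def divide_right_mono)
  also have "y \<le> sqrt y" using y by (intro real_le_rsqrt) (simp add: power2_eq_square mult_left_le)
  finally have t1: "(H + 1) / real n \<le> sqrt y" .
  have t2: "4000 * l * (sqrt (real n * (2 * H + 1)) / real n) \<le> 4000 * l * (3 / 2 * sqrt y)"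
    using l H m by (intro mult_left_mono sq) auto
  have t3: "4000 * l * (sqrt (real n * (m + 2)) / real n) \<le> 4000 * l * (3 / 2 * sqrt y)"
    using l H m by (intro mult_left_mono sq) auto
  have "d \<le> (H + 1) / real n + 4000 * l * (sqrt (real n * (2 * H + 1)) / real n)
      + 4000 * l * (sqrt (real n * (m + 2)) / real n)"
    using d by (simp add: add_divide_distrib)
  also have "\<dots> \<le> sqrt y + 12000 * (l * sqrt y)" using t1 t2 t3 by simp
  finally have "d \<le> sqrt y + 12000 * (l * sqrt y)" .
  moreover have "sqrt y \<le> 2 * (l * sqrt y)" using l y mult_right_mono[of "1 / 2" l "sqrt y"] by simp
  ultimately have "d \<le> 12002 * (l * sqrt y)" by linarith
  also have "12002 * (l * sqrt y) = sqrt ((12002 * l)\<^sup>2 * y)"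
    using l by (simp add: real_sqrt_mult)
  also have "\<dots> \<le> sqrt (10^9 * l ^ 3 * y)"
  proof (intro real_sqrt_le_mono mult_right_mono y)
    have "l\<^sup>2 * (1 / 2) \<le> l\<^sup>2 * l" using l by (intro mult_left_mono) auto
    then have "l\<^sup>2 \<le> 2 * l ^ 3" by (simp add: power3_eq_cube power2_eq_square)
    moreover have "0 \<le> l ^ 3" using l by simp
    ultimately have "144048004 * l\<^sup>2 \<le> 1000000000 * l ^ 3" by linarith
    then show "(12002 * l)\<^sup>2 \<le> 10^9 * l ^ 3" by (simp add: power_mult_distrib)
  qed
  finally show ?thesis by (simp add: y_def)
qed

text \<open>The parameters: \<open>L = 8 ln x\<close> beats the net size, which is of order \<open>x\<^sup>3\<close>.\<close>

lemma failure_budget: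
  fixes x :: real and S A n N :: nat
  assumes S: "0 < S" and A: "2 \<le> A" and n: "4 \<le> n" and d: "0 < \<delta>" "\<delta> < 1"
    and x: "x = real S * real A * real n / \<delta>"
    and N: "real N \<le> 16 * real S * real A * real n ^ 3 / \<delta> + 1"
  shows "real S * real A * real (2 * N + 3) * (3 * exp (- (8 * ln x))) \<le> \<delta> / 2"
proof -
  have SA: "1 \<le> real S" "2 \<le> real A" "4 \<le> real n" using S A n by auto
  have sa: "2 \<le> real S * real A" using mult_mono[of 1 "real S" 2 "real A"] SA by simp
  have san: "8 \<le> real S * real A * real n" using mult_mono[of 2 "real S * real A" 4 "real n"] sa SA by simp
  have xs: "real S * real A * real n \<le> x"
    unfolding x using d san by (simp add: pos_le_divide_eq mult_left_le)
  then have x8: "8 \<le> x" using san by linarith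
  have sax: "real S * real A \<le> x"
    using xs mult_left_mono[of 1 "real n" "real S * real A"] sa SA by linarith
  have dx: "1 \<le> \<delta> * x" unfolding x using d san by simp
  have nx: "real n \<le> x" using xs mult_right_mono[of 1 "real S * real A" "real n"] sa SA by linarith
  have "real S * real A * real n ^ 3 / \<delta> = x * (real n * real n)"
    by (simp add: x power3_eq_cube)
  also have "\<dots> \<le> x * (x * x)" using nx x8 SA by (intro mult_left_mono mult_mono) auto
  also have "\<dots> = x ^ 3" by (simp add: power3_eq_cube)
  finally have Nx: "real N \<le> 16 * x ^ 3 + 1" using N by simp
  have x3: "512 \<le> x ^ 3" using power_mono[OF x8, of 3] by simp
  have N3: "real (2 * N + 3) \<le> 33 * x ^ 3" using Nx x3 by simp
  have ex: "exp (- (8 * ln x)) = 1 / x ^ 8"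
  proof -
    have "exp (8 * ln x) = x ^ 8" using x8 exp_of_nat_mult[of 8 "ln x"] by simp
    then show ?thesis by (simp add: exp_minus inverse_eq_divide)
  qed
  have "real S * real A * real (2 * N + 3) * (3 * exp (- (8 * ln x))) \<le> (x * (33 * x ^ 3)) * (3 * (1 / x ^ 8))"
    unfolding ex using sax N3 x8 by (intro mult_mono) auto
  also have "\<dots> = 99 / x ^ 4" using x8 by (simp add: field_simps power_numeral_reduce)
  also have "\<dots> \<le> \<delta> / 2"
  proof -
    have "198 \<le> x ^ 3" using x3 by simp
    also have "x ^ 3 \<le> (\<delta> * x) * x ^ 3" using dx x8 mult_right_mono[OF dx, of "x ^ 3"] by simp
    also have "\<dots> = \<delta> * x ^ 4" by (simp add: power_numeral_reduce)
    finally show ?thesis using x8 by (simp add: field_simps)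
  qed
  finally show ?thesis .
qed

theorem mainTheorem7:
  "\<exists>C>0. \<forall>(S::nat) (A::nat) (n::nat) (P::nat \<Rightarrow> nat \<Rightarrow> nat pmf) (r::nat \<Rightarrow> nat \<Rightarrow> real) (s0::nat) (\<delta>::real).
     0 < S \<longrightarrow> 0 < A \<longrightarrow> 0 < n \<longrightarrow>
     (\<forall>s<S. \<forall>a<A. set_pmf (P s a) \<subseteq> {..<S}) \<longrightarrow>
     (\<forall>s<S. \<forall>a<A. 0 \<le> r s a \<and> r s a \<le> 1) \<longrightarrow>
     weakly_communicating S A (pmf_kernel P) \<longrightarrow>
     s0 < S \<longrightarrow> 0 < \<delta> \<longrightarrow> \<delta> < 1 \<longrightarrow>
     (let \<eta> = 1 / real n; \<xi> = 1 / (2 * real n ^ 2); M = sample_space S A n P \<xi> in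
      \<exists>E\<in>sets M. measure M E \<ge> 1 - \<delta> \<and>
        (\<forall>\<omega>\<in>E. \<forall>pihat.
           blackwell_optimal S A (anchor s0 \<eta> (emp_kernel n (fst \<omega>))) (perturb r (snd \<omega>)) pihat \<longrightarrow>
           (\<forall>s<S. opt_gain S A (pmf_kernel P) r s - gain S (pmf_kernel P) r pihat s \<le>
              sqrt (C * ln (real S * real A * real n / \<delta>) ^ 3 / real n *
                (span S (opt_bias S A (pmf_kernel P) r)
                 + min (span S (bias S (anchor s0 \<eta> (emp_kernel n (fst \<omega>))) r pihat))
                       (span S (bias S (anchor s0 \<eta> (pmf_kernel P)) r pihat))
                 + 1)))))"
proof (rule exI[of _ "10 ^ 9"], intro conjI allI impI)
  show "(0::real) < 10 ^ 9" by simp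
  fix S A n :: nat and P :: "nat \<Rightarrow> nat \<Rightarrow> nat pmf" and r :: "nat \<Rightarrow> nat \<Rightarrow> real" and s0 :: nat and \<delta> :: real
  assume S: "0 < S" and A: "0 < A" and n: "0 < n"
    and sup': "\<forall>s<S. \<forall>a<A. set_pmf (P s a) \<subseteq> {..<S}"
    and r': "\<forall>s<S. \<forall>a<A. 0 \<le> r s a \<and> r s a \<le> 1"
    and wc: "weakly_communicating S A (pmf_kernel P)" and s0: "s0 < S" and d: "0 < \<delta>" "\<delta> < 1"
  let ?K = "pmf_kernel P"
  define \<eta> where "\<eta> = 1 / real n"
  define \<xi> where "\<xi> = 1 / (2 * real n ^ 2)"
  define x where "x = real S * real A * real n / \<delta>"
  define p where "p = (SOME p. blackwell_optimal S A ?K r p)"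
  note sup = sup'[rule_format] and r = r'[rule_format]
  have xi: "0 < \<xi>" using n by (simp add: \<xi>_def)
  have K: "stochkernel S A ?K"
    using stoch_pmf[OF sup] by (simp add: stochkernel_def pmf_kernel_def[abs_def])
  have p: "blackwell_optimal S A ?K r p"
    unfolding p_def using blackwell_exists[OF K A] by (rule someI_ex)
  have og: "opt_gain S A ?K r = gain S ?K r p" and ob: "opt_bias S A ?K r = bias S ?K r p"
    by (simp_all add: opt_gain_def opt_bias_def p_def)
  have pp: "is_policy S A p" using p by (simp add: blackwell_optimal_def)
  have sn1: "1 \<le> real S * real n" using S n by (metis One_nat_def Suc_leI nat_0_less_mult_iff of_nat_1 of_nat_le_iff of_nat_mult)
  define RHS where "RHS Kh q = sqrt (10 ^ 9 * ln x ^ 3 / real n *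
      (span S (bias S ?K r p) + min (span S (bias S (anchor s0 \<eta> Kh) r q)) (span S (bias S (anchor s0 \<eta> ?K) r q)) + 1))"
    for Kh q
  have spans: "0 \<le> span S (bias S ?K r p)"
    "0 \<le> min (span S (bias S (anchor s0 \<eta> Kh) r q)) (span S (bias S (anchor s0 \<eta> ?K) r q))" for Kh q
    using span_nonneg[OF S] by auto
  have gap1: "gain S ?K r p s - gain S ?K r q s \<le> 1" if "is_policy S A q" "s < S" for q s
  proof -
    have "gain S ?K r p s \<le> 1"
      by (rule gain_bounds(2)[OF stochkernel_pstoch[OF K pp] _ that(2)]) (use r pp in \<open>auto simp: is_policy_def\<close>)
    moreover have "0 \<le> gain S ?K r q s"
      by (rule gain_bounds(1)[OF stochkernel_pstoch[OF K that(1)] _ that(2)]) (use r that in \<open>auto simp: is_policy_def\<close>)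
    ultimately show ?thesis by linarith
  qed
  have "\<exists>E\<in>sets (sample_space S A n P \<xi>). measure (sample_space S A n P \<xi>) E \<ge> 1 - \<delta> \<and>
        (\<forall>\<omega>\<in>E. \<forall>q. blackwell_optimal S A (anchor s0 \<eta> (emp_kernel n (fst \<omega>))) (perturb r (snd \<omega>)) q \<longrightarrow>
           (\<forall>s<S. gain S ?K r p s - gain S ?K r q s \<le> RHS (emp_kernel n (fst \<omega>)) q))"
    (is "\<exists>E\<in>sets ?M. _")
  \<comment> \<open>In these cases the whole space serves as event. With one action all policies
    coincide; this case is separated because \<open>ln x\<close> may then be arbitrarily close to 0.
    Otherwise \<open>ln x\<close> is at least 1/2 and n \<le> 512 ln x, so the bound exceeds
    1.\<close>
  proof (cases "A = 1 \<or> n < 4 \<or> real n < 64 * (8 * ln x)")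
    case True
    have prob: "prob_space ?M"
    proof -
      interpret M1: prob_space "sample_measure S A n P" by (rule prob_space_sample_measure)
      interpret M2: prob_space "noise S A \<xi>" by (rule prob_space_noise[OF xi])
      interpret pair_prob_space "sample_measure S A n P" "noise S A \<xi>" ..
      show ?thesis unfolding sample_space_eq by (rule P.prob_space_axioms)
    qed
    have "gain S ?K r p s - gain S ?K r q s \<le> RHS Kh q" if q: "is_policy S A q" and s: "s < S" for q s Kh
    proof (cases "A = 1")
      case True
      have "gain S ?K r p s = gain S ?K r q s"
        by (rule gain_cong_policy[OF _ s]) (use pp q True in \<open>auto simp: is_policy_def\<close>)
      moreover have "1 \<le> x"
      proof -
        have "\<delta> \<le> real S * real n" using sn1 d by linarith
        then show ?thesis using True d by (simp add: x_def)
      qed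
      then have "0 \<le> RHS Kh q" unfolding RHS_def using spans(1) spans(2)[of Kh q]
        by (intro real_sqrt_ge_zero mult_nonneg_nonneg divide_nonneg_nonneg zero_le_power add_nonneg_nonneg) auto
      ultimately show ?thesis by simp
    next
      case False
      then have A2: "2 \<le> real A" using A by simp
      have "2 * \<delta> \<le> real A * (real S * real n)" using mult_mono[OF A2 sn1] d A2 by linarith
      then have "2 \<le> x" using d by (simp add: x_def pos_le_divide_eq mult_ac)
      then have l: "1 / 2 \<le> ln x" by (rule ln_ge_half)
      have "real n \<le> 512 * ln x"
      proof -
        have "real n < 4 \<or> real n < 512 * ln x" using True False by auto
        then show ?thesis using l by linarith
      qed
      then have "1 \<le> RHS Kh q"
        unfolding RHS_def using spans(1) spans(2)[of Kh q] by (intro rate_trivial[OF l n]) auto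
      then show ?thesis using gap1[OF q s] by linarith
    qed
    then show ?thesis
      using prob_space.prob_space[OF prob] d
      by (intro bexI[of _ "space ?M"]) (auto simp: blackwell_optimal_def)
  next
    case False
    then have A2: "2 \<le> A" and n4: "4 \<le> n" and Ln: "64 * (8 * ln x) \<le> real n" using A by auto
    define L where "L = 8 * ln x"
    \<comment> \<open>The tie width spends half of \<delta> on near ties over all S A pairs. The
      mesh is half the width, as exact recovery of the policy requires, and \<open>N\<close> lets
      the net reach 2 n.\<close>
    define w where "w = \<delta> * \<xi> / (2 * real S * real A)"
    define e where "e = w / 2"
    define N where "N = nat \<lceil>2 * real n / e\<rceil>"
    define \<gamma> where "\<gamma> = 1 - 1 / real n"
    have Ar: "2 \<le> real A" and nr: "4 \<le> real n" and Sr: "1 \<le> real S" using A2 n4 S by auto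
    have san: "8 \<le> real S * real A * real n"
      using mult_mono[of 2 "real S * real A" 4 "real n"] mult_mono[of 1 "real S" 2 "real A"] Ar nr Sr by simp
    have "real S * real A * real n \<le> x"
      unfolding x_def using d san by (simp add: pos_le_divide_eq mult_left_le)
    then have x2: "2 \<le> x" using san by linarith
    have l: "1 / 2 \<le> ln x" using x2 by (rule ln_ge_half)
    have L1: "1 \<le> L" using l by (simp add: L_def)
    have w0: "0 < w" using d xi S A by (simp add: w_def)
    have e0: "0 < e" using w0 by (simp add: e_def)
    have ee: "e = \<delta> / (8 * real S * real A * real n ^ 2)" by (simp add: e_def w_def \<xi>_def)
    have "40 * e * real n = 5 * \<delta> / (real S * real A * real n)"
      using S A n by (simp add: ee power2_eq_square field_simps)
    also have "\<dots> \<le> 1" using d san by (simp add: divide_le_eq)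
    finally have en: "40 * e * real n \<le> 1" .
    have "2 * real n / e \<le> real N" unfolding N_def by (rule real_nat_ceiling_ge)
    then have Ne: "2 * real n \<le> real N * e" using e0 by (simp add: pos_divide_le_eq)
    have "real N \<le> 2 * real n / e + 1"
    proof -
      have "0 \<le> 2 * real n / e" using e0 by simp
      then have "real N = of_int \<lceil>2 * real n / e\<rceil>" by (simp add: N_def)
      then show ?thesis by linarith
    qed
    also have "2 * real n / e = 16 * real S * real A * real n ^ 3 / \<delta>"
      using d by (simp add: ee power3_eq_cube power2_eq_square)
    finally have Nb: "real N \<le> 16 * real S * real A * real n ^ 3 / \<delta> + 1" .
    define E where "E = {z \<in> space ?M. good_rows S A n P r \<gamma> L e N (disc_value S ?K r p \<gamma>) (fst z) (snd z) \<and>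
      good_noise S A n r \<gamma> w \<xi> (fst z) (snd z)}"
    note likely = good_event_likely[OF _ n order_trans[OF zero_le_one L1] xi less_imp_le[OF w0] E_def]
    have E: "E \<in> sets ?M" by (rule likely(1)) (rule sup)
    have "1 - (real S * real A * real (2 * N + 3) * (3 * exp (- L)) + real S * real A * (w / \<xi>)) \<le> measure ?M E"
      by (rule likely(2)) (rule sup)
    note likely = this
    have f1: "real S * real A * real (2 * N + 3) * (3 * exp (- L)) \<le> \<delta> / 2"
      unfolding L_def by (rule failure_budget[OF S A2 n4 d x_def Nb])
    have f2: "real S * real A * (w / \<xi>) = \<delta> / 2" using S A xi by (simp add: w_def)
    have mE: "1 - \<delta> \<le> measure ?M E" using likely f1 f2 by linarith
    have "gain S ?K r p s - gain S ?K r q s \<le> RHS (emp_kernel n (fst z)) q"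
      if z: "z \<in> E" and q: "blackwell_optimal S A (anchor s0 \<eta> (emp_kernel n (fst z))) (perturb r (snd z)) q"
        and s: "s < S" for z q s
      unfolding RHS_def
    proof (rule rate_bound[OF l n spans])
      show "gain S ?K r p s - gain S ?K r q s \<le> 1"
        using q by (intro gap1 s) (simp add: blackwell_optimal_def)
      show "gain S ?K r p s - gain S ?K r q s \<le> (span S (bias S ?K r p) + 1
          + 500 * (8 * ln x) * sqrt (real n * (2 * span S (bias S ?K r p) + 1))
          + 500 * (8 * ln x) * sqrt (real n * (min (span S (bias S (anchor s0 \<eta> (emp_kernel n (fst z))) r q))
              (span S (bias S (anchor s0 \<eta> ?K) r q)) + 2))) / real n"
        unfolding L_def[symmetric] \<eta>_def
      proof (rule good_event_gain_gap[where X = "fst z" and D = "snd z" and N = N and e = e and w = w and \<gamma> = \<gamma>])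
        show "64 * L \<le> real n" using Ln by (simp add: L_def)
        show "2 * e \<le> w" by (simp add: e_def)
      qed (use sup r A wc s0 n4 L1 e0 en Ne p z q s in \<open>auto simp: \<gamma>_def E_def \<xi>_def \<eta>_def\<close>)
    qed
    then show ?thesis using E mE by blast
  qed
  then show "let \<eta> = 1 / real n; \<xi> = 1 / (2 * real n ^ 2); M = sample_space S A n P \<xi> in
      \<exists>E\<in>sets M. measure M E \<ge> 1 - \<delta> \<and>
        (\<forall>\<omega>\<in>E. \<forall>pihat.
           blackwell_optimal S A (anchor s0 \<eta> (emp_kernel n (fst \<omega>))) (perturb r (snd \<omega>)) pihat \<longrightarrow>
           (\<forall>s<S. opt_gain S A (pmf_kernel P) r s - gain S (pmf_kernel P) r pihat s \<le>
              sqrt (10 ^ 9 * ln (real S * real A * real n / \<delta>) ^ 3 / real n *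
                (span S (opt_bias S A (pmf_kernel P) r)
                 + min (span S (bias S (anchor s0 \<eta> (emp_kernel n (fst \<omega>))) r pihat))
                       (span S (bias S (anchor s0 \<eta> (pmf_kernel P)) r pihat))
                 + 1))))"
    unfolding Let_def og ob RHS_def x_def \<eta>_def \<xi>_def .
qed

end
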